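(* Let $a>b>0$ and for $c>0$ let $S_c=\{x^{-c}e^{\mathbf{i}x}\in\mathbb{C}: x>0\}$. For every $K\ge 1$: there exists a $K$-quasiconformal map $f:\mathbb{C}\to\mathbb{C}$ with $f(S_a)=S_b$ if and only if $K\ge \tfrac{a}{b}$.
   Context: Here $\mathbf{i}$ is the imaginary unit. A homeomorphism $f:\Omega\to\Omega'$ between domains in $\mathbb{C}=\mathbb{R}^2$ is $K$-quasiconformal ($K\ge1$) if $f$ lies in the local Sobolev space $W^{1,2}_{loc}(\Omega:\mathbb{R}^2)$ and $|Df|^2\le K\det Df$ a.e. in $\Omega$, where $|Df|$ is the operator norm of the (a.e. defined) differential matrix. The dilatation $K_f$ is the smallest $K$ for which this inequality holds a.e.; thus $f$ is $K$-quasiconformal iff $f$ is quasiconformal and $K_f\le K$. A quasiconformal map $f:\mathbb{C}\to\mathbb{C}$ is a homeomorphism of $\mathbb{C}$ onto $\mathbb{C}$. *)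

theory Defs
  imports "HOL-Analysis.Analysis"
begin

text \<open>
  Smoothness on the whole space. The derivative of order \<open>Suc k\<close> is accessed through all
  directional derivatives, which in finite dimension is the usual class \<open>C^k\<close>.
\<close>

primrec Ck :: "nat \<Rightarrow> ('a::euclidean_space \<Rightarrow> 'b::real_normed_vector) \<Rightarrow> bool" where
  "Ck 0 f \<longleftrightarrow> continuous_on UNIV f"
| "Ck (Suc k) f \<longleftrightarrow>
     f differentiable_on UNIV \<and> (\<forall>v. Ck k (\<lambda>x. frechet_derivative f (at x) v))"

definition test_function :: "'a::euclidean_space set \<Rightarrow> ('a \<Rightarrow> real) \<Rightarrow> bool" where
  "test_function \<Omega> \<phi> \<longleftrightarrow>
     (\<forall>k. Ck k \<phi>) \<and> compact (closure {z. \<phi> z \<noteq> 0}) \<and> closure {z. \<phi> z \<noteq> 0} \<subseteq> \<Omega>"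

definition Lp_loc ::
    "nat \<Rightarrow> 'a::euclidean_space set \<Rightarrow> ('a \<Rightarrow> 'b::euclidean_space) \<Rightarrow> bool" where
  "Lp_loc p \<Omega> u \<longleftrightarrow>
     u \<in> borel_measurable (lebesgue_on \<Omega>) \<and>
     (\<forall>C. compact C \<and> C \<subseteq> \<Omega> \<longrightarrow> set_integrable lebesgue C (\<lambda>z. norm (u z) ^ p))"

text \<open>
  \<open>g\<close> is a weak (distributional) derivative of \<open>u\<close> on \<open>\<Omega>\<close> in direction \<open>v\<close>;
  it is determined up to null sets.
\<close>

definition weak_partial ::
    "'a::euclidean_space set \<Rightarrow> 'a \<Rightarrow> ('a \<Rightarrow> 'b::euclidean_space) \<Rightarrow> ('a \<Rightarrow> 'b) \<Rightarrow> bool" where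
  "weak_partial \<Omega> v u g \<longleftrightarrow>
     Lp_loc 1 \<Omega> u \<and> Lp_loc 1 \<Omega> g \<and>
     (\<forall>\<phi>. test_function \<Omega> \<phi> \<longrightarrow>
        (LINT z:\<Omega>|lebesgue. frechet_derivative \<phi> (at z) v *\<^sub>R u z) =
        - (LINT z:\<Omega>|lebesgue. \<phi> z *\<^sub>R g z))"

text \<open>
  Under the identification of \<open>\<complex>\<close> with the real plane, the differential matrix of a map with
  partial derivatives \<open>p\<close> (in direction \<open>1\<close>) and \<open>q\<close> (in direction \<open>\<i>\<close>) has columns \<open>p\<close> and \<open>q\<close>.
\<close>

definition diff_matrix :: "complex \<Rightarrow> complex \<Rightarrow> real^2^2" where
  "diff_matrix p q = vector [vector [Re p, Re q], vector [Im p, Im q]]"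

definition W12_loc :: "complex set \<Rightarrow> (complex \<Rightarrow> complex) \<Rightarrow> bool" where
  "W12_loc \<Omega> f \<longleftrightarrow>
     Lp_loc 2 \<Omega> f \<and>
     (\<exists>fx fy. weak_partial \<Omega> 1 f fx \<and> weak_partial \<Omega> \<i> f fy \<and> Lp_loc 2 \<Omega> fx \<and> Lp_loc 2 \<Omega> fy)"

definition distortion_inequality ::
    "real \<Rightarrow> complex set \<Rightarrow> (complex \<Rightarrow> complex) \<Rightarrow> bool" where
  "distortion_inequality K \<Omega> f \<longleftrightarrow>
     (\<exists>fx fy. weak_partial \<Omega> 1 f fx \<and> weak_partial \<Omega> \<i> f fy \<and>
        (AE z in lebesgue_on \<Omega>.
           (onorm (\<lambda>h. diff_matrix (fx z) (fy z) *v h))\<^sup>2 \<le> K * det (diff_matrix (fx z) (fy z))))"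

definition quasiconformal_map ::
    "real \<Rightarrow> complex set \<Rightarrow> complex set \<Rightarrow> (complex \<Rightarrow> complex) \<Rightarrow> bool" where
  "quasiconformal_map K \<Omega> \<Omega>' f \<longleftrightarrow>
     1 \<le> K \<and>
     open \<Omega> \<and> connected \<Omega> \<and> \<Omega> \<noteq> {} \<and> open \<Omega>' \<and> connected \<Omega>' \<and> \<Omega>' \<noteq> {} \<and>
     (\<exists>g. homeomorphism \<Omega> \<Omega>' f g) \<and>
     W12_loc \<Omega> f \<and> distortion_inequality K \<Omega> f"

definition spiral :: "real \<Rightarrow> complex set" where
  "spiral c = {of_real (x powr (- c)) * exp (\<i> * of_real x) | x::real. x > 0}"

end

theory Submission
  imports Defs
begin

text \<open>
Near the origin the only invariant of a power spiral is how fast its radius decays in terms of the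
angle that it has accumulated: on the spiral with exponent \<open>c\<close>, radius \<open>r\<close> belongs to angle
\<open>r powr (- 1 / c)\<close>. The radial stretch \<open>\<bar>z\<bar> powr (b / a - 1) * z\<close> carries one decay rate to the
other and has dilatation \<open>a / b\<close>; this settles one direction (\<open>quasiconformal_radial\<close> and
\<open>radial_spiral\<close>). The other direction says that no map can do better.

Let \<open>f\<close> be \<open>K\<close>-quasiconformal with \<open>f ` spiral a = spiral b\<close>. Then \<open>f 0 = 0\<close>, and \<open>f\<close> lifts through
the exponential to a map \<open>W\<close> of the logarithmic plane that commutes, up to sign, with translation
by \<open>2 * pi * \<i>\<close>. Write \<open>w = s + \<i> * \<theta>\<close>. Everything follows from one
inequality, \<open>smooth_log_approximation\<close>: over one period strip, the part of the Dirichlet integral of \<open>W\<close>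
where \<open>Re W\<close> lies in an interval of length \<open>l\<close> is at most \<open>2 * pi * K * l\<close>. Indeed the distortion
inequality replaces the squared gradient by \<open>K\<close> times the Jacobian, and the integral of
\<open>h (Re W)\<close> times the Jacobian is a boundary term, by Stokes and periodicity; at the ends of a long
strip the primitive of \<open>h\<close> is constant along the boundary circles, so that the boundary
term is \<open>2 * pi\<close> times the integral of \<open>h\<close>.

Suppose now \<open>K < a / b\<close> and choose \<open>\<beta>\<close> strictly between \<open>b / a\<close> and \<open>1 / K\<close>. Three uses of the
inequality contradict each other.
 \<^item> Depth (\<open>deep_point\<close>): each circle \<open>s = const\<close> has an image of length at least \<open>2 * pi\<close>, so by
   Cauchy-Schwarz the image of the strip \<open>- L \<le> s \<le> 0\<close> must reach down to
   \<open>Re W \<le> C - L / K\<close>. A minimum principle for homeomorphisms puts such a point on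
   every circle \<open>s \<le> - L\<close>.
 \<^item> Rotation (\<open>rotation_bound\<close>): the spirals cut the logarithmic plane into channels, and \<open>W\<close>
   maps channels to channels, up to a fixed shift and orientation of their numbering (\<open>spiral_rotation\<close>). If the whole circle \<open>s = - L\<close> went below \<open>Re W = - \<beta> * L\<close>, then along every radius
   the argument of the image would turn by at least \<open>exp (\<beta> * L / b) - exp (L / a) - C\<close>, which is
   exponentially large, while the area available above the level \<open>- \<beta> * L\<close> grows
   only linearly in \<open>L\<close>.
 \<^item> Crossing (\<open>crossing_bound\<close>): hence for large \<open>L\<close> every circle has both a point above \<open>- \<beta> * L\<close>
   and a point below \<open>C - L / K\<close>. A unit strip of circles that all cross the levels in between
   forces the gap between these levels to be bounded, but the gap is \<open>(1 / K - \<beta>) * L - C\<close>.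

The differential of a Sobolev map is only given weakly. To have classical calculus, \<open>f\<close> is
mollified: \<open>quasiconformal_smooth_approximation\<close> produces smooth maps uniformly close to \<open>f\<close> on a disc whose
failure to satisfy the distortion inequality is small in the mean. The estimates are carried out for logarithms of
these maps, and the error is absorbed in an additive constant.
\<close>

section \<open>Smooth functions\<close>

lemma Ck_SucD: "Ck (Suc k) f \<Longrightarrow> Ck k f"
proof (induction k arbitrary: f)
  case 0
  then show ?case by (auto intro: differentiable_imp_continuous_on)
qed auto

lemma Ck_const: "Ck k (\<lambda>x. c)"
  by (induction k arbitrary: c) auto

lemma Ck_add: "Ck k f \<Longrightarrow> Ck k g \<Longrightarrow> Ck k (\<lambda>x. f x + g x)"
proof (induction k arbitrary: f g)
  case 0
  then show ?case by (auto intro: continuous_intros)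
next
  case (Suc k)
  have df: "f differentiable (at x)" and dg: "g differentiable (at x)" for x
    using Suc.prems by (auto simp: differentiable_on_def)
  have "frechet_derivative (\<lambda>x. f x + g x) (at x) = (\<lambda>v. frechet_derivative f (at x) v + frechet_derivative g (at x) v)" for x
    by (rule frechet_derivative_at[symmetric])
      (intro has_derivative_add; use df dg frechet_derivative_works in blast)
  then show ?case using Suc df dg by (auto simp: differentiable_on_def)
qed

text \<open>
The Leibniz rule reduces order \<open>Suc k\<close> to products of order \<open>k\<close>, in which one factor is an
undifferentiated one; this is why \<open>Ck_SucD\<close> is needed.
\<close>

lemma Ck_mult:
  fixes f g :: "'a::euclidean_space \<Rightarrow> real"
  shows "Ck k f \<Longrightarrow> Ck k g \<Longrightarrow> Ck k (\<lambda>x. f x * g x)"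
proof (induction k arbitrary: f g)
  case 0
  then show ?case by (auto intro: continuous_intros)
next
  case (Suc k)
  have df: "f differentiable (at x)" and dg: "g differentiable (at x)" for x
    using Suc.prems by (auto simp: differentiable_on_def)
  have "frechet_derivative (\<lambda>x. f x * g x) (at x) =
      (\<lambda>v. f x * frechet_derivative g (at x) v + frechet_derivative f (at x) v * g x)" for x
    by (rule frechet_derivative_at[symmetric])
      (intro has_derivative_mult; use df dg frechet_derivative_works in blast)
  moreover have "Ck k f" "Ck k g" using Suc.prems Ck_SucD by blast+
  ultimately show ?case using Suc df dg by (auto simp: differentiable_on_def intro!: Ck_add)
qed

text \<open>
The derivative of \<open>exp (- 1 / t)\<close>, extended by zero, leaves the class of such functions; closing up under
differentiation gives this family, which is stable because \<open>flat n\<close> differentiates to a combination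
of \<open>flat (n + 2)\<close> and \<open>flat (n + 1)\<close>.
\<close>

definition flat :: "nat \<Rightarrow> real \<Rightarrow> real" where
  "flat n t = (if t > 0 then exp (- inverse t) * inverse t ^ n else 0)"

text \<open>
With \<open>x = 1 / t\<close> this is the statement that exponentials dominate powers at infinity.
\<close>

lemma flat_tendsto_0: "(flat n \<longlongrightarrow> 0) (at 0)"
proof -
  have "((\<lambda>t. exp (- inverse t) * inverse t ^ n) \<longlongrightarrow> 0) (at_right (0::real))"
  proof -
    have "((\<lambda>x::real. x ^ n / exp x) \<longlongrightarrow> 0) at_top" by (rule tendsto_power_div_exp_0)
    from filterlim_compose[OF this filterlim_inverse_at_top_right]
    show ?thesis by (simp add: exp_minus field_simps)
  qed
  then have "(flat n \<longlongrightarrow> 0) (at_right 0)"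
    by (rule Lim_transform_eventually)
      (auto simp: flat_def eventually_at_filter)
  moreover have "(flat n \<longlongrightarrow> 0) (at_left 0)"
    by (rule Lim_transform_eventually[OF tendsto_const])
      (auto simp: flat_def eventually_at_filter)
  ultimately show ?thesis by (simp add: filterlim_at_split)
qed

lemma flat_has_derivative:
  "(flat n has_real_derivative (flat (n + 2) t - real n * flat (n + 1) t)) (at t)"
proof (cases t "0::real" rule: linorder_cases)
  case less
  have "((\<lambda>_. 0) has_real_derivative 0) (at t)" by simp
  then have "(flat n has_real_derivative 0) (at t)"
    by (rule has_field_derivative_transform_within_open[of _ _ _ "{..<0}"])
      (use less in \<open>auto simp: flat_def\<close>)
  then show ?thesis using less by (simp add: flat_def)
next
  case equal
  have "((\<lambda>h. (flat n h - flat n 0) / (h - 0)) \<longlongrightarrow> 0) (at 0)"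
    by (rule Lim_transform_eventually[OF flat_tendsto_0[of "n + 1"]])
      (auto simp: flat_def eventually_at_filter field_simps)
  then show ?thesis using equal by (simp add: has_field_derivative_iff flat_def)
next
  case greater
  have "((\<lambda>t. exp (- inverse t) * inverse t ^ n) has_real_derivative
      exp (- inverse t) * inverse t ^ 2 * inverse t ^ n
        + exp (- inverse t) * (real n * inverse t ^ (n - 1) * (- (inverse t ^ 2)))) (at t)"
    using greater by (auto intro!: derivative_eq_intros simp: power2_eq_square)
  moreover have "exp (- inverse t) * inverse t ^ 2 * inverse t ^ n
      + exp (- inverse t) * (real n * inverse t ^ (n - 1) * (- (inverse t ^ 2)))
      = flat (n + 2) t - real n * flat (n + 1) t"
    using greater by (cases n) (simp_all add: flat_def power2_eq_square algebra_simps)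
  ultimately have "((\<lambda>t. exp (- inverse t) * inverse t ^ n) has_real_derivative
      (flat (n + 2) t - real n * flat (n + 1) t)) (at t)"
    by simp
  then show ?thesis
    by (rule has_field_derivative_transform_within_open[of _ _ _ "{0<..}"])
      (use greater in \<open>auto simp: flat_def\<close>)
qed

lemma continuous_flat [continuous_intros]:
  "continuous_on S f \<Longrightarrow> continuous_on S (\<lambda>x. flat n (f x))"
  using continuous_on_compose2[of UNIV "flat n" S f] flat_has_derivative
  by (metis DERIV_isCont UNIV_I continuous_at_imp_continuous_on subset_UNIV)

lemma Ck_flat_affine:
  fixes l :: "'a::euclidean_space \<Rightarrow> real"
  assumes l: "bounded_linear l"
  shows "Ck k (\<lambda>x. flat n (c + l x))"
proof (induction k arbitrary: n)
  case 0
  have "continuous_on UNIV l" using l by (rule linear_continuous_on)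
  then show ?case unfolding Ck.simps by (intro continuous_intros)
next
  case (Suc k)
  have der: "((\<lambda>x. flat n (c + l x)) has_derivative
     (\<lambda>v. l v * (flat (n + 2) (c + l x) - real n * flat (n + 1) (c + l x)))) (at x)" for x
  proof -
    have "((\<lambda>x. c + l x) has_derivative l) (at x)"
      using l bounded_linear_imp_has_derivative[OF l] by (auto intro!: derivative_eq_intros)
    from has_derivative_compose[OF this flat_has_derivative[of n "c + l x", unfolded has_field_derivative_def]]
    show ?thesis by (simp add: mult.commute)
  qed
  have "frechet_derivative (\<lambda>x. flat n (c + l x)) (at x) =
     (\<lambda>v. l v * (flat (n + 2) (c + l x) - real n * flat (n + 1) (c + l x)))" for x
    using frechet_derivative_at[OF der] by simp
  moreover have "(\<lambda>x. flat n (c + l x)) differentiable_on UNIV"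
    using der by (auto simp: differentiable_on_def differentiable_def intro: has_derivative_at_withinI)
  moreover have "Ck k (\<lambda>x. l v * (flat (n + 2) (c + l x) - real n * flat (n + 1) (c + l x)))" for v
  proof -
    have "Ck k (\<lambda>x. l v * (flat (n + 2) (c + l x) + (- real n) * flat (n + 1) (c + l x)))"
      by (intro Ck_mult Ck_const Ck_add Suc.IH)
    then show ?thesis by simp
  qed
  ultimately show ?case by simp
qed

definition bump :: "real \<Rightarrow> real \<Rightarrow> real" where
  "bump d t = flat 0 (1 + t / d) * flat 0 (1 + - t / d)"

text \<open>
Besides abstract smoothness, the mollified maps need their first and second partial derivatives
as explicit continuous functions with equal mixed derivatives. A product of two one-variable bumps delivers
them from the two derivatives given here.
\<close>

lemma bump_C2:
  assumes "d > 0"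
  obtains b1 b2 where "continuous_on UNIV b1" "continuous_on UNIV b2"
    "\<And>t. (bump d has_real_derivative b1 t) (at t)"
    "\<And>t. (b1 has_real_derivative b2 t) (at t)"
proof -
  define b1 where "b1 t = (flat 2 (1 + t / d) * flat 0 (1 + - t / d) - flat 0 (1 + t / d) * flat 2 (1 + - t / d)) / d" for t
  define b2 where "b2 t = ((flat 4 (1 + t / d) - 2 * flat 3 (1 + t / d)) * flat 0 (1 + - t / d)
      - 2 * flat 2 (1 + t / d) * flat 2 (1 + - t / d)
      + flat 0 (1 + t / d) * (flat 4 (1 + - t / d) - 2 * flat 3 (1 + - t / d))) / d / d" for t
  have p: "((\<lambda>t. flat n (1 + t / d)) has_real_derivative (flat (n + 2) (1 + t / d) - real n * flat (n + 1) (1 + t / d)) * (1 / d)) (at t)" for n t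
    using assms by (intro DERIV_chain2[OF flat_has_derivative]) (auto intro!: derivative_eq_intros)
  have m: "((\<lambda>t. flat n (1 + - t / d)) has_real_derivative (flat (n + 2) (1 + - t / d) - real n * flat (n + 1) (1 + - t / d)) * (- 1 / d)) (at t)" for n t
    using assms by (intro DERIV_chain2[OF flat_has_derivative]) (auto intro!: derivative_eq_intros)
  have 1: "(bump d has_real_derivative b1 t) (at t)" for t
    using DERIV_mult[OF p[of 0 t] m[of 0 t]]
    unfolding bump_def[abs_def] b1_def
    by (simp add: algebra_simps diff_divide_distrib numeral_2_eq_2)
  have 2: "(b1 has_real_derivative b2 t) (at t)" for t
    using DERIV_cdivide[OF DERIV_diff[OF DERIV_mult[OF p[of 2 t] m[of 0 t]] DERIV_mult[OF p[of 0 t] m[of 2 t]]], of d]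
    unfolding b1_def[abs_def] b2_def
    by (simp add: algebra_simps diff_divide_distrib add_divide_distrib numeral_2_eq_2 numeral_3_eq_3 numeral_eq_Suc)
  have "continuous_on UNIV b2"
    using assms unfolding b2_def[abs_def] by (auto intro!: continuous_intros)
  moreover have "continuous_on UNIV b1"
    using 2 by (metis DERIV_isCont continuous_at_imp_continuous_on)
  ultimately show ?thesis using that 1 2 by blast
qed

lemma bump_eq_0: "d > 0 \<Longrightarrow> \<bar>t\<bar> \<ge> d \<Longrightarrow> bump d t = 0"
  by (auto simp: bump_def flat_def field_simps abs_real_def split: if_splits)

lemma bump_nonneg: "0 \<le> bump d t"
  by (auto simp: bump_def flat_def)

lemma bump_0: "0 < bump d 0"
  by (auto simp: bump_def flat_def)

section \<open>Mollifiers\<close>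

definition C1_kernel :: "real \<Rightarrow> (complex \<Rightarrow> real) \<Rightarrow> (complex \<Rightarrow> real) \<Rightarrow> (complex \<Rightarrow> real) \<Rightarrow> bool" where
  "C1_kernel d \<kappa> \<kappa>x \<kappa>y \<longleftrightarrow>
     continuous_on UNIV \<kappa> \<and> continuous_on UNIV \<kappa>x \<and> continuous_on UNIV \<kappa>y \<and>
     (\<forall>z. norm z > d \<longrightarrow> \<kappa> z = 0 \<and> \<kappa>x z = 0 \<and> \<kappa>y z = 0) \<and>
     (\<forall>z. (\<kappa> has_derivative (\<lambda>v. Re v * \<kappa>x z + Im v * \<kappa>y z)) (at z))"

text \<open>
For a product the mixed second derivatives are visibly the same function, which spares a general theorem
on the symmetry of second derivatives.
\<close>

lemma product_kernel:
  assumes "d > 0"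
    and \<alpha>: "\<And>t. (\<alpha> has_real_derivative \<alpha>' t) (at t)" "continuous_on UNIV \<alpha>'" "\<And>t. \<bar>t\<bar> \<ge> d \<Longrightarrow> \<alpha> t = 0"
    and \<beta>: "\<And>t. (\<beta> has_real_derivative \<beta>' t) (at t)" "continuous_on UNIV \<beta>'" "\<And>t. \<bar>t\<bar> \<ge> d \<Longrightarrow> \<beta> t = 0"
  shows "C1_kernel (2 * d) (\<lambda>z. \<alpha> (Re z) * \<beta> (Im z)) (\<lambda>z. \<alpha>' (Re z) * \<beta> (Im z)) (\<lambda>z. \<alpha> (Re z) * \<beta>' (Im z))"
proof -
  have c: "continuous_on UNIV \<alpha>" "continuous_on UNIV \<beta>"
    using \<alpha>(1) \<beta>(1) by (metis DERIV_isCont continuous_at_imp_continuous_on)+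
  have z: "\<gamma>' t = 0" if "\<And>t. (\<gamma> has_real_derivative \<gamma>' t) (at t)" "\<And>t. \<bar>t\<bar> \<ge> d \<Longrightarrow> \<gamma> t = 0" "\<bar>t\<bar> > d"
    for \<gamma> \<gamma>' :: "real \<Rightarrow> real" and t
  proof -
    have "((\<lambda>_. 0) has_real_derivative 0) (at t)" by simp
    then have "(\<gamma> has_real_derivative 0) (at t)"
      by (rule has_field_derivative_transform_within_open[of _ _ _ "- {-d..d}"])
        (use that in auto)
    with that(1) show ?thesis by (rule DERIV_unique)
  qed
  have big: "d < \<bar>Re w\<bar> \<or> d < \<bar>Im w\<bar>" if "2 * d < norm w" for w
    using cmod_le[of w] that by linarith
  have d: "((\<lambda>w. \<alpha> (Re w) * \<beta> (Im w)) has_derivative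
      (\<lambda>v. Re v * (\<alpha>' (Re w) * \<beta> (Im w)) + Im v * (\<alpha> (Re w) * \<beta>' (Im w)))) (at w)" for w
  proof -
    have 1: "((\<lambda>w. \<alpha> (Re w)) has_derivative (\<lambda>v. \<alpha>' (Re w) * Re v)) (at w)"
      using has_derivative_compose[OF bounded_linear_imp_has_derivative[OF bounded_linear_Re]
          \<alpha>(1)[unfolded has_field_derivative_def]] by simp
    have 2: "((\<lambda>w. \<beta> (Im w)) has_derivative (\<lambda>v. \<beta>' (Im w) * Im v)) (at w)"
      using has_derivative_compose[OF bounded_linear_imp_has_derivative[OF bounded_linear_Im]
          \<beta>(1)[unfolded has_field_derivative_def]] by simp
    show ?thesis using has_derivative_mult[OF 1 2] by (simp add: algebra_simps)
  qed
  have cc: "continuous_on UNIV (\<lambda>z. \<gamma> (Re z) * \<delta> (Im z))"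
    if "continuous_on UNIV \<gamma>" "continuous_on UNIV \<delta>" for \<gamma> \<delta> :: "real \<Rightarrow> real"
    by (intro continuous_intros continuous_on_compose2[OF that(1)] continuous_on_compose2[OF that(2)]) auto
  show ?thesis unfolding C1_kernel_def
  proof (intro conjI allI impI d cc c \<alpha>(2) \<beta>(2))
    fix w :: complex assume "norm w > 2 * d"
    from big[OF this] consider "d < \<bar>Re w\<bar>" | "d < \<bar>Im w\<bar>" by blast
    note * = this
    show "\<alpha> (Re w) * \<beta> (Im w) = 0" using * by cases (auto simp: \<alpha>(3) \<beta>(3))
    show "\<alpha>' (Re w) * \<beta> (Im w) = 0" using * by cases (auto simp: z[OF \<alpha>(1,3)] \<beta>(3))
    show "\<alpha> (Re w) * \<beta>' (Im w) = 0" using * by cases (auto simp: \<alpha>(3) z[OF \<beta>(1,3)])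
  qed
qed

lemma C1_kernel_scale:
  "C1_kernel d \<kappa> \<kappa>x \<kappa>y \<Longrightarrow> C1_kernel d (\<lambda>z. c * \<kappa> z) (\<lambda>z. c * \<kappa>x z) (\<lambda>z. c * \<kappa>y z)"
  unfolding C1_kernel_def
  by (auto intro!: continuous_on_mult_left has_derivative_eq_rhs[OF has_derivative_mult_right] simp: algebra_simps)

lemma compact_support_integrable:
  fixes u :: "complex \<Rightarrow> 'b::euclidean_space"
  assumes "continuous_on UNIV u" "\<And>z. norm z > d \<Longrightarrow> u z = 0"
  shows "integrable lborel u"
proof -
  have "integrable lborel (\<lambda>x. indicator (cball 0 d) x *\<^sub>R u x)"
    by (intro borel_integrable_compact continuous_on_subset[OF assms(1)]) auto
  also have "(\<lambda>x. indicator (cball 0 d) x *\<^sub>R u x) = u"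
    using assms(2) by (auto simp: indicator_def fun_eq_iff)
  finally show ?thesis .
qed

lemma mollifier_exists:
  assumes "d > 0"
  obtains \<rho> \<rho>x \<rho>y \<rho>xx \<rho>xy \<rho>yy where
    "\<And>k. Ck k \<rho>" "\<And>z. 0 \<le> \<rho> z" "(\<integral>z. \<rho> z \<partial>lborel) = 1"
    "C1_kernel d \<rho> \<rho>x \<rho>y" "C1_kernel d \<rho>x \<rho>xx \<rho>xy" "C1_kernel d \<rho>y \<rho>xy \<rho>yy"
proof -
  define e where "e = d / 2"
  have e: "e > 0" "2 * e = d" using assms by (auto simp: e_def)
  obtain b1 b2 where b: "continuous_on UNIV b1" "continuous_on UNIV b2"
    "\<And>t. (bump e has_real_derivative b1 t) (at t)" "\<And>t. (b1 has_real_derivative b2 t) (at t)"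
    using bump_C2[OF e(1)] by blast
  note b0 = bump_eq_0[OF e(1)]
  (* At the end points of the support the bump has a minimum. *)
  have b10: "b1 t = 0" if "\<bar>t\<bar> \<ge> e" for t
  proof (cases "\<bar>t\<bar> = e")
    case True
    have "bump e s \<ge> bump e t" for s
      using b0[of t] that bump_nonneg[of e s] by simp
    then show ?thesis
      using DERIV_local_min[OF b(3)[of t], of 1] by auto
  next
    case False
    have "((\<lambda>_. 0) has_real_derivative 0) (at t)" by simp
    then have "(bump e has_real_derivative 0) (at t)"
      by (rule has_field_derivative_transform_within_open[of _ _ _ "- {-e..e}"])
        (use that False b0 in auto)
    with b(3) show ?thesis by (rule DERIV_unique)
  qed
  let ?u = "\<lambda>z. bump e (Re z) * bump e (Im z)"
  have K: "C1_kernel d ?u (\<lambda>z. b1 (Re z) * bump e (Im z)) (\<lambda>z. bump e (Re z) * b1 (Im z))"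
    "C1_kernel d (\<lambda>z. b1 (Re z) * bump e (Im z)) (\<lambda>z. b2 (Re z) * bump e (Im z)) (\<lambda>z. b1 (Re z) * b1 (Im z))"
    "C1_kernel d (\<lambda>z. bump e (Re z) * b1 (Im z)) (\<lambda>z. b1 (Re z) * b1 (Im z)) (\<lambda>z. bump e (Re z) * b2 (Im z))"
    using product_kernel[OF e(1)] b b0 b10 e(2) by simp_all
  have cu: "continuous_on UNIV ?u" and u0: "\<And>z. norm z > d \<Longrightarrow> ?u z = 0"
    using K(1) by (auto simp: C1_kernel_def)
  have iu: "integrable lborel ?u" by (rule compact_support_integrable[OF cu u0])
  define I where "I = (\<integral>z. ?u z \<partial>lborel)"
  have "I > 0"
  proof -
    have nn: "0 \<le> I" unfolding I_def by (intro integral_nonneg_AE) (auto simp: bump_nonneg)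
    have "I \<noteq> 0"
    proof
      assume "I = 0"
      then have "AE z in lborel. ?u z = 0"
        using integral_nonneg_eq_0_iff_AE[OF iu] by (simp add: I_def bump_nonneg)
      then have "emeasure lborel {z. ?u z \<noteq> 0} = 0"
        using borel_open[OF open_Collect_neq[OF cu continuous_on_const[of UNIV 0]]]
        by (subst (asm) AE_iff_measurable[OF _ refl]) simp_all
      moreover have "open {z. ?u z \<noteq> 0}" using cu by (intro open_Collect_neq continuous_on_const)
      moreover have "0 \<in> {z. ?u z \<noteq> 0}" using bump_0[of e] by simp
      ultimately have "\<not> negligible {z. ?u z \<noteq> 0}"
        using open_not_negligible by blast
      with \<open>emeasure lborel {z. ?u z \<noteq> 0} = 0\<close> \<open>open {z. ?u z \<noteq> 0}\<close> show False
        unfolding negligible_iff_null_sets using null_sets_completionI[OF null_setsI] borel_open sets_lborel by metis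
    qed
    with nn show ?thesis by simp
  qed
  have smooth: "Ck k (\<lambda>z. inverse I * ?u z)" for k
  proof -
    have l: "bounded_linear (\<lambda>z. Re z / e)" "bounded_linear (\<lambda>z. - Re z / e)"
      "bounded_linear (\<lambda>z. Im z / e)" "bounded_linear (\<lambda>z. - Im z / e)"
      using bounded_linear_compose[OF bounded_linear_divide[of e] bounded_linear_Re]
        bounded_linear_compose[OF bounded_linear_divide[of e] bounded_linear_minus[OF bounded_linear_Re]]
        bounded_linear_compose[OF bounded_linear_divide[of e] bounded_linear_Im]
        bounded_linear_compose[OF bounded_linear_divide[of e] bounded_linear_minus[OF bounded_linear_Im]]
      by simp_all
    show ?thesis
      unfolding bump_def using l by (intro Ck_mult Ck_const Ck_flat_affine)
  qed
  show ?thesis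
    by (rule that[OF smooth _ _ K[THEN C1_kernel_scale, of "inverse I"]])
      (use \<open>I > 0\<close> in \<open>auto simp: bump_nonneg I_def[symmetric]\<close>)
qed

definition conv :: "(complex \<Rightarrow> real) \<Rightarrow> (complex \<Rightarrow> complex) \<Rightarrow> complex \<Rightarrow> complex" where
  "conv \<kappa> f z = (\<integral>y. \<kappa> (z - y) *\<^sub>R f y \<partial>lborel)"

lemma conv_eq_integral:
  assumes k: "continuous_on UNIV \<kappa>" "\<And>z. norm z > d \<Longrightarrow> \<kappa> z = 0" and f: "continuous_on UNIV f"
    and ab: "cball z d \<subseteq> cbox a b"
  shows "conv \<kappa> f z = integral (cbox a b) (\<lambda>y. \<kappa> (z - y) *\<^sub>R f y)"
proof -
  have c: "continuous_on UNIV (\<lambda>y. \<kappa> (z - y) *\<^sub>R f y)"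
    by (intro continuous_intros continuous_on_compose2[OF k(1)] f) auto
  have "set_integrable lborel (cbox a b) (\<lambda>y. \<kappa> (z - y) *\<^sub>R f y)"
    unfolding set_integrable_def
    by (intro borel_integrable_compact continuous_on_subset[OF c]) auto
  then have "(LINT y:cbox a b|lborel. \<kappa> (z - y) *\<^sub>R f y) = integral (cbox a b) (\<lambda>y. \<kappa> (z - y) *\<^sub>R f y)"
    by (rule set_borel_integral_eq_integral)
  moreover have "(\<lambda>y. indicator (cbox a b) y *\<^sub>R \<kappa> (z - y) *\<^sub>R f y) = (\<lambda>y. \<kappa> (z - y) *\<^sub>R f y)"
  proof
    fix y
    show "indicator (cbox a b) y *\<^sub>R \<kappa> (z - y) *\<^sub>R f y = \<kappa> (z - y) *\<^sub>R f y"
  proof (cases "y \<in> cbox a b")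
    case False
    then have "norm (z - y) > d" using ab[THEN subsetD, of y] by (metis mem_cball dist_norm not_le)
    then show ?thesis using k(2) by simp
    qed simp
  qed
  ultimately show ?thesis unfolding set_lebesgue_integral_def conv_def by simp
qed

lemma has_derivative_shift:
  fixes \<kappa> :: "complex \<Rightarrow> real"
  assumes der: "\<And>z. (\<kappa> has_derivative D z) (at z)"
  shows "((\<lambda>x. \<kappa> (x - t)) has_derivative D (x - t)) (at x)"
proof -
  have "((\<lambda>x. x - t) has_derivative (\<lambda>v. v)) (at x)"
    by (rule has_derivative_eq_rhs[OF has_derivative_diff[OF has_derivative_ident has_derivative_const]]) simp
  from has_derivative_compose[OF this der[of "x - t"]] show ?thesis .
qed

text \<open>
Only the kernel has to be differentiable: in the difference \<open>z - y\<close> the variable \<open>z\<close> occurs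
in the kernel alone, and one differentiates under an integral over a fixed box that contains the supports for all nearby \<open>z\<close>.
\<close>

lemma conv_has_derivative:
  assumes K: "C1_kernel d \<kappa> \<kappa>x \<kappa>y" and f: "continuous_on UNIV f"
  shows "(conv \<kappa> f has_derivative (\<lambda>v. Re v *\<^sub>R conv \<kappa>x f z + Im v *\<^sub>R conv \<kappa>y f z)) (at z)"
proof -
  have c: "continuous_on UNIV \<kappa>" "continuous_on UNIV \<kappa>x" "continuous_on UNIV \<kappa>y"
    and z0: "\<And>z. norm z > d \<Longrightarrow> \<kappa> z = 0" "\<And>z. norm z > d \<Longrightarrow> \<kappa>x z = 0" "\<And>z. norm z > d \<Longrightarrow> \<kappa>y z = 0"
    and der: "\<And>z. (\<kappa> has_derivative (\<lambda>v. Re v * \<kappa>x z + Im v * \<kappa>y z)) (at z)"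
    using K unfolding C1_kernel_def by blast+
  obtain a b where ab: "cball z (d + 1) \<subseteq> cbox a b"
    using bounded_subset_cbox_symmetric[OF bounded_cball] by meson
  have sub: "cball x d \<subseteq> cbox a b" if "x \<in> ball z 1" for x
    using that by (intro subset_trans[OF _ ab]) (simp add: cball_subset_cball_iff dist_commute)
  define L where "L x y = blinfun_scaleR_left (f y) o\<^sub>L (\<kappa>x (x - y) *\<^sub>R Blinfun Re + \<kappa>y (x - y) *\<^sub>R Blinfun Im)" for x y
  have Lapp: "blinfun_apply (L x y) v = Re v *\<^sub>R \<kappa>x (x - y) *\<^sub>R f y + Im v *\<^sub>R \<kappa>y (x - y) *\<^sub>R f y" for x y v
    by (simp add: L_def blinfun.add_left blinfun.scaleR_left bounded_linear_Blinfun_apply bounded_linear_Re bounded_linear_Im scaleR_add_left mult.commute)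
  have Lfun: "blinfun_apply (L x y) = (\<lambda>v. Re v *\<^sub>R \<kappa>x (x - y) *\<^sub>R f y + Im v *\<^sub>R \<kappa>y (x - y) *\<^sub>R f y)" for x y
    by (intro ext Lapp)
  have contL: "continuous_on (ball z 1 \<times> cbox a b) (\<lambda>(x, y). L x y)"
    unfolding L_def split_beta
  proof (rule bounded_bilinear.continuous_on[OF bounded_bilinear_blinfun_compose])
    have "continuous_on (ball z 1 \<times> cbox a b) (\<lambda>p. f (snd p))"
      by (rule continuous_on_compose2[OF f]) (auto intro: continuous_on_snd continuous_on_id)
    then show "continuous_on (ball z 1 \<times> cbox a b) (\<lambda>p. blinfun_scaleR_left (f (snd p)))"
      by (rule bounded_linear.continuous_on[OF bounded_linear_blinfun_scaleR_left])
    have ck: "continuous_on (ball z 1 \<times> cbox a b) (\<lambda>p. k (fst p - snd p))" if "continuous_on UNIV k" for k :: "complex \<Rightarrow> real"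
      by (rule continuous_on_compose2[OF that]) (auto intro!: continuous_on_diff continuous_on_fst continuous_on_snd continuous_on_id)
    show "continuous_on (ball z 1 \<times> cbox a b) (\<lambda>p. \<kappa>x (fst p - snd p) *\<^sub>R Blinfun Re + \<kappa>y (fst p - snd p) *\<^sub>R Blinfun Im)"
      by (intro continuous_on_add continuous_on_scaleR continuous_on_const ck[OF c(2)] ck[OF c(3)])
  qed
  have at: "at z within ball z 1 = at z"
    by (rule at_within_open) auto
  have "((\<lambda>x. integral (cbox a b) (\<lambda>y. \<kappa> (x - y) *\<^sub>R f y)) has_derivative
      blinfun_apply (integral (cbox a b) (L z))) (at z within ball z 1)"
  proof (rule leibniz_rule[OF _ _ contL])
    fix x t
    have "((\<lambda>x. \<kappa> (x - t)) has_derivative (\<lambda>v. Re v * \<kappa>x (x - t) + Im v * \<kappa>y (x - t))) (at x)"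
      by (rule has_derivative_shift[OF der])
    then have "((\<lambda>x. \<kappa> (x - t) *\<^sub>R f t) has_derivative (\<lambda>v. (Re v * \<kappa>x (x - t) + Im v * \<kappa>y (x - t)) *\<^sub>R f t)) (at x)"
      by (rule bounded_linear.has_derivative[OF bounded_linear_scaleR_left])
    moreover have "(\<lambda>v. (Re v * \<kappa>x (x - t) + Im v * \<kappa>y (x - t)) *\<^sub>R f t) = blinfun_apply (L x t)"
      by (simp add: Lfun scaleR_add_left)
    ultimately show "((\<lambda>x. \<kappa> (x - t) *\<^sub>R f t) has_derivative blinfun_apply (L x t)) (at x within ball z 1)"
      by (metis has_derivative_at_withinI)
  next
    fix x
    show "(\<lambda>y. \<kappa> (x - y) *\<^sub>R f y) integrable_on cbox a b"
      by (intro integrable_continuous continuous_intros continuous_on_compose2[OF c(1)] continuous_on_subset[OF f]) auto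
  qed auto
  then have D: "((\<lambda>x. integral (cbox a b) (\<lambda>y. \<kappa> (x - y) *\<^sub>R f y)) has_derivative
      blinfun_apply (integral (cbox a b) (L z))) (at z)"
    unfolding at .
  have "continuous_on (cbox a b) (\<lambda>y. case (z, y) of (x, y) \<Rightarrow> L x y)"
    by (rule continuous_on_compose2[OF contL]) (auto intro!: continuous_on_Pair continuous_on_id)
  then have Li: "L z integrable_on cbox a b"
    by (intro integrable_continuous) simp
  have int: "(\<lambda>y. k (z - y) *\<^sub>R f y) integrable_on cbox a b" if "continuous_on UNIV k" for k :: "complex \<Rightarrow> real"
    by (intro integrable_continuous continuous_intros continuous_on_compose2[OF that] continuous_on_subset[OF f]) auto
  have "blinfun_apply (integral (cbox a b) (L z)) v = Re v *\<^sub>R conv \<kappa>x f z + Im v *\<^sub>R conv \<kappa>y f z" for v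
  proof -
    have "blinfun_apply (integral (cbox a b) (L z)) v = integral (cbox a b) (\<lambda>y. blinfun_apply (L z y) v)"
      using integral_linear[OF Li blinfun.bounded_linear_left[of v]] by (simp add: o_def)
    also have "\<dots> = Re v *\<^sub>R integral (cbox a b) (\<lambda>y. \<kappa>x (z - y) *\<^sub>R f y) + Im v *\<^sub>R integral (cbox a b) (\<lambda>y. \<kappa>y (z - y) *\<^sub>R f y)"
      using integral_add[OF integrable_cmul[OF int[OF c(2)], of "Re v"] integrable_cmul[OF int[OF c(3)], of "Im v"]]
      by (simp only: Lapp integral_cmul)
    finally show ?thesis
      using conv_eq_integral[OF c(2) z0(2) f sub, of z] conv_eq_integral[OF c(3) z0(3) f sub, of z] by simp
  qed
  then have "blinfun_apply (integral (cbox a b) (L z)) = (\<lambda>v. Re v *\<^sub>R conv \<kappa>x f z + Im v *\<^sub>R conv \<kappa>y f z)"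
    by (intro ext)
  with D have D': "((\<lambda>x. integral (cbox a b) (\<lambda>y. \<kappa> (x - y) *\<^sub>R f y)) has_derivative
      (\<lambda>v. Re v *\<^sub>R conv \<kappa>x f z + Im v *\<^sub>R conv \<kappa>y f z)) (at z)"
    by simp
  show ?thesis
  proof (rule has_derivative_transform_within_open[OF D' open_ball[of z 1]])
    show "integral (cbox a b) (\<lambda>y. \<kappa> (x - y) *\<^sub>R f y) = conv \<kappa> f x" if "x \<in> ball z 1" for x
      using conv_eq_integral[OF c(1) z0(1) f sub[OF that]] by simp
  qed simp
qed

lemma continuous_on_conv:
  assumes k: "continuous_on UNIV \<kappa>" "\<And>z. norm z > d \<Longrightarrow> \<kappa> z = 0" and f: "continuous_on UNIV f"
  shows "continuous_on UNIV (conv \<kappa> f)"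
proof (rule continuous_at_imp_continuous_on, rule ballI)
  fix z :: complex
  obtain a b where ab: "cball z (d + 1) \<subseteq> cbox a b"
    using bounded_subset_cbox_symmetric[OF bounded_cball] by meson
  have sub: "cball x d \<subseteq> cbox a b" if "x \<in> ball z 1" for x
    using that by (intro subset_trans[OF _ ab]) (simp add: cball_subset_cball_iff dist_commute)
  have 1: "continuous_on (ball z 1 \<times> cbox a b) (\<lambda>p. f (snd p))"
    by (rule continuous_on_compose2[OF f]) (auto intro: continuous_on_snd continuous_on_id)
  have 2: "continuous_on (ball z 1 \<times> cbox a b) (\<lambda>p. \<kappa> (fst p - snd p))"
    by (rule continuous_on_compose2[OF k(1)]) (auto intro!: continuous_on_diff continuous_on_fst continuous_on_snd continuous_on_id)
  have 3: "continuous_on (ball z 1 \<times> cbox a b) (\<lambda>(x, y). \<kappa> (x - y) *\<^sub>R f y)"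
    unfolding split_beta using 1 2 by (intro continuous_on_scaleR)
  have 4: "continuous_on (ball z 1) (\<lambda>x. integral (cbox a b) (\<lambda>y. \<kappa> (x - y) *\<^sub>R f y))"
    using 3 by (rule integral_continuous_on_param)
  have 5: "integral (cbox a b) (\<lambda>y. \<kappa> (x - y) *\<^sub>R f y) = conv \<kappa> f x" if "x \<in> ball z 1" for x
    using conv_eq_integral[OF k f sub[OF that]] by simp
  have 6: "continuous_on (ball z 1) (conv \<kappa> f)"
    using continuous_on_eq[OF 4 5] .
  show "isCont (conv \<kappa> f) z" 
    using continuous_on_interior[OF 6, of z] by simp
qed

section \<open>Convergence of mollifications\<close>

lemma nn_integral_reflect:
  fixes h :: "'a::euclidean_space \<Rightarrow> ennreal"
  assumes [measurable]: "h \<in> borel_measurable borel"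
  shows "(\<integral>\<^sup>+y. h (z - y) \<partial>lborel) = (\<integral>\<^sup>+y. h y \<partial>lborel)"
proof -
  have "(\<integral>\<^sup>+y. h y \<partial>lborel) = (\<integral>\<^sup>+y. h y \<partial>density (distr lborel borel (\<lambda>x. z + (-1) *\<^sub>R x)) (\<lambda>_. ennreal (\<bar>-1\<bar> ^ DIM('a))))"
    using lborel_affine[of "-1" z] by simp
  also have "\<dots> = (\<integral>\<^sup>+y. h (z - y) \<partial>lborel)"
    by (simp add: nn_integral_density nn_integral_distr)
  finally show ?thesis by simp
qed

lemma nn_integral_shift:
  fixes h :: "'a::euclidean_space \<Rightarrow> ennreal"
  assumes [measurable]: "h \<in> borel_measurable borel"
  shows "(\<integral>\<^sup>+z. h (z - y) \<partial>lborel) = (\<integral>\<^sup>+z. h z \<partial>lborel)"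
  using nn_integral_reflect[of "\<lambda>x. h (- x)" y] nn_integral_reflect[of h 0] by simp

definition mollifier :: "real \<Rightarrow> (complex \<Rightarrow> real) \<Rightarrow> bool" where
  "mollifier d \<rho> \<longleftrightarrow> continuous_on UNIV \<rho> \<and> (\<forall>z. 0 \<le> \<rho> z) \<and> (\<forall>z. norm z > d \<longrightarrow> \<rho> z = 0) \<and>
     (\<integral>z. \<rho> z \<partial>lborel) = 1"

lemma mollifier_nn_integral:
  assumes "mollifier d \<rho>"
  shows "(\<integral>\<^sup>+y. \<rho> (z - y) \<partial>lborel) = 1" "(\<integral>\<^sup>+z. \<rho> (z - y) \<partial>lborel) = 1"
proof -
  have m[measurable]: "\<rho> \<in> borel_measurable borel"
    using assms by (auto simp: mollifier_def intro: borel_measurable_continuous_onI)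
  have "integrable lborel \<rho>"
    using assms by (intro compact_support_integrable[of \<rho> d]) (auto simp: mollifier_def)
  then have "(\<integral>\<^sup>+y. \<rho> y \<partial>lborel) = 1"
    using assms by (subst nn_integral_eq_integral) (auto simp: mollifier_def)
  then show "(\<integral>\<^sup>+y. \<rho> (z - y) \<partial>lborel) = 1" "(\<integral>\<^sup>+z. \<rho> (z - y) \<partial>lborel) = 1"
    using nn_integral_reflect[of "\<lambda>x. ennreal (\<rho> x)" z] nn_integral_shift[of "\<lambda>x. ennreal (\<rho> x)" y]
    by simp_all
qed

text \<open>
Jensen's inequality for the probability density \<open>\<rho>\<close>; for exponent \<open>2\<close> it is Cauchy-Schwarz with
\<open>\<rho>\<close> split into two square roots.
\<close>

lemma conv_norm_power_le:
  fixes p :: nat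
  assumes \<rho>: "mollifier d \<rho>" and u[measurable]: "u \<in> borel_measurable borel" and p: "p = 1 \<or> p = 2"
  shows "ennreal (norm (conv \<rho> u z) ^ p) \<le> (\<integral>\<^sup>+y. ennreal (\<rho> (z - y) * norm (u y) ^ p) \<partial>lborel)"
proof -
  have m[measurable]: "\<rho> \<in> borel_measurable borel" and nn: "\<And>z. 0 \<le> \<rho> z"
    using \<rho> by (auto simp: mollifier_def intro: borel_measurable_continuous_onI)
  have 1: "ennreal (norm (conv \<rho> u z)) \<le> (\<integral>\<^sup>+y. ennreal (\<rho> (z - y) * norm (u y)) \<partial>lborel)"
  proof (cases "integrable lborel (\<lambda>y. \<rho> (z - y) *\<^sub>R u y)")
    case True
    from integral_norm_bound_ennreal[OF this] show ?thesis
      by (simp add: conv_def nn)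
  next
    case False
    then show ?thesis by (simp add: conv_def not_integrable_integral_eq)
  qed
  show ?thesis
  proof (cases "p = 1")
    case False
    with p have p2: "p = 2" by simp
    have "ennreal (norm (conv \<rho> u z) ^ 2) \<le> (\<integral>\<^sup>+y. ennreal (\<rho> (z - y) * norm (u y)) \<partial>lborel)\<^sup>2"
      using power_mono[OF 1, of 2] by (simp add: ennreal_power)
    also have "\<dots> = (\<integral>\<^sup>+y. ennreal (sqrt (\<rho> (z - y))) * ennreal (sqrt (\<rho> (z - y)) * norm (u y)) \<partial>lborel)\<^sup>2"
      by (simp add: ennreal_mult[symmetric] nn mult.assoc[symmetric] del: ennreal_mult)
    also have "\<dots> \<le> (\<integral>\<^sup>+y. ennreal (sqrt (\<rho> (z - y))) ^ 2 \<partial>lborel) * (\<integral>\<^sup>+y. ennreal (sqrt (\<rho> (z - y)) * norm (u y)) ^ 2 \<partial>lborel)"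
      by (rule Cauchy_Schwarz_nn_integral) measurable
    also have "\<dots> = (\<integral>\<^sup>+y. ennreal (\<rho> (z - y) * norm (u y) ^ 2) \<partial>lborel)"
      using mollifier_nn_integral(1)[OF \<rho>, of z] by (simp add: ennreal_power nn power_mult_distrib)
    finally show ?thesis using p2 by simp
  qed (use 1 in simp)
qed

text \<open>
Young's inequality in local form: integrate the pointwise bound and exchange the integrals. The radius
grows by \<open>d\<close> because \<open>\<rho> (z - y)\<close> lives on \<open>norm (z - y) \<le> d\<close>.
\<close>

lemma conv_Lp_bound:
  fixes p :: nat
  assumes \<rho>: "mollifier d \<rho>" and u[measurable]: "u \<in> borel_measurable borel" and p: "p = 1 \<or> p = 2"
  shows "(\<integral>\<^sup>+z. ennreal (norm (conv \<rho> u z) ^ p) * indicator (cball 0 R) z \<partial>lborel)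
    \<le> (\<integral>\<^sup>+z. ennreal (norm (u z) ^ p) * indicator (cball 0 (R + d)) z \<partial>lborel)"
proof -
  have m[measurable]: "\<rho> \<in> borel_measurable borel" and nn: "\<And>z. 0 \<le> \<rho> z"
    and sup: "\<And>z. norm z > d \<Longrightarrow> \<rho> z = 0"
    using \<rho> by (auto simp: mollifier_def intro: borel_measurable_continuous_onI)
  have b[measurable]: "cball (0::complex) (R + d) \<in> sets borel" by simp
  let ?U = "\<lambda>y. ennreal (norm (u y) ^ p) * indicator (cball 0 (R + d)) y"
  have "(\<integral>\<^sup>+z. ennreal (norm (conv \<rho> u z) ^ p) * indicator (cball 0 R) z \<partial>lborel)
     \<le> (\<integral>\<^sup>+z. (\<integral>\<^sup>+y. ennreal (\<rho> (z - y)) * ?U y \<partial>lborel) \<partial>lborel)"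
  proof (rule nn_integral_mono)
    fix z :: complex
    show "ennreal (norm (conv \<rho> u z) ^ p) * indicator (cball 0 R) z \<le> (\<integral>\<^sup>+y. ennreal (\<rho> (z - y)) * ?U y \<partial>lborel)"
    proof (cases "z \<in> cball 0 R")
      case True
      have "(\<integral>\<^sup>+y. ennreal (\<rho> (z - y) * norm (u y) ^ p) \<partial>lborel) = (\<integral>\<^sup>+y. ennreal (\<rho> (z - y)) * ?U y \<partial>lborel)"
      proof (rule nn_integral_cong)
        fix y
        show "ennreal (\<rho> (z - y) * norm (u y) ^ p) = ennreal (\<rho> (z - y)) * ?U y"
        proof (cases "norm (z - y) > d")
          case False
          have "norm y \<le> norm z + norm (z - y)" by (metis norm_minus_commute norm_triangle_sub)
          with False True have "y \<in> cball 0 (R + d)" by simp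
          then show ?thesis by (simp add: ennreal_mult nn)
        qed (use sup in simp)
      qed
      with conv_norm_power_le[OF \<rho> u p, of z] True show ?thesis by simp
    qed simp
  qed
  also have "\<dots> = (\<integral>\<^sup>+y. (\<integral>\<^sup>+z. ennreal (\<rho> (z - y)) * ?U y \<partial>lborel) \<partial>lborel)"
    by (rule lborel_pair.Fubini') measurable
  also have "\<dots> = (\<integral>\<^sup>+y. ?U y \<partial>lborel)"
    using mollifier_nn_integral(2)[OF \<rho>] by (simp add: nn_integral_multc)
  finally show ?thesis .
qed

text \<open>
The radial retraction onto the disc of radius \<open>m\<close>.
\<close>

definition clip :: "real \<Rightarrow> complex \<Rightarrow> complex" where
  "clip m v = v /\<^sub>R max 1 (norm v / m)"

lemma continuous_on_clip [continuous_intros]: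
  "m > 0 \<Longrightarrow> continuous_on S f \<Longrightarrow> continuous_on S (\<lambda>x. clip m (f x))"
  unfolding clip_def by (intro continuous_intros) (auto simp: max_def)

lemma norm_clip_le: "m > 0 \<Longrightarrow> norm (clip m v) \<le> m"
  by (auto simp: clip_def max_def field_simps)

lemma clip_eq: "m > 0 \<Longrightarrow> norm v \<le> m \<Longrightarrow> clip m v = v"
  by (auto simp: clip_def max_def field_simps)

lemma norm_diff_clip_le: "m > 0 \<Longrightarrow> norm (v - clip m v) \<le> norm v"
proof -
  assume "m > 0"
  define l where "l = inverse (max 1 (norm v / m))"
  have "0 \<le> l" "l \<le> 1" by (auto simp: l_def inverse_le_1_iff)
  moreover have "v - clip m v = (1 - l) *\<^sub>R v" by (simp add: clip_def l_def algebra_simps)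
  ultimately show ?thesis by (simp add: mult_left_le_one_le)
qed

lemma norm_add3_power: "norm (x + y + z) ^ p \<le> 3 ^ p * (norm x ^ p + norm y ^ p + norm z ^ p)"
proof -
  define M where "M = max (norm x) (max (norm y) (norm z))"
  have "norm (x + y + z) \<le> norm x + norm y + norm z"
    by (meson add_right_mono norm_triangle_ineq order_trans)
  also have "\<dots> \<le> 3 * M" unfolding M_def by linarith
  finally have "norm (x + y + z) ^ p \<le> (3 * M) ^ p" by (intro power_mono) auto
  also have "\<dots> = 3 ^ p * M ^ p" by (simp add: power_mult_distrib)
  also have "M ^ p \<le> norm x ^ p + norm y ^ p + norm z ^ p"
    unfolding M_def max_def using zero_le_power[OF norm_ge_zero, of x p] zero_le_power[OF norm_ge_zero, of y p] zero_le_power[OF norm_ge_zero, of z p]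
    by auto
  finally show ?thesis by simp
qed

lemma nn_integral_add3_power:
  fixes f g h :: "complex \<Rightarrow> complex"
  assumes [measurable]: "f \<in> borel_measurable borel" "g \<in> borel_measurable borel" "h \<in> borel_measurable borel" "A \<in> sets borel"
  assumes eq: "\<And>x. x \<in> A \<Longrightarrow> k x = f x + g x + h x"
  shows "(\<integral>\<^sup>+x. ennreal (norm (k x) ^ p) * indicator A x \<partial>lborel) \<le> 3 ^ p *
     ((\<integral>\<^sup>+x. ennreal (norm (f x) ^ p) * indicator A x \<partial>lborel) +
      (\<integral>\<^sup>+x. ennreal (norm (g x) ^ p) * indicator A x \<partial>lborel) +
      (\<integral>\<^sup>+x. ennreal (norm (h x) ^ p) * indicator A x \<partial>lborel))"
proof -
  have "(\<integral>\<^sup>+x. ennreal (norm (k x) ^ p) * indicator A x \<partial>lborel)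
    \<le> (\<integral>\<^sup>+x. 3 ^ p * (ennreal (norm (f x) ^ p) * indicator A x + ennreal (norm (g x) ^ p) * indicator A x + ennreal (norm (h x) ^ p) * indicator A x) \<partial>lborel)"
  proof (rule nn_integral_mono)
    fix x
    have "ennreal (norm (f x + g x + h x) ^ p) \<le> ennreal (3 ^ p * (norm (f x) ^ p + norm (g x) ^ p + norm (h x) ^ p))"
      by (rule ennreal_leI[OF norm_add3_power])
    also have "\<dots> = 3 ^ p * (ennreal (norm (f x) ^ p) + ennreal (norm (g x) ^ p) + ennreal (norm (h x) ^ p))"
    proof -
      have "ennreal (3 ^ p * (a + b + c)) = 3 ^ p * (ennreal a + ennreal b + ennreal c)"
        if "0 \<le> a" "0 \<le> b" "0 \<le> c" for a b c :: real
      proof -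
        have "ennreal (3 ^ p) = 3 ^ p" by (metis ennreal_numeral ennreal_power zero_le_numeral)
        with that show ?thesis by (simp add: ennreal_mult)
      qed
      then show ?thesis by simp
    qed
    finally show "ennreal (norm (k x) ^ p) * indicator A x \<le> 3 ^ p * (ennreal (norm (f x) ^ p) * indicator A x + ennreal (norm (g x) ^ p) * indicator A x + ennreal (norm (h x) ^ p) * indicator A x)"
      by (cases "x \<in> A") (auto simp: eq)
  qed
  also have "\<dots> = 3 ^ p *
     ((\<integral>\<^sup>+x. ennreal (norm (f x) ^ p) * indicator A x \<partial>lborel) +
      (\<integral>\<^sup>+x. ennreal (norm (g x) ^ p) * indicator A x \<partial>lborel) +
      (\<integral>\<^sup>+x. ennreal (norm (h x) ^ p) * indicator A x \<partial>lborel))"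
    by (simp add: nn_integral_cmult nn_integral_add)
  finally show ?thesis .
qed

lemma cball_emeasure_finite: "emeasure lborel (cball (0::complex) R) < top"
  using emeasure_bounded_finite[OF bounded_cball, of "0::complex" R] by simp

text \<open>
A measurable function is an almost everywhere limit of continuous functions, but without any bound on these.
Clipping at height \<open>m\<close> makes dominated convergence applicable; a first
application of dominated convergence shows that clipping changes the function little in the mean.
\<close>

lemma continuous_dense_Lp:
  fixes u :: "complex \<Rightarrow> complex" and p :: nat
  assumes u[measurable]: "u \<in> borel_measurable borel" and p: "p > 0"
    and fin: "(\<integral>\<^sup>+x. ennreal (norm (u x) ^ p) * indicator (cball 0 R) x \<partial>lborel) < \<infinity>" and e: "e > 0"
  shows "\<exists>c. continuous_on UNIV c \<and>
    (\<integral>\<^sup>+x. ennreal (norm (u x - c x) ^ p) * indicator (cball 0 R) x \<partial>lborel) \<le> ennreal e"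
proof -
  have B[measurable]: "cball (0::complex) R \<in> sets borel" by simp
  define e1 where "e1 = e / (3 ^ p * 4)"
  have e1: "e1 > 0" using e by (simp add: e1_def)
  have mclip[measurable]: "clip m \<in> borel_measurable borel" if "m > 0" for m
    using continuous_on_clip[OF that continuous_on_id] by (rule borel_measurable_continuous_onI)
  have mS[measurable]: "clip (1 + real n) \<in> borel_measurable borel" for n by (rule mclip) simp
  have "(\<lambda>n. \<integral>\<^sup>+x. ennreal (norm (u x - clip (1 + real n) (u x)) ^ p) * indicator (cball 0 R) x \<partial>lborel)
     \<longlonglongrightarrow> (\<integral>\<^sup>+x. 0 \<partial>(lborel :: complex measure))"
  proof (rule nn_integral_dominated_convergence[OF _ _ _ _ fin])
    show "AE x in lborel. ennreal (norm (u x - clip (1 + real n) (u x)) ^ p) * indicator (cball 0 R) x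
       \<le> ennreal (norm (u x) ^ p) * indicator (cball 0 R) x" for n
      by (intro AE_I2 mult_right_mono ennreal_leI power_mono norm_diff_clip_le) auto
    show "AE x in lborel. (\<lambda>n. ennreal (norm (u x - clip (1 + real n) (u x)) ^ p) * indicator (cball 0 R) x) \<longlonglongrightarrow> 0"
    proof (rule AE_I2, rule tendsto_eventually)
      fix x
      have "eventually (\<lambda>n. norm (u x) \<le> 1 + real n) sequentially"
        using eventually_ge_at_top[of "nat \<lceil>norm (u x)\<rceil>"] by eventually_elim linarith
      then show "eventually (\<lambda>n. ennreal (norm (u x - clip (1 + real n) (u x)) ^ p) * indicator (cball 0 R) x = 0) sequentially"
        by eventually_elim (use p in \<open>simp add: clip_eq zero_power\<close>)
    qed
  qed measurable
  then have "eventually (\<lambda>n. (\<integral>\<^sup>+x. ennreal (norm (u x - clip (1 + real n) (u x)) ^ p) * indicator (cball 0 R) x \<partial>lborel) < ennreal e1) sequentially"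
    using e1 by (intro order_tendstoD) auto
  then obtain k where k: "(\<integral>\<^sup>+x. ennreal (norm (u x - clip (1 + real k) (u x)) ^ p) * indicator (cball 0 R) x \<partial>lborel) < ennreal e1"
    by (auto simp: eventually_sequentially)
  define m where "m = 1 + real k"
  have m: "m > 0" by (simp add: m_def)
  note mclip[OF m, measurable]
  have "u \<in> borel_measurable lebesgue" using u by (simp add: measurable_completion)
  then have "u measurable_on UNIV" by (rule lebesgue_measurable_imp_measurable_on) auto
  then obtain N g where N: "negligible N" and g: "\<And>n::nat. continuous_on UNIV (g n)"
    and lim: "\<And>x. x \<notin> N \<Longrightarrow> (\<lambda>n. g n x) \<longlonglongrightarrow> u x"
    unfolding measurable_on_def by auto
  have gm[measurable]: "g n \<in> borel_measurable borel" for n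
    using g by (rule borel_measurable_continuous_onI)
  have "AE x in lebesgue. x \<notin> N"
    using N unfolding negligible_iff_null_sets by (rule AE_not_in)
  then have AEN: "AE x in lborel. x \<notin> N" by (simp add: AE_completion_iff)
  have "(\<lambda>n. \<integral>\<^sup>+x. ennreal (norm (clip m (u x) - clip m (g n x)) ^ p) * indicator (cball 0 R) x \<partial>lborel)
     \<longlonglongrightarrow> (\<integral>\<^sup>+x. 0 \<partial>(lborel :: complex measure))"
  proof (rule nn_integral_dominated_convergence)
    show "AE x in lborel. ennreal (norm (clip m (u x) - clip m (g n x)) ^ p) * indicator (cball 0 R) x
       \<le> ennreal ((2 * m) ^ p) * indicator (cball 0 R) x" for n
    proof (intro AE_I2 mult_right_mono ennreal_leI power_mono)
      fix x show "norm (clip m (u x) - clip m (g n x)) \<le> 2 * m"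
        using norm_triangle_ineq4[of "clip m (u x)" "clip m (g n x)"] norm_clip_le[OF m, of "u x"] norm_clip_le[OF m, of "g n x"]
        by linarith
    qed auto
    show "(\<integral>\<^sup>+x. ennreal ((2 * m) ^ p) * indicator (cball (0::complex) R) x \<partial>lborel) < \<infinity>"
      by (subst nn_integral_cmult_indicator)
        (auto simp: ennreal_mult_less_top cball_emeasure_finite simp flip: ennreal_power)
    show "AE x in lborel. (\<lambda>n. ennreal (norm (clip m (u x) - clip m (g n x)) ^ p) * indicator (cball 0 R) x) \<longlonglongrightarrow> 0"
      using AEN
    proof eventually_elim
      fix x assume "x \<notin> N"
      have "(\<lambda>n. clip m (g n x)) \<longlonglongrightarrow> clip m (u x)"
        using continuous_on_tendsto_compose[OF continuous_on_clip[OF m continuous_on_id[of UNIV]] lim[OF \<open>x \<notin> N\<close>]] by simp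
      then have "(\<lambda>n. norm (clip m (u x) - clip m (g n x)) ^ p) \<longlonglongrightarrow> norm (clip m (u x) - clip m (u x)) ^ p"
        by (intro tendsto_intros)
      then have "(\<lambda>n. ennreal (norm (clip m (u x) - clip m (g n x)) ^ p)) \<longlonglongrightarrow> ennreal 0"
        using p by (intro tendsto_ennrealI) (simp add: zero_power)
      then show "(\<lambda>n. ennreal (norm (clip m (u x) - clip m (g n x)) ^ p) * indicator (cball 0 R) x) \<longlonglongrightarrow> 0"
        by (cases "x \<in> cball 0 R") simp_all
    qed
  qed measurable
  then have "eventually (\<lambda>n. (\<integral>\<^sup>+x. ennreal (norm (clip m (u x) - clip m (g n x)) ^ p) * indicator (cball 0 R) x \<partial>lborel) < ennreal e1) sequentially"
    using e1 by (intro order_tendstoD) auto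
  then obtain n where n: "(\<integral>\<^sup>+x. ennreal (norm (clip m (u x) - clip m (g n x)) ^ p) * indicator (cball 0 R) x \<partial>lborel) < ennreal e1"
    by (auto simp: eventually_sequentially)
  have "(\<integral>\<^sup>+x. ennreal (norm (u x - clip m (g n x)) ^ p) * indicator (cball 0 R) x \<partial>lborel) \<le> 3 ^ p *
     ((\<integral>\<^sup>+x. ennreal (norm (u x - clip m (u x)) ^ p) * indicator (cball 0 R) x \<partial>lborel) +
      (\<integral>\<^sup>+x. ennreal (norm (clip m (u x) - clip m (g n x)) ^ p) * indicator (cball 0 R) x \<partial>lborel) +
      (\<integral>\<^sup>+x. ennreal (norm (0::complex) ^ p) * indicator (cball (0::complex) R) x \<partial>lborel))"
    by (rule nn_integral_add3_power[OF _ _ _ B]) (measurable, use m in simp_all)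
  also have "\<dots> \<le> 3 ^ p * (ennreal e1 + ennreal e1 + 0)"
    using k n p by (intro mult_left_mono add_mono) (auto simp: m_def zero_power)
  also have "\<dots> = ennreal (3 ^ p * (e1 + e1))"
  proof -
    have "ennreal (3 ^ p) = 3 ^ p" by (metis ennreal_numeral ennreal_power zero_le_numeral)
    moreover have "ennreal (3 ^ p * (e1 + e1)) = ennreal (3 ^ p) * ennreal (e1 + e1)"
      using e1 by (intro ennreal_mult) auto
    moreover have "ennreal (e1 + e1) = ennreal e1 + ennreal e1"
      using e1 by (intro ennreal_plus) auto
    ultimately show ?thesis by (simp only: add_0_right)
  qed
  also have "\<dots> \<le> ennreal e" using e by (intro ennreal_leI) (simp add: e1_def field_simps)
  finally show ?thesis
    using continuous_on_clip[OF m g[of n]] by blast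
qed

lemma mollifier_shift:
  assumes "mollifier d \<rho>"
  shows "integrable lborel (\<lambda>y. \<rho> (z - y))" "(\<integral>y. \<rho> (z - y) \<partial>lborel) = 1"
proof -
  have m[measurable]: "\<rho> \<in> borel_measurable borel" and nn: "\<And>z. 0 \<le> \<rho> z"
    using assms by (auto simp: mollifier_def intro: borel_measurable_continuous_onI)
  show "integrable lborel (\<lambda>y. \<rho> (z - y))"
    by (rule integrableI_nonneg) (use mollifier_nn_integral(1)[OF assms, of z] nn in auto)
  show "(\<integral>y. \<rho> (z - y) \<partial>lborel) = 1"
    by (subst integral_eq_nn_integral) (use mollifier_nn_integral(1)[OF assms, of z] nn in auto)
qed

lemma conv_near:
  assumes \<rho>: "mollifier d \<rho>" and int: "integrable lborel (\<lambda>y. \<rho> (z - y) *\<^sub>R c y)"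
    and near: "\<And>y. dist y z \<le> d \<Longrightarrow> norm (c y - c z) \<le> \<eta>"
  shows "norm (conv \<rho> c z - c z) \<le> \<eta>"
proof -
  have nn: "\<And>z. 0 \<le> \<rho> z" and sup: "\<And>z. norm z > d \<Longrightarrow> \<rho> z = 0"
    using \<rho> by (auto simp: mollifier_def)
  note s = mollifier_shift[OF \<rho>, of z]
  have sc: "integrable lborel (\<lambda>y. \<rho> (z - y) *\<^sub>R c z)"
    by (rule integrable_scaleR_left) (use s(1) in simp)
  have "c z = (\<integral>y. \<rho> (z - y) *\<^sub>R c z \<partial>lborel)"
    using s by (subst integral_scaleR_left) auto
  then have "conv \<rho> c z - c z = (\<integral>y. \<rho> (z - y) *\<^sub>R c y - \<rho> (z - y) *\<^sub>R c z \<partial>lborel)"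
    unfolding conv_def using Bochner_Integration.integral_diff[OF int sc] by simp
  also have "norm \<dots> \<le> (\<integral>y. \<rho> (z - y) * \<eta> \<partial>lborel)"
  proof (rule Bochner_Integration.integral_norm_bound_integral)
    show "integrable lborel (\<lambda>y. \<rho> (z - y) *\<^sub>R c y - \<rho> (z - y) *\<^sub>R c z)"
      using int sc by (rule Bochner_Integration.integrable_diff)
    show "integrable lborel (\<lambda>y. \<rho> (z - y) * \<eta>)" using s(1) by simp
    fix y
    have "norm (\<rho> (z - y) *\<^sub>R c y - \<rho> (z - y) *\<^sub>R c z) = \<rho> (z - y) * norm (c y - c z)"
      using nn[of "z - y"] by (simp add: scaleR_diff_right[symmetric])
    also have "\<dots> \<le> \<rho> (z - y) * \<eta>"
    proof (cases "norm (z - y) > d")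
      case False
      then show ?thesis using near[of y] nn[of "z - y"]
        by (intro mult_left_mono) (auto simp: dist_norm norm_minus_commute)
    qed (simp add: sup)
    finally show "norm (\<rho> (z - y) *\<^sub>R c y - \<rho> (z - y) *\<^sub>R c z) \<le> \<rho> (z - y) * \<eta>" .
  qed
  also have "\<dots> = \<eta>" using s by simp
  finally show ?thesis .
qed

text \<open>
The integrand vanishes off a disc, and on it \<open>norm u \<le> 1 + norm u ^ p\<close>.
\<close>

lemma conv_integrable:
  fixes p :: nat and u :: "complex \<Rightarrow> complex"
  assumes \<rho>: "mollifier d \<rho>" and u[measurable]: "u \<in> borel_measurable borel" and p: "p = 1 \<or> p = 2"
    and fin: "\<And>R. (\<integral>\<^sup>+x. ennreal (norm (u x) ^ p) * indicator (cball 0 R) x \<partial>lborel) < \<infinity>"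
  shows "integrable lborel (\<lambda>y. \<rho> (z - y) *\<^sub>R u y)"
proof -
  have m[measurable]: "\<rho> \<in> borel_measurable borel" and nn: "\<And>z. 0 \<le> \<rho> z"
    and sup: "\<And>z. norm z > d \<Longrightarrow> \<rho> z = 0" and c: "continuous_on UNIV \<rho>"
    using \<rho> by (auto simp: mollifier_def intro: borel_measurable_continuous_onI)
  define R where "R = norm z + d"
  have Bs[measurable]: "cball (0::complex) R \<in> sets borel" by simp
  have "bounded (\<rho> ` cball 0 d)"
    by (intro compact_imp_bounded compact_continuous_image continuous_on_subset[OF c]) auto
  then obtain B where B: "B > 0" "\<And>x. x \<in> cball 0 d \<Longrightarrow> norm (\<rho> x) \<le> B"
    by (auto simp: bounded_pos)
  have bound: "norm (\<rho> (z - y) *\<^sub>R u y) \<le> B * (1 + norm (u y) ^ p)" for y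
  proof -
    have "norm (u y) \<le> 1 + norm (u y) ^ p"
    proof (cases "p = 1")
      case False
      with p have "p = 2" by simp
      have "0 \<le> (norm (u y) - 1 / 2)\<^sup>2" by simp
      then show ?thesis using \<open>p = 2\<close> by (simp add: power2_eq_square algebra_simps)
    qed simp
    moreover have "\<bar>\<rho> (z - y)\<bar> \<le> B"
      using B sup[of "z - y"] by (cases "norm (z - y) > d") auto
    ultimately show ?thesis by (auto intro!: mult_mono)
  qed
  have zero: "\<rho> (z - y) *\<^sub>R u y = 0" if "y \<notin> cball 0 R" for y
  proof -
    have "norm y \<le> norm z + norm (z - y)" by (metis norm_minus_commute norm_triangle_sub)
    with that have "norm (z - y) > d" by (simp add: R_def)
    then show ?thesis using sup by simp
  qed
  have "(\<integral>\<^sup>+y. ennreal (norm (\<rho> (z - y) *\<^sub>R u y)) \<partial>lborel)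
      \<le> (\<integral>\<^sup>+y. ennreal B * (indicator (cball 0 R) y + ennreal (norm (u y) ^ p) * indicator (cball 0 R) y) \<partial>lborel)"
  proof (rule nn_integral_mono)
    fix y
    show "ennreal (norm (\<rho> (z - y) *\<^sub>R u y)) \<le> ennreal B * (indicator (cball 0 R) y + ennreal (norm (u y) ^ p) * indicator (cball 0 R) y)"
    proof (cases "y \<in> cball 0 R")
      case True
      have "ennreal (norm (\<rho> (z - y) *\<^sub>R u y)) \<le> ennreal (B * (1 + norm (u y) ^ p))" by (rule ennreal_leI[OF bound])
      also have "\<dots> = ennreal B * (1 + ennreal (norm (u y) ^ p))"
      proof -
        have "ennreal (B * (1 + a)) = ennreal B * (1 + ennreal a)" if "a \<ge> 0" for a
          using B that by (simp add: ennreal_mult)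
        then show ?thesis by simp
      qed
      finally show ?thesis using True by simp
    next
      case False
      show ?thesis unfolding zero[OF False] by simp
    qed
  qed
  also have "\<dots> = ennreal B * (emeasure lborel (cball (0::complex) R) + (\<integral>\<^sup>+x. ennreal (norm (u x) ^ p) * indicator (cball 0 R) x \<partial>lborel))"
    by (simp add: nn_integral_cmult nn_integral_add)
  also have "\<dots> < \<infinity>"
    using fin[of R] by (auto simp: ennreal_mult_less_top cball_emeasure_finite)
  finally show ?thesis by (intro integrableI_bounded) auto
qed

lemma cball_nn_finite_continuous:
  fixes c :: "complex \<Rightarrow> complex"
  assumes "continuous_on UNIV c"
  shows "(\<integral>\<^sup>+x. ennreal (norm (c x) ^ p) * indicator (cball 0 R) x \<partial>lborel) < \<infinity>"
proof -
  have "integrable lborel (\<lambda>x. indicator (cball 0 R) x *\<^sub>R (norm (c x) ^ p))"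
    by (intro borel_integrable_compact continuous_intros continuous_on_subset[OF assms]) auto
  then have "(\<integral>\<^sup>+x. ennreal (norm (indicator (cball 0 R) x *\<^sub>R (norm (c x) ^ p))) \<partial>lborel) < \<infinity>"
    by (auto simp: integrable_iff_bounded)
  also have "(\<lambda>x. ennreal (norm (indicator (cball 0 R) x *\<^sub>R (norm (c x) ^ p)))) = (\<lambda>x. ennreal (norm (c x) ^ p) * indicator (cball 0 R) x)"
    by (auto simp: indicator_def)
  finally show ?thesis .
qed

lemma conv_uniform:
  assumes f: "continuous_on UNIV f" and e: "e > 0"
  shows "\<exists>d. 0 < d \<and> d \<le> 1 \<and> (\<forall>\<rho>. mollifier d \<rho> \<longrightarrow> (\<forall>z\<in>cball 0 R. norm (conv \<rho> f z - f z) \<le> e))"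
proof -
  have "uniformly_continuous_on (cball 0 (R + 1)) f"
    by (intro compact_uniformly_continuous continuous_on_subset[OF f]) auto
  then obtain d0 where d0: "d0 > 0" "\<And>x y. x \<in> cball 0 (R + 1) \<Longrightarrow> y \<in> cball 0 (R + 1) \<Longrightarrow> dist y x < d0 \<Longrightarrow> dist (f y) (f x) < e"
    using e unfolding uniformly_continuous_on_def by metis
  define d where "d = min 1 (d0 / 2)"
  have "norm (conv \<rho> f z - f z) \<le> e" if \<rho>: "mollifier d \<rho>" and z: "z \<in> cball 0 R" for \<rho> z
  proof (rule conv_near[OF \<rho>])
    show "integrable lborel (\<lambda>y. \<rho> (z - y) *\<^sub>R f y)"
      using f by (intro conv_integrable[OF \<rho>, where p = 1] cball_nn_finite_continuous borel_measurable_continuous_onI) auto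
    fix y assume y: "dist y z \<le> d"
    have "norm y \<le> norm z + dist y z" by (metis dist_norm norm_triangle_sub)
    with y z have "y \<in> cball 0 (R + 1)" "z \<in> cball 0 (R + 1)" "dist y z < d0"
      using d0(1) by (auto simp: d_def)
    then show "norm (f y - f z) \<le> e" using d0(2)[of z y] by (simp add: dist_norm less_imp_le)
  qed
  moreover have "0 < d" "d \<le> 1" using d0 by (auto simp: d_def)
  ultimately show ?thesis by blast
qed

lemma mollifier_mono: "mollifier d \<rho> \<Longrightarrow> d \<le> d' \<Longrightarrow> mollifier d' \<rho>"
  by (auto simp: mollifier_def)

text \<open>
For continuous functions the convergence is uniform; the general case follows by density, since
convolution does not increase the norm. The continuity of the convolution is a hypothesis here because in the
application it is known from moving the derivative to the kernel.
\<close>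

lemma conv_Lp:
  fixes p :: nat
  assumes u[measurable]: "u \<in> borel_measurable borel" and p: "p = 1 \<or> p = 2"
    and fin: "\<And>R. (\<integral>\<^sup>+x. ennreal (norm (u x) ^ p) * indicator (cball 0 R) x \<partial>lborel) < \<infinity>"
    and e: "e > 0"
  shows "\<exists>d. 0 < d \<and> d \<le> 1 \<and> (\<forall>\<rho>. mollifier d \<rho> \<longrightarrow> continuous_on UNIV (conv \<rho> u) \<longrightarrow>
    (\<integral>\<^sup>+z. ennreal (norm (conv \<rho> u z - u z) ^ p) * indicator (cball 0 R) z \<partial>lborel) \<le> ennreal e)"
proof -
  have B[measurable]: "cball (0::complex) R \<in> sets borel" by simp
  define e1 where "e1 = e / (3 ^ p * 3)"
  have e1: "e1 > 0" using e by (simp add: e1_def)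
  have p0: "p > 0" using p by auto
  obtain c where c: "continuous_on UNIV c"
    and ce: "(\<integral>\<^sup>+x. ennreal (norm (u x - c x) ^ p) * indicator (cball 0 (R + 1)) x \<partial>lborel) \<le> ennreal e1"
    using continuous_dense_Lp[OF u p0 fin e1] by blast
  have cm[measurable]: "c \<in> borel_measurable borel" using c by (rule borel_measurable_continuous_onI)
  define V where "V = measure lborel (cball (0::complex) R)"
  have V: "emeasure lborel (cball (0::complex) R) = ennreal V"
    unfolding V_def by (intro emeasure_eq_ennreal_measure) (use cball_emeasure_finite[of R] in simp)
  have V0: "V \<ge> 0" by (simp add: V_def)
  define \<eta> where "\<eta> = min 1 (e1 / (V + 1))"
  have \<eta>: "\<eta> > 0" using e1 V0 by (simp add: \<eta>_def)
  have \<eta>p: "\<eta> ^ p * V \<le> e1"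
  proof -
    have "\<eta> ^ p \<le> \<eta> ^ 1" using \<eta> p0 by (intro power_decreasing) (auto simp: \<eta>_def)
    then have "\<eta> ^ p * V \<le> (e1 / (V + 1)) * V" using V0 by (intro mult_right_mono) (auto simp: \<eta>_def)
    also have "\<dots> \<le> e1" using V0 e1 by (simp add: field_simps)
    finally show ?thesis .
  qed
  obtain d where d: "0 < d" "d \<le> 1" and dc: "\<And>\<rho> z. mollifier d \<rho> \<Longrightarrow> z \<in> cball 0 R \<Longrightarrow> norm (conv \<rho> c z - c z) \<le> \<eta>"
    using conv_uniform[OF c \<eta>, of R] by blast
  have "(\<integral>\<^sup>+z. ennreal (norm (conv \<rho> u z - u z) ^ p) * indicator (cball 0 R) z \<partial>lborel) \<le> ennreal e"
    if \<rho>: "mollifier d \<rho>" and cu: "continuous_on UNIV (conv \<rho> u)" for \<rho>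
  proof -
    have iu: "integrable lborel (\<lambda>y. \<rho> (z - y) *\<^sub>R u y)" for z
      by (rule conv_integrable[OF \<rho> u p fin])
    have ic: "integrable lborel (\<lambda>y. \<rho> (z - y) *\<^sub>R c y)" for z
      by (rule conv_integrable[OF \<rho> cm p cball_nn_finite_continuous[OF c]])
    have lin: "conv \<rho> (\<lambda>y. u y - c y) z = conv \<rho> u z - conv \<rho> c z" for z
      unfolding conv_def scaleR_diff_right by (rule Bochner_Integration.integral_diff[OF iu ic])
    have [measurable]: "conv \<rho> u \<in> borel_measurable borel" using cu by (rule borel_measurable_continuous_onI)
    have "continuous_on UNIV (conv \<rho> c)"
      using \<rho> by (intro continuous_on_conv[of \<rho> d] c) (auto simp: mollifier_def)
    then have [measurable]: "conv \<rho> c \<in> borel_measurable borel" by (rule borel_measurable_continuous_onI)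
    have m1: "(\<lambda>x. conv \<rho> u x - conv \<rho> c x) \<in> borel_measurable borel" by measurable
    have m2: "(\<lambda>x. conv \<rho> c x - c x) \<in> borel_measurable borel" by measurable
    have m3: "(\<lambda>x. c x - u x) \<in> borel_measurable borel" by measurable
    have "(\<integral>\<^sup>+z. ennreal (norm (conv \<rho> u z - u z) ^ p) * indicator (cball 0 R) z \<partial>lborel) \<le> 3 ^ p *
     ((\<integral>\<^sup>+x. ennreal (norm (conv \<rho> u x - conv \<rho> c x) ^ p) * indicator (cball 0 R) x \<partial>lborel) +
      (\<integral>\<^sup>+x. ennreal (norm (conv \<rho> c x - c x) ^ p) * indicator (cball 0 R) x \<partial>lborel) +
      (\<integral>\<^sup>+x. ennreal (norm (c x - u x) ^ p) * indicator (cball 0 R) x \<partial>lborel))"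
      by (rule nn_integral_add3_power[OF m1 m2 m3 B]) simp
    also have "\<dots> \<le> 3 ^ p * (ennreal e1 + ennreal e1 + ennreal e1)"
    proof (intro mult_left_mono add_mono)
      have "(\<integral>\<^sup>+x. ennreal (norm (conv \<rho> (\<lambda>y. u y - c y) x) ^ p) * indicator (cball 0 R) x \<partial>lborel)
         \<le> (\<integral>\<^sup>+x. ennreal (norm (u x - c x) ^ p) * indicator (cball 0 (R + d)) x \<partial>lborel)"
        by (rule conv_Lp_bound[OF \<rho> _ p]) measurable
      also have "\<dots> \<le> (\<integral>\<^sup>+x. ennreal (norm (u x - c x) ^ p) * indicator (cball 0 (R + 1)) x \<partial>lborel)"
        using d(2) by (intro nn_integral_mono mult_left_mono) (auto simp: indicator_def)
      also have "\<dots> \<le> ennreal e1" by (rule ce)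
      finally show "(\<integral>\<^sup>+x. ennreal (norm (conv \<rho> u x - conv \<rho> c x) ^ p) * indicator (cball 0 R) x \<partial>lborel) \<le> ennreal e1"
        by (simp only: lin)
      have "(\<integral>\<^sup>+x. ennreal (norm (conv \<rho> c x - c x) ^ p) * indicator (cball 0 R) x \<partial>lborel)
         \<le> (\<integral>\<^sup>+x. ennreal (\<eta> ^ p) * indicator (cball (0::complex) R) x \<partial>lborel)"
      proof (rule nn_integral_mono)
        fix x
        show "ennreal (norm (conv \<rho> c x - c x) ^ p) * indicator (cball 0 R) x \<le> ennreal (\<eta> ^ p) * indicator (cball (0::complex) R) x"
          using dc[OF \<rho>, of x] by (cases "x \<in> cball 0 R") (auto intro!: ennreal_leI power_mono simp del: mem_cball)
      qed
      also have "\<dots> = ennreal (\<eta> ^ p) * ennreal V" by (simp only: nn_integral_cmult_indicator B sets_lborel V)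
      also have "\<dots> \<le> ennreal e1" using \<eta>p \<eta> V0 by (simp add: ennreal_leI flip: ennreal_mult)
      finally show "(\<integral>\<^sup>+x. ennreal (norm (conv \<rho> c x - c x) ^ p) * indicator (cball 0 R) x \<partial>lborel) \<le> ennreal e1" .
      have "(\<integral>\<^sup>+x. ennreal (norm (c x - u x) ^ p) * indicator (cball 0 R) x \<partial>lborel)
         \<le> (\<integral>\<^sup>+x. ennreal (norm (u x - c x) ^ p) * indicator (cball 0 (R + 1)) x \<partial>lborel)"
        by (intro nn_integral_mono mult_mono) (auto simp: indicator_def norm_minus_commute)
      also note ce
      finally show "(\<integral>\<^sup>+x. ennreal (norm (c x - u x) ^ p) * indicator (cball 0 R) x \<partial>lborel) \<le> ennreal e1" .
    qed simp
    also have "\<dots> = ennreal (3 ^ p * (e1 + e1 + e1))"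
    proof -
      have "ennreal (3 ^ p) = 3 ^ p" by (metis ennreal_numeral ennreal_power zero_le_numeral)
      moreover have "ennreal (3 ^ p * (e1 + e1 + e1)) = ennreal (3 ^ p) * ennreal (e1 + e1 + e1)"
        using e1 by (intro ennreal_mult) auto
      moreover have "ennreal (e1 + e1 + e1) = ennreal e1 + ennreal e1 + ennreal e1"
        using e1 ennreal_plus[of "e1 + e1" e1] ennreal_plus[of e1 e1] by (simp only: add_nonneg_nonneg less_imp_le)
      ultimately show ?thesis by (simp only:)
    qed
    also have "\<dots> = ennreal e" by (simp add: e1_def field_simps)
    finally show ?thesis .
  qed
  with d show ?thesis by blast
qed

section \<open>Weak derivatives and their mollifications\<close>

lemma Ck_reflect:
  fixes f :: "'a::euclidean_space \<Rightarrow> real"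
  shows "Ck k f \<Longrightarrow> Ck k (\<lambda>y. f (z - y))"
proof (induction k arbitrary: f)
  case 0
  then have "continuous_on UNIV f" by simp
  then have "continuous_on UNIV (\<lambda>y. f (z - y))"
    by (rule continuous_on_compose2) (auto intro!: continuous_on_diff continuous_on_const continuous_on_id)
  then show ?case by simp
next
  case (Suc k)
  have d: "((\<lambda>y. f (z - y)) has_derivative (\<lambda>v. (-1) * frechet_derivative f (at (z - y)) v)) (at y)" for y
  proof -
    have f: "(f has_derivative frechet_derivative f (at (z - y))) (at (z - y))"
      using Suc.prems frechet_derivative_works by (auto simp: differentiable_on_def)
    have "((\<lambda>y. z - y) has_derivative (\<lambda>v. - v)) (at y)"
      by (rule has_derivative_eq_rhs[OF has_derivative_diff[OF has_derivative_const has_derivative_ident]]) simp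
    from has_derivative_compose[OF this f]
    show ?thesis using linear_neg[OF has_derivative_linear[OF f]] by simp
  qed
  have "Ck k (\<lambda>y. (-1) * frechet_derivative f (at (z - y)) v)" for v
    using Suc.prems by (intro Ck_mult Ck_const Suc.IH) simp
  moreover have "frechet_derivative (\<lambda>y. f (z - y)) (at y) = (\<lambda>v. (-1) * frechet_derivative f (at (z - y)) v)" for y
    by (rule frechet_derivative_at[OF d, symmetric])
  moreover have "(\<lambda>y. f (z - y)) differentiable_on UNIV"
    using d by (auto simp: differentiable_on_def differentiable_def)
  ultimately show ?case by simp
qed

text \<open>
The definition of the weak derivative, tested against \<open>\<lambda>y. \<rho> (z - y)\<close>.
Two sign changes cancel: one from the reflection, one from the integration by parts.
\<close>

lemma weak_partial_conv:
  assumes wp: "weak_partial UNIV v f g" and f: "continuous_on UNIV f"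
    and \<rho>: "\<And>k. Ck k \<rho>" "\<And>z. norm z > d \<Longrightarrow> \<rho> z = 0"
    and der: "\<And>z. (\<rho> has_derivative D z) (at z)" and Dc: "continuous_on UNIV (\<lambda>z. D z v)"
    and g'[measurable]: "g' \<in> borel_measurable borel" and ae: "AE z in lborel. g z = g' z"
  shows "conv (\<lambda>z. D z v) f z = conv \<rho> g' z"
proof -
  define \<phi> where "\<phi> y = \<rho> (z - y)" for y
  have rc: "continuous_on UNIV \<rho>" using \<rho>(1)[of 0] by simp
  have "{y. \<phi> y \<noteq> 0} \<subseteq> cball z d"
    using \<rho>(2) unfolding \<phi>_def by (auto simp: dist_norm) (meson not_le)
  then have "closure {y. \<phi> y \<noteq> 0} \<subseteq> cball z d" by (simp add: closure_minimal)
  then have "compact (closure {y. \<phi> y \<noteq> 0})"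
    by (meson bounded_cball bounded_subset closed_closure compact_eq_bounded_closed)
  then have tf: "test_function UNIV \<phi>"
    unfolding test_function_def \<phi>_def using Ck_reflect[OF \<rho>(1)] by simp
  have fd: "frechet_derivative \<phi> (at y) v = - D (z - y) v" for y
  proof -
    have "((\<lambda>y. z - y) has_derivative (\<lambda>v. - v)) (at y)"
      by (rule has_derivative_eq_rhs[OF has_derivative_diff[OF has_derivative_const has_derivative_ident]]) simp
    from has_derivative_compose[OF this der[of "z - y"]]
    have "(\<phi> has_derivative (\<lambda>v. - D (z - y) v)) (at y)"
      unfolding \<phi>_def using linear_neg[OF has_derivative_linear[OF der]] by simp
    from frechet_derivative_at[OF this] show ?thesis by metis
  qed
  have "(LINT y:UNIV|lebesgue. frechet_derivative \<phi> (at y) v *\<^sub>R f y) = - (LINT y:UNIV|lebesgue. \<phi> y *\<^sub>R g y)"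
    using wp tf unfolding weak_partial_def by blast
  then have eq: "(\<integral>y. - (D (z - y) v *\<^sub>R f y) \<partial>lebesgue) = - (\<integral>y. \<rho> (z - y) *\<^sub>R g y \<partial>lebesgue)"
    unfolding set_lebesgue_integral_def fd \<phi>_def by simp
  have [measurable]: "f \<in> borel_measurable borel" "\<rho> \<in> borel_measurable borel" "(\<lambda>z. D z v) \<in> borel_measurable borel"
    using f rc Dc by (auto intro: borel_measurable_continuous_onI)
  have Dm: "(\<lambda>y. D (z - y) v) \<in> borel_measurable borel"
    by (rule measurable_compose[where f = "\<lambda>y. z - y" and g = "\<lambda>z. D z v"]) measurable
  have 1: "(\<integral>y. - (D (z - y) v *\<^sub>R f y) \<partial>lebesgue) = - conv (\<lambda>z. D z v) f z"
    unfolding conv_def using Dm by (subst integral_completion) (auto intro!: borel_measurable_scaleR)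
  have gm: "g \<in> borel_measurable lebesgue"
    using wp by (simp add: weak_partial_def Lp_loc_def lebesgue_on_UNIV_eq)
  have rm: "(\<lambda>y. \<rho> (z - y)) \<in> borel_measurable lebesgue"
    by (rule measurable_completion) measurable
  have gm': "g' \<in> borel_measurable lebesgue"
    by (rule measurable_completion) measurable
  have "(\<integral>y. \<rho> (z - y) *\<^sub>R g y \<partial>lebesgue) = (\<integral>y. \<rho> (z - y) *\<^sub>R g' y \<partial>lebesgue)"
    by (rule integral_cong_AE) (use gm gm' rm ae in \<open>auto intro!: borel_measurable_scaleR simp: AE_completion_iff\<close>)
  also have "\<dots> = conv \<rho> g' z"
    unfolding conv_def by (subst integral_completion) auto
  finally show ?thesis using eq 1 by simp
qed

text \<open>
Weak derivatives are only Lebesgue measurable; a Borel version is needed for compositions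
and iterated integrals.
\<close>

lemma lebesgue_borel_rep:
  fixes g :: "complex \<Rightarrow> complex"
  assumes "g \<in> borel_measurable lebesgue"
  obtains g' where "g' \<in> borel_measurable borel" "AE z in lborel. g z = g' z"
proof -
  have "(\<lambda>z. Re (g z)) \<in> borel_measurable lebesgue" "(\<lambda>z. Im (g z)) \<in> borel_measurable lebesgue"
    using assms by measurable
  from this[THEN completion_ex_borel_measurable_real]
  obtain a b where ab: "a \<in> borel_measurable lborel" "AE x in lborel. Re (g x) = a x"
    "b \<in> borel_measurable lborel" "AE x in lborel. Im (g x) = b x" by blast
  have "(\<lambda>x. Complex (a x) (b x)) \<in> borel_measurable borel"
    using ab(1,3) unfolding borel_measurable_complex_iff by simp
  moreover have "AE z in lborel. g z = Complex (a z) (b z)"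
    using ab(2,4) by eventually_elim (simp add: complex_eq_iff)
  ultimately show ?thesis using that by blast
qed

lemma Lp_loc_nn_integral:
  fixes u u' :: "complex \<Rightarrow> complex"
  assumes "Lp_loc p UNIV u" and [measurable]: "u' \<in> borel_measurable borel" and ae: "AE z in lborel. u z = u' z"
  shows "(\<integral>\<^sup>+x. ennreal (norm (u' x) ^ p) * indicator (cball 0 R) x \<partial>lborel) < \<infinity>"
proof -
  have "set_integrable lebesgue (cball 0 R) (\<lambda>z. norm (u z) ^ p)"
    using assms(1) unfolding Lp_loc_def by simp
  then have "(\<integral>\<^sup>+x. ennreal (norm (indicator (cball 0 R) x *\<^sub>R (norm (u x) ^ p))) \<partial>lebesgue) < \<infinity>"
    unfolding set_integrable_def integrable_iff_bounded by blast
  also have "(\<integral>\<^sup>+x. ennreal (norm (indicator (cball 0 R) x *\<^sub>R (norm (u x) ^ p))) \<partial>lebesgue)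
    = (\<integral>\<^sup>+x. ennreal (norm (indicator (cball 0 R) x *\<^sub>R (norm (u x) ^ p))) \<partial>lborel)"
    by (rule nn_integral_completion)
  also have "\<dots> = (\<integral>\<^sup>+x. ennreal (norm (u' x) ^ p) * indicator (cball 0 R) x \<partial>lborel)"
  proof (rule nn_integral_cong_AE)
    show "AE x in lborel. ennreal (norm (indicator (cball 0 R) x *\<^sub>R (norm (u x) ^ p))) = ennreal (norm (u' x) ^ p) * indicator (cball 0 R) x"
      using ae by eventually_elim (auto simp: indicator_def)
  qed
  finally show ?thesis .
qed

section \<open>The distortion inequality in Wirtinger form\<close>

text \<open>
The Wirtinger derivatives of a map with partial derivatives \<open>p\<close> and \<open>q\<close>: the differential is
\<open>w \<mapsto> dz p q * w + dzb p q * cnj w\<close>.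
\<close>

definition dz :: "complex \<Rightarrow> complex \<Rightarrow> complex" where "dz p q = (p - \<i> * q) / 2"
definition dzb :: "complex \<Rightarrow> complex \<Rightarrow> complex" where "dzb p q = (p + \<i> * q) / 2"

lemma det_diff_matrix: "det (diff_matrix p q) = (norm (dz p q))\<^sup>2 - (norm (dzb p q))\<^sup>2"
proof -
  have "(norm (dz p q))\<^sup>2 = ((Re p + Im q)\<^sup>2 + (Im p - Re q)\<^sup>2) / 4"
    by (simp add: dz_def norm_divide power_divide cmod_power2)
  moreover have "(norm (dzb p q))\<^sup>2 = ((Re p - Im q)\<^sup>2 + (Im p + Re q)\<^sup>2) / 4"
    by (simp add: dzb_def norm_divide power_divide cmod_power2)
  ultimately show ?thesis
    by (simp add: diff_matrix_def det_2 vector_2 power2_eq_square field_simps)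
qed

lemma diff_matrix_mult:
  "diff_matrix p q *v vector [Re w, Im w] = vector [Re (dz p q * w + dzb p q * cnj w), Im (dz p q * w + dzb p q * cnj w)]"
  by (simp add: diff_matrix_def vec_eq_iff forall_2 matrix_vector_mult_def sum_2 vector_2 dz_def dzb_def field_simps)

lemma norm_vector_2: "norm (vector [x, y] :: real^2) = norm (Complex x y)"
  by (simp add: norm_vec_def L2_set_def sum_2 vector_2 cmod_def)

text \<open>
Turning \<open>w\<close> by an angle \<open>t\<close> turns the two summands by \<open>t\<close> and by \<open>- t\<close>, so they can be given the same
argument.
\<close>

lemma ex_aligned: "\<exists>w. norm w = 1 \<and> norm (m * w + n * cnj w) = norm m + norm n"
proof -
  define t where "t = (Arg n - Arg m) / 2"
  define w where "w = cis t"
  have "m * w + n * cnj w = of_real (norm m) * cis (Arg m + t) + of_real (norm n) * cis (Arg n - t)"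
  proof -
    have "m = of_real (norm m) * cis (Arg m)" "n = of_real (norm n) * cis (Arg n)"
      by (simp_all add: cis_Arg rcis_cmod_Arg[unfolded rcis_def])
    then have "m * w = of_real (norm m) * cis (Arg m) * cis t" "n * cnj w = of_real (norm n) * cis (Arg n) * cis (- t)"
      by (simp_all add: w_def cis_cnj)
    then show ?thesis by (simp add: mult.assoc cis_mult)
  qed
  also have "Arg m + t = Arg n - t" by (simp add: t_def field_simps)
  also have "of_real (norm m) * cis (Arg n - t) + of_real (norm n) * cis (Arg n - t) = of_real (norm m + norm n) * cis (Arg n - t)"
    by (simp add: algebra_simps)
  finally have "norm (m * w + n * cnj w) = norm m + norm n" by (simp only: norm_mult norm_cis norm_of_real) simp
  moreover have "norm w = 1" by (simp add: w_def)
  ultimately show ?thesis by blast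
qed

lemma onorm_diff_matrix: "onorm (\<lambda>h. diff_matrix p q *v h) = norm (dz p q) + norm (dzb p q)"
proof (rule antisym)
  have rep: "h = vector [Re (Complex (h $ 1) (h $ 2)), Im (Complex (h $ 1) (h $ 2))]" for h :: "real^2"
    by (simp add: vec_eq_iff forall_2 vector_2)
  show "onorm (\<lambda>h. diff_matrix p q *v h) \<le> norm (dz p q) + norm (dzb p q)"
  proof (rule onorm_le)
    fix h :: "real^2"
    define w where "w = Complex (h $ 1) (h $ 2)"
    have h: "h = vector [Re w, Im w]" unfolding w_def by (rule rep)
    have "norm (diff_matrix p q *v h) = norm (dz p q * w + dzb p q * cnj w)"
      by (simp only: h diff_matrix_mult norm_vector_2 complex_surj)
    also have "\<dots> \<le> norm (dz p q) * norm w + norm (dzb p q) * norm w"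
      by (metis complex_mod_cnj norm_mult norm_triangle_ineq)
    also have "norm w = norm h" unfolding h norm_vector_2 by simp
    finally show "norm (diff_matrix p q *v h) \<le> (norm (dz p q) + norm (dzb p q)) * norm h"
      by (simp add: algebra_simps)
  qed
  obtain w where w: "norm w = 1" "norm (dz p q * w + dzb p q * cnj w) = norm (dz p q) + norm (dzb p q)"
    using ex_aligned by blast
  have "norm (diff_matrix p q *v vector [Re w, Im w]) \<le> onorm (\<lambda>h. diff_matrix p q *v h) * norm (vector [Re w, Im w] :: real^2)"
    by (rule onorm[OF matrix_vector_mul_bounded_linear])
  then show "norm (dz p q) + norm (dzb p q) \<le> onorm (\<lambda>h. diff_matrix p q *v h)"
    by (simp only: diff_matrix_mult norm_vector_2 complex_surj w mult_1_right)
qed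

text \<open>
The amount by which the distortion inequality fails for the partial derivatives \<open>p\<close> and \<open>q\<close>.
\<close>

definition defect :: "real \<Rightarrow> complex \<Rightarrow> complex \<Rightarrow> real" where
  "defect K p q = max 0 ((norm (dz p q) + norm (dzb p q))\<^sup>2 - K * ((norm (dz p q))\<^sup>2 - (norm (dzb p q))\<^sup>2))"

text \<open>
With \<open>\<mu>\<close>, \<open>\<nu>\<close> the moduli of the Wirtinger derivatives, the defect factors as
\<open>(\<mu> + \<nu>) * ((1 - K) * \<mu> + (1 + K) * \<nu>)\<close>. Where the distortion inequality holds the second factor is
at most zero, so nearby its positive part is at most a multiple of the distance; the product is then
linear in the distance with a coefficient in \<open>L2\<close>. The parameter \<open>\<tau>\<close> splits this product into squares.
\<close>

lemma defect_bound:
  assumes K: "K \<ge> 1" and \<tau>: "\<tau> > 0"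
    and d: "(norm (dz p q) + norm (dzb p q))\<^sup>2 \<le> K * ((norm (dz p q))\<^sup>2 - (norm (dzb p q))\<^sup>2)"
  shows "defect K p' q' \<le> (K + 1) * (2 * \<tau>) * ((norm p)\<^sup>2 + (norm q)\<^sup>2)
     + (K + 1) * (2 * (1 + 1 / \<tau>)) * ((norm (p' - p))\<^sup>2 + (norm (q' - q))\<^sup>2)"
proof -
  define m n m' n' where "m = norm (dz p q)" "n = norm (dzb p q)" "m' = norm (dz p' q')" "n' = norm (dzb p' q')"
  note defs = this
  have nn: "0 \<le> m" "0 \<le> n" "0 \<le> m'" "0 \<le> n'" by (simp_all add: defs)
  define Y D where "Y = norm p + norm q" "D = norm (p' - p) + norm (q' - q)"
  note YD = this
  have half: "norm ((x + y) / 2 :: complex) \<le> (norm x + norm y) / 2" for x y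
    using norm_triangle_ineq[of x y] by (simp add: norm_divide)
  have half': "norm ((x - y) / 2 :: complex) \<le> (norm x + norm y) / 2" for x y
    using norm_triangle_ineq4[of x y] by (simp add: norm_divide)
  have X: "m + n \<le> Y"
    using half'[of p "\<i> * q"] half[of p "\<i> * q"] by (simp add: defs dz_def dzb_def YD norm_mult)
  have e: "dz p' q' - dz p q = ((p' - p) - \<i> * (q' - q)) / 2" "dzb p' q' - dzb p q = ((p' - p) + \<i> * (q' - q)) / 2"
    by (simp_all add: dz_def dzb_def field_simps)
  have "norm (dz p' q' - dz p q) \<le> D / 2" "norm (dzb p' q' - dzb p q) \<le> D / 2"
    unfolding e using half'[of "p' - p" "\<i> * (q' - q)"] half[of "p' - p" "\<i> * (q' - q)"]
    by (simp_all add: YD norm_mult)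
  then have mm: "\<bar>m' - m\<bar> \<le> D / 2" "\<bar>n' - n\<bar> \<le> D / 2"
    unfolding defs using norm_triangle_ineq3 order_trans by blast+
  have D0: "D \<ge> 0" "Y \<ge> 0" by (simp_all add: YD)
  have neg: "(1 - K) * m + (1 + K) * n \<le> 0"
  proof (cases "m + n = 0")
    case True
    then have "m = 0" "n = 0" using nn by auto
    then show ?thesis by simp
  next
    case False
    have "(m + n) * ((1 - K) * m + (1 + K) * n) \<le> 0"
      using d unfolding defs[symmetric] by (simp add: power2_eq_square algebra_simps)
    with False nn show ?thesis by (simp add: mult_le_0_iff)
  qed
  have "(1 - K) * m' + (1 + K) * n' \<le> (K + 1) * D"
  proof -
    have "(1 - K) * (m' - m) \<le> (K + 1) * (D / 2)"
    proof -
      have "(1 - K) * (m' - m) \<le> \<bar>1 - K\<bar> * \<bar>m' - m\<bar>" by (metis abs_ge_self abs_mult)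
      also have "\<dots> \<le> (K + 1) * (D / 2)" using K mm D0 by (intro mult_mono) auto
      finally show ?thesis .
    qed
    moreover have "(1 + K) * (n' - n) \<le> (K + 1) * (D / 2)"
    proof -
      have "n' - n \<le> D / 2" using mm by linarith
      then show ?thesis using K by (subst add.commute) (rule mult_left_mono, simp_all)
    qed
    ultimately show ?thesis using neg by (simp add: algebra_simps)
  qed
  then have "(m' + n') * ((1 - K) * m' + (1 + K) * n') \<le> (m' + n') * ((K + 1) * D)"
    using nn by (intro mult_left_mono) auto
  also have "\<dots> \<le> (Y + D) * ((K + 1) * D)"
  proof (rule mult_right_mono)
    show "m' + n' \<le> Y + D" using X mm by linarith
  qed (use K D0 in auto)
  finally have "(m' + n')\<^sup>2 - K * (m'\<^sup>2 - n'\<^sup>2) \<le> (K + 1) * (Y * D + D\<^sup>2)"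
    by (simp add: power2_eq_square algebra_simps)
  moreover have "0 \<le> (K + 1) * (Y * D + D\<^sup>2)" using K D0 by auto
  ultimately have 1: "defect K p' q' \<le> (K + 1) * (Y * D + D\<^sup>2)"
    unfolding defect_def defs[symmetric] by simp
  have "Y * D \<le> \<tau> * Y\<^sup>2 + D\<^sup>2 / \<tau>"
  proof -
    have "0 \<le> (\<tau> * Y - D)\<^sup>2" by simp
    then have "2 * \<tau> * (Y * D) \<le> \<tau> * (\<tau> * Y\<^sup>2) + D\<^sup>2" by (simp add: power2_eq_square algebra_simps)
    moreover have "\<tau> * (Y * D) \<ge> 0" using \<tau> D0 by simp
    ultimately have "\<tau> * (Y * D) \<le> \<tau> * (\<tau> * Y\<^sup>2) + D\<^sup>2" by linarith
    then have "\<tau> * (Y * D) \<le> \<tau> * (\<tau> * Y\<^sup>2 + D\<^sup>2 / \<tau>)" using \<tau> by (simp add: algebra_simps)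
    then show ?thesis using \<tau> by simp
  qed
  then have 2: "Y * D + D\<^sup>2 \<le> \<tau> * Y\<^sup>2 + (1 + 1 / \<tau>) * D\<^sup>2" by (simp add: algebra_simps)
  have sq: "(x + y)\<^sup>2 \<le> 2 * (x\<^sup>2 + y\<^sup>2)" for x y :: real
    using sum_squares_bound[of x y] by (simp add: power2_eq_square algebra_simps)
  have 3: "\<tau> * Y\<^sup>2 \<le> (2 * \<tau>) * ((norm p)\<^sup>2 + (norm q)\<^sup>2)"
    using mult_left_mono[OF sq[of "norm p" "norm q"], of \<tau>] \<tau> by (simp add: YD)
  have 4: "(1 + 1 / \<tau>) * D\<^sup>2 \<le> (2 * (1 + 1 / \<tau>)) * ((norm (p' - p))\<^sup>2 + (norm (q' - q))\<^sup>2)"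
  proof -
    have "0 \<le> 1 + 1 / \<tau>" using \<tau> by simp
    from mult_left_mono[OF sq[of "norm (p' - p)" "norm (q' - q)"] this]
    show ?thesis unfolding YD(2)[symmetric] by (simp only: ac_simps)
  qed
  have "(K + 1) * (Y * D + D\<^sup>2) \<le> (K + 1) * ((2 * \<tau>) * ((norm p)\<^sup>2 + (norm q)\<^sup>2) + (2 * (1 + 1 / \<tau>)) * ((norm (p' - p))\<^sup>2 + (norm (q' - q))\<^sup>2))"
    using K 2 3 4 by (intro mult_left_mono) linarith+
  with 1 show ?thesis by (simp add: ring_distribs mult.assoc)
qed

section \<open>Polar coordinates\<close>

lemma lborel_complex:
  "(lborel :: complex measure) = distr (lborel \<Otimes>\<^sub>M lborel) borel (\<lambda>(x, y). Complex x y)"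
proof (rule lborel_eqI)
  have [measurable]: "(\<lambda>(x, y). Complex x y) \<in> borel \<Otimes>\<^sub>M borel \<rightarrow>\<^sub>M borel"
    unfolding borel_measurable_complex_iff by (simp add: split_beta)
  fix l u :: complex assume le: "\<And>b. b \<in> Basis \<Longrightarrow> l \<bullet> b \<le> u \<bullet> b"
  have eq: "(\<lambda>(x, y). Complex x y) -` box l u \<inter> space (lborel \<Otimes>\<^sub>M lborel) = {Re l<..<Re u} \<times> {Im l<..<Im u}"
    by (auto simp: box_def Basis_complex_def inner_complex_def space_pair_measure)
  have le2: "Re l \<le> Re u" "Im l \<le> Im u"
    using le[of 1] le[of \<i>] by (auto simp: Basis_complex_def)
  have "emeasure (distr (lborel \<Otimes>\<^sub>M lborel) borel (\<lambda>(x, y). Complex x y)) (box l u)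
      = emeasure (lborel \<Otimes>\<^sub>M lborel) ({Re l<..<Re u} \<times> {Im l<..<Im u})"
    by (subst emeasure_distr) (auto simp: eq)
  also have "\<dots> = ennreal (Re u - Re l) * ennreal (Im u - Im l)"
    using le2 by (subst lborel.emeasure_pair_measure_Times) auto
  also have "\<dots> = ennreal ((Re u - Re l) * (Im u - Im l))" using le2 by (simp add: ennreal_mult)
  also have "\<dots> = ennreal (\<Prod>b\<in>Basis. (u - l) \<bullet> b)"
    by (simp add: Basis_complex_def)
  finally show "emeasure (distr (lborel \<Otimes>\<^sub>M lborel) borel (\<lambda>(x, y). Complex x y)) (box l u) = ennreal (\<Prod>b\<in>Basis. (u - l) \<bullet> b)" .
qed simp

lemma measurable_Complex [measurable]: "(\<lambda>(x, y). Complex x y) \<in> borel \<Otimes>\<^sub>M borel \<rightarrow>\<^sub>M borel"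
  unfolding borel_measurable_complex_iff by (simp add: split_beta)

lemma borel_measurable_Complex [measurable (raw)]:
  assumes "f \<in> borel_measurable M" "g \<in> borel_measurable M"
  shows "(\<lambda>x. Complex (f x) (g x)) \<in> borel_measurable M"
  using assms unfolding borel_measurable_complex_iff by simp

lemma nn_integral_complex:
  fixes G :: "complex \<Rightarrow> ennreal"
  assumes [measurable]: "G \<in> borel_measurable borel"
  shows "(\<integral>\<^sup>+z. G z \<partial>lborel) = (\<integral>\<^sup>+x. (\<integral>\<^sup>+y. G (Complex x y) \<partial>lborel) \<partial>lborel)"
proof -
  have "(\<integral>\<^sup>+z. G z \<partial>lborel) = (\<integral>\<^sup>+xy. G (case xy of (x, y) \<Rightarrow> Complex x y) \<partial>(lborel \<Otimes>\<^sub>M lborel))"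
    by (subst lborel_complex) (simp add: nn_integral_distr)
  also have "\<dots> = (\<integral>\<^sup>+x. (\<integral>\<^sup>+y. G (Complex x y) \<partial>lborel) \<partial>lborel)"
    by (subst lborel.nn_integral_fst[symmetric]) (simp_all add: split_beta)
  finally show ?thesis .
qed

lemma nn_integral_times_i:
  fixes G :: "complex \<Rightarrow> ennreal"
  assumes [measurable]: "G \<in> borel_measurable borel"
  shows "(\<integral>\<^sup>+z. G (\<i> * z) \<partial>lborel) = (\<integral>\<^sup>+z. G z \<partial>lborel)"
proof -
  have [measurable]: "(\<lambda>z. G (\<i> * z)) \<in> borel_measurable borel"
    by (rule measurable_compose[OF _ assms]) (auto intro!: borel_measurable_continuous_onI continuous_intros)
  have "(\<integral>\<^sup>+z. G (\<i> * z) \<partial>lborel) = (\<integral>\<^sup>+x. (\<integral>\<^sup>+y. G (\<i> * Complex x y) \<partial>lborel) \<partial>lborel)"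
    by (rule nn_integral_complex) measurable
  also have "\<dots> = (\<integral>\<^sup>+y. (\<integral>\<^sup>+x. G (\<i> * Complex x y) \<partial>lborel) \<partial>lborel)"
    by (rule lborel_pair.Fubini'[symmetric]) measurable
  also have "\<dots> = (\<integral>\<^sup>+y. (\<integral>\<^sup>+x. G (Complex (0 - y) x) \<partial>lborel) \<partial>lborel)"
    by (intro nn_integral_cong arg_cong[where f = G]) (simp add: complex_eq_iff)
  also have "\<dots> = (\<integral>\<^sup>+y. (\<integral>\<^sup>+x. G (Complex y x) \<partial>lborel) \<partial>lborel)"
    by (rule nn_integral_reflect) measurable
  also have "\<dots> = (\<integral>\<^sup>+z. G z \<partial>lborel)"
    by (rule nn_integral_complex[symmetric]) measurable
  finally show ?thesis .
qed

lemma abs_less_imp_cos_pos: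
  "\<bar>t\<bar> \<le> pi / 4 \<Longrightarrow> cos t > 0"
proof -
  assume "\<bar>t\<bar> \<le> pi / 4"
  then have "- (pi / 2) < t" "t < pi / 2" using pi_gt_zero by linarith+
  then show ?thesis by (rule cos_gt_zero_pi)
qed

lemma borel_measurable_tan [measurable]: "(tan :: real \<Rightarrow> real) \<in> borel_measurable borel"
  unfolding tan_def[abs_def] by (intro borel_measurable_divide borel_measurable_continuous_onI continuous_intros)

text \<open>
Polar coordinates by two substitutions in one variable: \<open>x = r * cos t\<close> for fixed \<open>t\<close>, then
\<open>y = x * tan t\<close> for fixed \<open>x\<close>. This works as long as \<open>cos t\<close> stays away from zero, hence the
restriction to a quarter of the circle. Only an inequality is claimed, so that no image sets have to be identified.
\<close>

lemma polar_sector_le: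
  fixes G :: "complex \<Rightarrow> ennreal"
  assumes G[measurable]: "G \<in> borel_measurable borel" and ab: "0 < a" "a < b"
  shows "(\<integral>\<^sup>+t. (\<integral>\<^sup>+r. G (rcis r t) * ennreal r * indicator {a..b} r \<partial>lborel) * indicator {-(pi/4)..pi/4} t \<partial>lborel)
     \<le> (\<integral>\<^sup>+z. G z \<partial>lborel)"
proof -
  have "(\<integral>\<^sup>+t. (\<integral>\<^sup>+r. G (rcis r t) * ennreal r * indicator {a..b} r \<partial>lborel) * indicator {-(pi/4)..pi/4} t \<partial>lborel)
    \<le> (\<integral>\<^sup>+t. (\<integral>\<^sup>+x. G (Complex x (x * tan t)) * ennreal (x * inverse ((cos t)\<^sup>2)) * indicator {0..} x \<partial>lborel) * indicator {-(pi/4)..pi/4} t \<partial>lborel)"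
  proof (rule nn_integral_mono)
    fix t :: real
    show "(\<integral>\<^sup>+r. G (rcis r t) * ennreal r * indicator {a..b} r \<partial>lborel) * indicator {-(pi/4)..pi/4} t
      \<le> (\<integral>\<^sup>+x. G (Complex x (x * tan t)) * ennreal (x * inverse ((cos t)\<^sup>2)) * indicator {0..} x \<partial>lborel) * indicator {-(pi/4)..pi/4} t"
    proof (cases "t \<in> {-(pi/4)..pi/4}")
      case True
      then have c: "cos t > 0" by (intro abs_less_imp_cos_pos) auto
      let ?F = "\<lambda>x. G (Complex x (x * tan t)) * ennreal (x * inverse ((cos t)\<^sup>2))"
      have "(\<integral>\<^sup>+r. G (rcis r t) * ennreal r * indicator {a..b} r \<partial>lborel)
        = (\<integral>\<^sup>+r. ?F (cos t * r) * ennreal (cos t) * indicator {a..b} r \<partial>lborel)"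
      proof (intro nn_integral_cong)
        fix r :: real
        show "G (rcis r t) * ennreal r * indicator {a..b} r = ?F (cos t * r) * ennreal (cos t) * indicator {a..b} r"
        proof (cases "r \<in> {a..b}")
          case r: True
          then have "r > 0" using ab by auto
          have "Complex (cos t * r) (cos t * r * tan t) = rcis r t"
            using c by (simp add: complex_eq_iff tan_def)
          moreover have "ennreal (cos t * r * inverse ((cos t)\<^sup>2)) * ennreal (cos t) = ennreal r"
          proof -
            have "cos t * r * inverse ((cos t)\<^sup>2) * cos t = r"
              using c by (simp add: power2_eq_square field_simps)
            then show ?thesis
              using c \<open>r > 0\<close> by (metis ennreal_mult'' less_imp_le)
          qed
          ultimately show ?thesis by (simp add: mult.assoc)
        qed simp
      qed
      also have "\<dots> = (\<integral>\<^sup>+x. ?F x * indicator {cos t * a..cos t * b} x \<partial>lborel)"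
        using ab c by (intro nn_integral_substitution_aux[symmetric]) (auto intro!: derivative_eq_intros)
      also have "\<dots> \<le> (\<integral>\<^sup>+x. ?F x * indicator {0..} x \<partial>lborel)"
      proof (intro nn_integral_mono mult_left_mono)
        fix x
        have "0 \<le> cos t * a" using c ab by simp
        then have "{cos t * a..cos t * b} \<subseteq> {0..}" by auto
        then show "indicator {cos t * a..cos t * b} x \<le> (indicator {0..} x :: ennreal)"
          by (rule indicator_leI[OF subsetD])
      qed simp
      finally show ?thesis using True by simp
    qed simp
  qed
  also have "\<dots> = (\<integral>\<^sup>+t. (\<integral>\<^sup>+x. G (Complex x (x * tan t)) * ennreal (x * inverse ((cos t)\<^sup>2)) * indicator {0..} x * indicator {-(pi/4)..pi/4} t \<partial>lborel) \<partial>lborel)"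
    by (intro nn_integral_cong nn_integral_multc[symmetric]) measurable
  also have "\<dots> = (\<integral>\<^sup>+x. (\<integral>\<^sup>+t. G (Complex x (x * tan t)) * ennreal (x * inverse ((cos t)\<^sup>2)) * indicator {0..} x * indicator {-(pi/4)..pi/4} t \<partial>lborel) \<partial>lborel)"
    by (rule lborel_pair.Fubini') measurable
  also have "\<dots> \<le> (\<integral>\<^sup>+x. (\<integral>\<^sup>+y. G (Complex x y) \<partial>lborel) \<partial>lborel)"
  proof (rule nn_integral_mono)
    fix x :: real
    show "(\<integral>\<^sup>+t. G (Complex x (x * tan t)) * ennreal (x * inverse ((cos t)\<^sup>2)) * indicator {0..} x * indicator {-(pi/4)..pi/4} t \<partial>lborel)
       \<le> (\<integral>\<^sup>+y. G (Complex x y) \<partial>lborel)"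
    proof (cases "x \<ge> 0")
      case True
      have "(\<integral>\<^sup>+t. G (Complex x (x * tan t)) * ennreal (x * inverse ((cos t)\<^sup>2)) * indicator {-(pi/4)..pi/4} t \<partial>lborel)
        = (\<integral>\<^sup>+y. G (Complex x y) * indicator {x * tan (-(pi/4))..x * tan (pi/4)} y \<partial>lborel)"
      proof (rule nn_integral_substitution_aux[symmetric])
        fix t assume t: "t \<in> {-(pi/4)..pi/4}"
        then have c: "cos t > 0" by (intro abs_less_imp_cos_pos) auto
        show "((\<lambda>t. x * tan t) has_real_derivative x * inverse ((cos t)\<^sup>2)) (at t)"
          using c by (auto intro!: derivative_eq_intros)
        show "x * inverse ((cos t)\<^sup>2) \<ge> 0" using True by simp
      next
        have "cos t \<noteq> 0" if "t \<in> {-(pi/4)..pi/4}" for t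
        proof -
          have "\<bar>t\<bar> \<le> pi / 4" using that by (intro abs_leI) auto
          from abs_less_imp_cos_pos[OF this] show ?thesis by simp
        qed
        then show "continuous_on {-(pi/4)..pi/4} (\<lambda>t. x * inverse ((cos t)\<^sup>2))"
          by (intro continuous_intros) auto
      qed auto
      also have "\<dots> \<le> (\<integral>\<^sup>+y. G (Complex x y) \<partial>lborel)"
        by (intro nn_integral_mono) (auto simp: indicator_def)
      finally show ?thesis using True by simp
    qed simp
  qed
  also have "\<dots> = (\<integral>\<^sup>+z. G z \<partial>lborel)" by (rule nn_integral_complex[symmetric]) measurable
  finally show ?thesis .
qed

lemma rcis_add_half_pi: "rcis r (t + pi / 2) = \<i> * rcis r t"
  by (simp add: complex_eq_iff sin_add cos_add)

text \<open>
Multiplication by \<open>\<i>\<close> preserves area and moves one sector to the next. Five closed sectors,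
centred at multiples of \<open>pi / 2\<close>, cover \<open>{0..2*pi}\<close>.
\<close>

lemma polar_le:
  fixes G :: "complex \<Rightarrow> ennreal"
  assumes G[measurable]: "G \<in> borel_measurable borel" and ab: "0 < a" "a < b"
  shows "(\<integral>\<^sup>+t. (\<integral>\<^sup>+r. G (rcis r t) * ennreal r * indicator {a..b} r \<partial>lborel) * indicator {0..2*pi} t \<partial>lborel)
     \<le> 5 * (\<integral>\<^sup>+z. G z \<partial>lborel)"
proof -
  define h where "h t = (\<integral>\<^sup>+r. G (rcis r t) * ennreal r * indicator {a..b} r \<partial>lborel)" for t
  have [measurable]: "(\<lambda>x. rcis (f x) (g x)) \<in> borel_measurable M"
    if "f \<in> borel_measurable M" "g \<in> borel_measurable M" for f g :: "'b \<Rightarrow> real" and M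
    using that unfolding borel_measurable_complex_iff by (simp add: rcis_def)
  have hm[measurable]: "h \<in> borel_measurable borel"
    unfolding h_def by measurable
  have sector: "(\<integral>\<^sup>+t. h t * indicator {real k * (pi/2) - pi/4..real k * (pi/2) + pi/4} t \<partial>lborel) \<le> (\<integral>\<^sup>+z. G z \<partial>lborel)" for k
  proof -
    define Gk where "Gk = (\<lambda>z. G (\<i> ^ k * z))"
    have Gk[measurable]: "Gk \<in> borel_measurable borel"
      unfolding Gk_def by (rule measurable_compose[OF _ G]) (auto intro!: borel_measurable_continuous_onI continuous_intros)
    have Gki: "(\<integral>\<^sup>+z. G (\<i> ^ k * z) \<partial>lborel) = (\<integral>\<^sup>+z. G z \<partial>lborel)"
    proof (induction k)
      case (Suc k)
      have [measurable]: "(\<lambda>z. G (\<i> ^ k * z)) \<in> borel_measurable borel"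
        by (rule measurable_compose[OF _ G]) (auto intro!: borel_measurable_continuous_onI continuous_intros)
      show ?case using nn_integral_times_i[of "\<lambda>z. G (\<i> ^ k * z)"] Suc by (simp add: mult.assoc mult.left_commute)
    qed simp
    have rot: "rcis r (real k * (pi/2) + t) = \<i> ^ k * rcis r t" for r t
    proof (induction k)
      case (Suc k)
      have "real (Suc k) * (pi/2) + t = (real k * (pi/2) + t) + pi/2" by (simp add: field_simps)
      then show ?case using Suc by (simp only: rcis_add_half_pi power_Suc mult.assoc)
    qed simp
    have "(\<integral>\<^sup>+t. h t * indicator {real k * (pi/2) - pi/4..real k * (pi/2) + pi/4} t \<partial>lborel)
      = (\<integral>\<^sup>+t. h (real k * (pi/2) + 1 * t) * indicator {real k * (pi/2) - pi/4..real k * (pi/2) + pi/4} (real k * (pi/2) + 1 * t) \<partial>lborel)"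
      by (subst nn_integral_real_affine[where c = 1 and t = "real k * (pi/2)"]) auto
    also have "\<dots> = (\<integral>\<^sup>+t. (\<integral>\<^sup>+r. Gk (rcis r t) * ennreal r * indicator {a..b} r \<partial>lborel) * indicator {-(pi/4)..pi/4} t \<partial>lborel)"
      unfolding h_def mult_1 rot Gk_def by (intro nn_integral_cong) (auto simp: indicator_def)
    also have "\<dots> \<le> (\<integral>\<^sup>+z. Gk z \<partial>lborel)" by (rule polar_sector_le[OF Gk ab])
    also have "\<dots> = (\<integral>\<^sup>+z. G z \<partial>lborel)" unfolding Gk_def by (rule Gki)
    finally show ?thesis .
  qed
  have "(\<integral>\<^sup>+t. h t * indicator {0..2*pi} t \<partial>lborel)
    \<le> (\<integral>\<^sup>+t. (\<Sum>k<5. h t * indicator {real k * (pi/2) - pi/4..real k * (pi/2) + pi/4} t) \<partial>lborel)"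
  proof (rule nn_integral_mono)
    fix t :: real
    show "h t * indicator {0..2*pi} t \<le> (\<Sum>k<5. h t * indicator {real k * (pi/2) - pi/4..real k * (pi/2) + pi/4} t)"
    proof (cases "t \<in> {0..2*pi}")
      case True
      have "\<exists>k<5. t \<in> {real k * (pi/2) - pi/4..real k * (pi/2) + pi/4}"
      proof -
        have "t \<in> {real 0 * (pi/2) - pi/4..real 0 * (pi/2) + pi/4} \<or> t \<in> {real 1 * (pi/2) - pi/4..real 1 * (pi/2) + pi/4}
          \<or> t \<in> {real 2 * (pi/2) - pi/4..real 2 * (pi/2) + pi/4} \<or> t \<in> {real 3 * (pi/2) - pi/4..real 3 * (pi/2) + pi/4}
          \<or> t \<in> {real 4 * (pi/2) - pi/4..real 4 * (pi/2) + pi/4}"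
          using True by (simp add: field_simps) linarith
        moreover have "(0::nat) < 5" "(1::nat) < 5" "(2::nat) < 5" "(3::nat) < 5" "(4::nat) < 5" by simp_all
        ultimately show ?thesis by metis
      qed
      then obtain k where k: "k < 5" "t \<in> {real k * (pi/2) - pi/4..real k * (pi/2) + pi/4}" by blast
      have "h t = h t * indicator {real k * (pi/2) - pi/4..real k * (pi/2) + pi/4} t" using k(2) by simp
      also have "\<dots> \<le> (\<Sum>k<5. h t * indicator {real k * (pi/2) - pi/4..real k * (pi/2) + pi/4} t)"
        using k(1) by (intro member_le_sum) auto
      finally show ?thesis using True by simp
    qed simp
  qed
  also have "\<dots> = (\<Sum>k<5. \<integral>\<^sup>+t. h t * indicator {real k * (pi/2) - pi/4..real k * (pi/2) + pi/4} t \<partial>lborel)"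
    by (rule nn_integral_sum) measurable
  also have "\<dots> \<le> (\<Sum>k<(5::nat). \<integral>\<^sup>+z. G z \<partial>lborel)" by (intro sum_mono sector)
  also have "\<dots> = 5 * (\<integral>\<^sup>+z. G z \<partial>lborel)" by simp
  finally show ?thesis unfolding h_def .
qed

lemma exp_box_le:
  fixes G :: "complex \<Rightarrow> ennreal"
  assumes G[measurable]: "G \<in> borel_measurable borel" and ab: "s0 < s1"
  shows "(\<integral>\<^sup>+t. (\<integral>\<^sup>+s. G (exp (Complex s t)) * ennreal (exp (2 * s)) * indicator {s0..s1} s \<partial>lborel) * indicator {0..2*pi} t \<partial>lborel)
     \<le> 5 * (\<integral>\<^sup>+z. G z \<partial>lborel)"
proof -
  have [measurable]: "(\<lambda>x. rcis (f x) (g x)) \<in> borel_measurable M"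
    if "f \<in> borel_measurable M" "g \<in> borel_measurable M" for f g :: "'b \<Rightarrow> real" and M
    using that unfolding borel_measurable_complex_iff by (simp add: rcis_def)
  have "(\<integral>\<^sup>+s. G (exp (Complex s t)) * ennreal (exp (2 * s)) * indicator {s0..s1} s \<partial>lborel)
    = (\<integral>\<^sup>+r. G (rcis r t) * ennreal r * indicator {exp s0..exp s1} r \<partial>lborel)" for t
  proof -
    have "(\<integral>\<^sup>+r. (G (rcis r t) * ennreal r) * indicator {exp s0..exp s1} r \<partial>lborel)
      = (\<integral>\<^sup>+s. (G (rcis (exp s) t) * ennreal (exp s)) * ennreal (exp s) * indicator {s0..s1} s \<partial>lborel)"
      using ab by (intro nn_integral_substitution_aux) (auto intro!: derivative_eq_intros continuous_intros)
    also have "\<dots> = (\<integral>\<^sup>+s. G (exp (Complex s t)) * ennreal (exp (2 * s)) * indicator {s0..s1} s \<partial>lborel)"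
    proof (intro nn_integral_cong)
      fix s :: real
      have "rcis (exp s) t = exp (Complex s t)"
        by (simp only: exp_eq_polar rcis_def complex.sel)
      moreover have "ennreal (exp s) * ennreal (exp s) = ennreal (exp (2 * s))"
        by (simp add: ennreal_mult[symmetric] exp_add[symmetric])
      ultimately show "(G (rcis (exp s) t) * ennreal (exp s)) * ennreal (exp s) * indicator {s0..s1} s
         = G (exp (Complex s t)) * ennreal (exp (2 * s)) * indicator {s0..s1} s"
        by (simp add: mult.assoc)
    qed
    finally show ?thesis by simp
  qed
  then show ?thesis using polar_le[OF G, of "exp s0" "exp s1"] ab by simp
qed

section \<open>Smooth approximation of quasiconformal maps\<close>

text \<open>
A twice continuously differentiable map with its partial derivatives: \<open>p\<close>, \<open>q\<close> of first order in the
directions \<open>1\<close> and \<open>\<i>\<close>, and \<open>r\<close>, \<open>t\<close>, \<open>u\<close> of second order, the mixed one occurring once.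
\<close>

definition C2_map where
  "C2_map F p q r t u \<longleftrightarrow>
     (\<forall>z. (F has_derivative (\<lambda>v. Re v *\<^sub>R p z + Im v *\<^sub>R q z)) (at z)) \<and>
     (\<forall>z. (p has_derivative (\<lambda>v. Re v *\<^sub>R r z + Im v *\<^sub>R t z)) (at z)) \<and>
     (\<forall>z. (q has_derivative (\<lambda>v. Re v *\<^sub>R t z + Im v *\<^sub>R u z)) (at z)) \<and>
     continuous_on UNIV r \<and> continuous_on UNIV t \<and> continuous_on UNIV u"
  for F p q r t u :: "complex \<Rightarrow> complex"

text \<open>
One kernel serves all weak derivatives of \<open>f\<close> at once; that different versions of a weak derivative have the
same convolution is what proves their uniqueness below.
\<close>

lemma mollify_weak_partials:
  fixes f :: "complex \<Rightarrow> complex"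
  assumes d: "d > 0" and f: "continuous_on UNIV f"
  shows "\<exists>\<rho> p q r t u. mollifier d \<rho> \<and> C2_map (conv \<rho> f) p q r t u \<and>
    (\<forall>g g'. weak_partial UNIV 1 f g \<longrightarrow> g' \<in> borel_measurable borel \<longrightarrow> (AE z in lborel. g z = g' z) \<longrightarrow> conv \<rho> g' = p) \<and>
    (\<forall>g g'. weak_partial UNIV \<i> f g \<longrightarrow> g' \<in> borel_measurable borel \<longrightarrow> (AE z in lborel. g z = g' z) \<longrightarrow> conv \<rho> g' = q)"
proof -
  obtain \<rho> \<rho>x \<rho>y \<rho>xx \<rho>xy \<rho>yy where k: "\<And>k. Ck k \<rho>" "\<And>z. 0 \<le> \<rho> z" "(\<integral>z. \<rho> z \<partial>lborel) = 1"
    "C1_kernel d \<rho> \<rho>x \<rho>y" "C1_kernel d \<rho>x \<rho>xx \<rho>xy" "C1_kernel d \<rho>y \<rho>xy \<rho>yy"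
    using mollifier_exists[OF d] by metis
  have c: "continuous_on UNIV \<rho>" "continuous_on UNIV \<rho>x" "continuous_on UNIV \<rho>y" "continuous_on UNIV \<rho>xx"
      "continuous_on UNIV \<rho>xy" "continuous_on UNIV \<rho>yy"
    and z: "\<And>z. norm z > d \<Longrightarrow> \<rho> z = 0" "\<And>z. norm z > d \<Longrightarrow> \<rho>xx z = 0" "\<And>z. norm z > d \<Longrightarrow> \<rho>xy z = 0" "\<And>z. norm z > d \<Longrightarrow> \<rho>yy z = 0"
    and der: "\<And>z. (\<rho> has_derivative (\<lambda>v. Re v * \<rho>x z + Im v * \<rho>y z)) (at z)"
    using k(4-6) unfolding C1_kernel_def by blast+
  have M: "mollifier d \<rho>" unfolding mollifier_def using k c z by blast
  have C: "C2_map (conv \<rho> f) (conv \<rho>x f) (conv \<rho>y f) (conv \<rho>xx f) (conv \<rho>xy f) (conv \<rho>yy f)"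
    unfolding C2_map_def
    using conv_has_derivative[OF k(4) f] conv_has_derivative[OF k(5) f] conv_has_derivative[OF k(6) f]
      continuous_on_conv[OF c(4) z(2) f] continuous_on_conv[OF c(5) z(3) f] continuous_on_conv[OF c(6) z(4) f]
    by blast
  have 1: "conv \<rho> g' = conv \<rho>x f"
    if "weak_partial UNIV 1 f g" "g' \<in> borel_measurable borel" "AE z in lborel. g z = g' z" for g g'
    using weak_partial_conv[OF that(1) f k(1) z(1) der _ that(2,3)] c by (simp add: fun_eq_iff)
  have 2: "conv \<rho> g' = conv \<rho>y f"
    if "weak_partial UNIV \<i> f g" "g' \<in> borel_measurable borel" "AE z in lborel. g z = g' z" for g g'
    using weak_partial_conv[OF that(1) f k(1) z(1) der _ that(2,3)] c by (simp add: fun_eq_iff)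
  show ?thesis using M C 1 2 by blast
qed

lemma C2_map_continuous:
  assumes "C2_map F p q r t u"
  shows "continuous_on UNIV F" "continuous_on UNIV p" "continuous_on UNIV q"
  using assms unfolding C2_map_def
  by (meson continuous_at_imp_continuous_on has_derivative_continuous)+

lemma Lp_loc_1_nn_integral:
  fixes f g a :: "complex \<Rightarrow> complex"
  assumes "weak_partial UNIV v f g" "a \<in> borel_measurable borel" "AE z in lborel. g z = a z"
  shows "(\<integral>\<^sup>+x. ennreal (norm (a x) ^ 1) * indicator (cball 0 R) x \<partial>lborel) < \<infinity>"
  using Lp_loc_nn_integral[of 1 g a] assms unfolding weak_partial_def by blast

text \<open>
The Sobolev class and the distortion inequality each come with their own weak derivatives. Both have the same
mollifications, and these converge to either of them in \<open>L1\<close>.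
\<close>

lemma weak_partial_unique:
  fixes f :: "complex \<Rightarrow> complex"
  assumes f: "continuous_on UNIV f" and v: "v = 1 \<or> v = \<i>"
    and w: "weak_partial UNIV v f g1" "weak_partial UNIV v f g2"
    and a1: "a1 \<in> borel_measurable borel" "AE z in lborel. g1 z = a1 z"
    and a2: "a2 \<in> borel_measurable borel" "AE z in lborel. g2 z = a2 z"
  shows "AE z in lborel. z \<in> cball 0 R \<longrightarrow> a1 z = a2 z"
proof -
  note [measurable] = a1(1) a2(1)
  have B: "cball (0::complex) R \<in> sets borel" by simp
  note [measurable] = B
  define I where "I = (\<integral>\<^sup>+z. ennreal (norm (a1 z - a2 z) ^ 1) * indicator (cball 0 R) z \<partial>lborel)"
  have "I \<le> 0 + ennreal e" if e: "e > 0" for e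
  proof -
    have e6: "e / 6 > 0" using e by simp
    note fin = Lp_loc_1_nn_integral[OF w(1) a1] Lp_loc_1_nn_integral[OF w(2) a2]
    obtain d1 where d1: "d1 > 0" "\<And>\<rho>. mollifier d1 \<rho> \<Longrightarrow> continuous_on UNIV (conv \<rho> a1) \<Longrightarrow>
      (\<integral>\<^sup>+z. ennreal (norm (conv \<rho> a1 z - a1 z) ^ 1) * indicator (cball 0 R) z \<partial>lborel) \<le> ennreal (e / 6)"
      using conv_Lp[OF a1(1) _ fin(1) e6, of R] by blast
    obtain d2 where d2: "d2 > 0" "\<And>\<rho>. mollifier d2 \<rho> \<Longrightarrow> continuous_on UNIV (conv \<rho> a2) \<Longrightarrow>
      (\<integral>\<^sup>+z. ennreal (norm (conv \<rho> a2 z - a2 z) ^ 1) * indicator (cball 0 R) z \<partial>lborel) \<le> ennreal (e / 6)"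
      using conv_Lp[OF a2(1) _ fin(2) e6, of R] by blast
    have "min d1 d2 > 0" using d1 d2 by simp
    from mollify_weak_partials[OF this f] obtain \<rho> p q r t u where \<rho>: "mollifier (min d1 d2) \<rho>" "C2_map (conv \<rho> f) p q r t u"
      and p: "\<And>g g'. weak_partial UNIV 1 f g \<Longrightarrow> g' \<in> borel_measurable borel \<Longrightarrow> AE z in lborel. g z = g' z \<Longrightarrow> conv \<rho> g' = p"
      and q: "\<And>g g'. weak_partial UNIV \<i> f g \<Longrightarrow> g' \<in> borel_measurable borel \<Longrightarrow> AE z in lborel. g z = g' z \<Longrightarrow> conv \<rho> g' = q"
      by blast
    define h where "h = (if v = 1 then p else q)"
    have hc: "continuous_on UNIV h" using C2_map_continuous[OF \<rho>(2)] by (simp add: h_def)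
    have h: "conv \<rho> a1 = h" "conv \<rho> a2 = h"
      using v w p[OF _ a1] p[OF _ a2] q[OF _ a1] q[OF _ a2] by (auto simp: h_def)
    have [measurable]: "h \<in> borel_measurable borel" using hc by (rule borel_measurable_continuous_onI)
    have I1: "(\<integral>\<^sup>+z. ennreal (norm (a1 z - h z) ^ 1) * indicator (cball 0 R) z \<partial>lborel) \<le> ennreal (e / 6)"
      using d1(2)[OF mollifier_mono[OF \<rho>(1)]] hc by (simp add: h norm_minus_commute)
    have I2: "(\<integral>\<^sup>+z. ennreal (norm (h z - a2 z) ^ 1) * indicator (cball 0 R) z \<partial>lborel) \<le> ennreal (e / 6)"
      using d2(2)[OF mollifier_mono[OF \<rho>(1)]] hc by (simp add: h)
    have m1: "(\<lambda>z. a1 z - h z) \<in> borel_measurable borel" by measurable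
    have m2: "(\<lambda>z. h z - a2 z) \<in> borel_measurable borel" by measurable
    have m3: "(\<lambda>z::complex. 0::complex) \<in> borel_measurable borel" by measurable
    have "I \<le> 3 ^ 1 * ((\<integral>\<^sup>+z. ennreal (norm (a1 z - h z) ^ 1) * indicator (cball 0 R) z \<partial>lborel) +
       (\<integral>\<^sup>+z. ennreal (norm (h z - a2 z) ^ 1) * indicator (cball 0 R) z \<partial>lborel) +
       (\<integral>\<^sup>+z. ennreal (norm (0::complex) ^ 1) * indicator (cball (0::complex) R) z \<partial>lborel))"
      unfolding I_def by (rule nn_integral_add3_power[OF m1 m2 m3 B]) simp
    also have "\<dots> \<le> 3 ^ 1 * (ennreal (e / 6) + ennreal (e / 6) + 0)"
      using I1 I2 by (intro mult_left_mono add_mono) auto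
    also have "\<dots> = ennreal 3 * ennreal (e / 6 + e / 6)"
      using e ennreal_plus[of "e / 6" "e / 6"] by simp
    also have "\<dots> = ennreal (3 * (e / 6 + e / 6))" using e by (intro ennreal_mult[symmetric]) auto
    also have "3 * (e / 6 + e / 6) = e" by simp
    finally show ?thesis by simp
  qed
  then have "I \<le> 0" by (rule ennreal_le_epsilon)
  then have "AE z in lborel. ennreal (norm (a1 z - a2 z) ^ 1) * indicator (cball 0 R) z = 0"
    unfolding I_def by (subst nn_integral_0_iff_AE[symmetric]) auto
  then show ?thesis by eventually_elim (auto simp: indicator_def split: if_splits)
qed

text \<open>
Mollification converges to \<open>f\<close> uniformly and to the differential of \<open>f\<close> in \<open>L2\<close>. By \<open>defect_bound\<close> the defect
of the mollified map is bounded by \<open>\<tau>\<close> times a fixed integrable function plus a multiple, depending on \<open>\<tau>\<close>, of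
the squared error; so \<open>\<tau>\<close> is chosen first and the kernel afterwards.
\<close>

lemma quasiconformal_smooth_approximation:
  assumes qc: "quasiconformal_map K UNIV UNIV f" and \<epsilon>: "\<epsilon> > 0"
  shows "\<exists>F p q r t u. C2_map F p q r t u \<and> (\<forall>z\<in>cball 0 R. norm (F z - f z) \<le> \<epsilon>) \<and>
    (\<integral>\<^sup>+z. ennreal (defect K (p z) (q z)) * indicator (cball 0 R) z \<partial>lborel) \<le> ennreal \<epsilon>"
proof -
  have K: "K \<ge> 1" and f: "continuous_on UNIV f"
    using qc unfolding quasiconformal_map_def homeomorphism_def by blast+
  obtain g1 h1 where w1: "weak_partial UNIV 1 f g1" "weak_partial UNIV \<i> f h1" "Lp_loc 2 UNIV g1" "Lp_loc 2 UNIV h1"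
    using qc unfolding quasiconformal_map_def W12_loc_def by blast
  obtain g2 h2 where w2: "weak_partial UNIV 1 f g2" "weak_partial UNIV \<i> f h2"
    and dist: "AE z in lebesgue_on UNIV. (onorm (\<lambda>h. diff_matrix (g2 z) (h2 z) *v h))\<^sup>2 \<le> K * det (diff_matrix (g2 z) (h2 z))"
    using qc unfolding quasiconformal_map_def distortion_inequality_def by blast
  have m: "g1 \<in> borel_measurable lebesgue" "h1 \<in> borel_measurable lebesgue" "g2 \<in> borel_measurable lebesgue" "h2 \<in> borel_measurable lebesgue"
    using w1 w2 by (simp_all add: weak_partial_def Lp_loc_def lebesgue_on_UNIV_eq)
  obtain a1 where a1: "a1 \<in> borel_measurable borel" "AE z in lborel. g1 z = a1 z" using lebesgue_borel_rep[OF m(1)] .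
  obtain b1 where b1: "b1 \<in> borel_measurable borel" "AE z in lborel. h1 z = b1 z" using lebesgue_borel_rep[OF m(2)] .
  obtain a2 where a2: "a2 \<in> borel_measurable borel" "AE z in lborel. g2 z = a2 z" using lebesgue_borel_rep[OF m(3)] .
  obtain b2 where b2: "b2 \<in> borel_measurable borel" "AE z in lborel. h2 z = b2 z" using lebesgue_borel_rep[OF m(4)] .
  note [measurable] = a1(1) b1(1)
  have B: "cball (0::complex) R \<in> sets borel" by simp
  note [measurable] = B
  have "AE z in lborel. (onorm (\<lambda>h. diff_matrix (g2 z) (h2 z) *v h))\<^sup>2 \<le> K * det (diff_matrix (g2 z) (h2 z))"
    using dist unfolding lebesgue_on_UNIV_eq AE_completion_iff .
  moreover have "AE z in lborel. z \<in> cball 0 R \<longrightarrow> a1 z = a2 z"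
    by (rule weak_partial_unique[OF f _ w1(1) w2(1) a1 a2]) simp
  moreover have "AE z in lborel. z \<in> cball 0 R \<longrightarrow> b1 z = b2 z"
    by (rule weak_partial_unique[OF f _ w1(2) w2(2) b1 b2]) simp
  ultimately have D: "AE z in lborel. z \<in> cball 0 R \<longrightarrow>
      (norm (dz (a1 z) (b1 z)) + norm (dzb (a1 z) (b1 z)))\<^sup>2 \<le> K * ((norm (dz (a1 z) (b1 z)))\<^sup>2 - (norm (dzb (a1 z) (b1 z)))\<^sup>2)"
    using a2(2) b2(2) by eventually_elim (auto simp: onorm_diff_matrix det_diff_matrix)
  note fin = Lp_loc_nn_integral[OF w1(3) a1] Lp_loc_nn_integral[OF w1(4) b1]
  define M where "M = enn2real (\<integral>\<^sup>+x. ennreal (norm (a1 x) ^ 2) * indicator (cball 0 R) x \<partial>lborel)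
      + enn2real (\<integral>\<^sup>+x. ennreal (norm (b1 x) ^ 2) * indicator (cball 0 R) x \<partial>lborel)"
  have M0: "M \<ge> 0" by (simp add: M_def)
  have M: "(\<integral>\<^sup>+x. ennreal (norm (a1 x) ^ 2) * indicator (cball 0 R) x \<partial>lborel)
      + (\<integral>\<^sup>+x. ennreal (norm (b1 x) ^ 2) * indicator (cball 0 R) x \<partial>lborel) = ennreal M"
    unfolding M_def using fin[of R] by (simp add: ennreal_plus)
  (* Chosen such that the fixed part of the bound is at most half of \<epsilon>. *)
  define \<tau> where "\<tau> = \<epsilon> / (4 * (K + 1) * (M + 1))"
  have \<tau>: "\<tau> > 0" using \<epsilon> K M0 by (simp add: \<tau>_def)
  define C1 C2 where "C1 = (K + 1) * (2 * \<tau>)" "C2 = (K + 1) * (2 * (1 + 1 / \<tau>))"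
  have C: "C1 > 0" "C2 > 0" using K \<tau> by (auto simp: C1_C2_def intro!: mult_pos_pos add_pos_pos)
  have C1M: "C1 * M \<le> \<epsilon> / 2"
  proof -
    have "C1 * M \<le> C1 * (M + 1)" using C by simp
    also have "\<dots> = (4 * (K + 1) * (M + 1)) * \<tau> / 2" by (simp add: C1_C2_def algebra_simps)
    also have "(4 * (K + 1) * (M + 1)) * \<tau> = \<epsilon>"
    proof -
      have "4 * (K + 1) * (M + 1) \<noteq> 0" using K M0 by auto
      then show ?thesis unfolding \<tau>_def by (simp only: times_divide_eq_right nonzero_mult_div_cancel_left not_False_eq_True)
    qed
    finally show ?thesis .
  qed
  define e where "e = \<epsilon> / (4 * C2)"
  have e: "e > 0" using \<epsilon> C by (simp add: e_def)
  obtain d1 where d1: "d1 > 0" "\<And>\<rho>. mollifier d1 \<rho> \<Longrightarrow> continuous_on UNIV (conv \<rho> a1) \<Longrightarrow>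
      (\<integral>\<^sup>+z. ennreal (norm (conv \<rho> a1 z - a1 z) ^ 2) * indicator (cball 0 R) z \<partial>lborel) \<le> ennreal e"
    using conv_Lp[OF a1(1) _ fin(1) e, of R] by blast
  obtain d2 where d2: "d2 > 0" "\<And>\<rho>. mollifier d2 \<rho> \<Longrightarrow> continuous_on UNIV (conv \<rho> b1) \<Longrightarrow>
      (\<integral>\<^sup>+z. ennreal (norm (conv \<rho> b1 z - b1 z) ^ 2) * indicator (cball 0 R) z \<partial>lborel) \<le> ennreal e"
    using conv_Lp[OF b1(1) _ fin(2) e, of R] by blast
  obtain d3 where d3: "d3 > 0" "\<And>\<rho> z. mollifier d3 \<rho> \<Longrightarrow> z \<in> cball 0 R \<Longrightarrow> norm (conv \<rho> f z - f z) \<le> \<epsilon>"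
    using conv_uniform[OF f \<epsilon>, of R] by blast
  define d where "d = min d1 (min d2 d3)"
  have d: "d > 0" "d \<le> d1" "d \<le> d2" "d \<le> d3" using d1 d2 d3 by (auto simp: d_def)
  from mollify_weak_partials[OF d(1) f] obtain \<rho> p q r t u where \<rho>: "mollifier d \<rho>" "C2_map (conv \<rho> f) p q r t u"
    and p: "\<And>g g'. weak_partial UNIV 1 f g \<Longrightarrow> g' \<in> borel_measurable borel \<Longrightarrow> AE z in lborel. g z = g' z \<Longrightarrow> conv \<rho> g' = p"
    and q: "\<And>g g'. weak_partial UNIV \<i> f g \<Longrightarrow> g' \<in> borel_measurable borel \<Longrightarrow> AE z in lborel. g z = g' z \<Longrightarrow> conv \<rho> g' = q"
    by blast
  have pq: "conv \<rho> a1 = p" "conv \<rho> b1 = q"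
    using p[OF w1(1) a1] q[OF w1(2) b1] by auto
  note pqc = C2_map_continuous(2,3)[OF \<rho>(2)]
  have [measurable]: "p \<in> borel_measurable borel" "q \<in> borel_measurable borel"
    using pqc by (auto intro: borel_measurable_continuous_onI)
  have Ip: "(\<integral>\<^sup>+z. ennreal (norm (p z - a1 z) ^ 2) * indicator (cball 0 R) z \<partial>lborel) \<le> ennreal e"
    using d1(2)[OF mollifier_mono[OF \<rho>(1) d(2)]] pqc by (simp add: pq)
  have Iq: "(\<integral>\<^sup>+z. ennreal (norm (q z - b1 z) ^ 2) * indicator (cball 0 R) z \<partial>lborel) \<le> ennreal e"
    using d2(2)[OF mollifier_mono[OF \<rho>(1) d(3)]] pqc by (simp add: pq)
  let ?A = "\<lambda>z. ennreal (norm (a1 z) ^ 2) * indicator (cball 0 R) z"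
  let ?B = "\<lambda>z. ennreal (norm (b1 z) ^ 2) * indicator (cball 0 R) z"
  let ?P = "\<lambda>z. ennreal (norm (p z - a1 z) ^ 2) * indicator (cball 0 R) z"
  let ?Q = "\<lambda>z. ennreal (norm (q z - b1 z) ^ 2) * indicator (cball 0 R) z"
  have "(\<integral>\<^sup>+z. ennreal (defect K (p z) (q z)) * indicator (cball 0 R) z \<partial>lborel)
     \<le> (\<integral>\<^sup>+z. ennreal C1 * (?A z + ?B z) + ennreal C2 * (?P z + ?Q z) \<partial>lborel)"
  proof (rule nn_integral_mono_AE)
    show "AE z in lborel. ennreal (defect K (p z) (q z)) * indicator (cball 0 R) z
       \<le> ennreal C1 * (?A z + ?B z) + ennreal C2 * (?P z + ?Q z)"
      using D
    proof eventually_elim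
      fix z
      assume D: "z \<in> cball 0 R \<longrightarrow>
      (norm (dz (a1 z) (b1 z)) + norm (dzb (a1 z) (b1 z)))\<^sup>2 \<le> K * ((norm (dz (a1 z) (b1 z)))\<^sup>2 - (norm (dzb (a1 z) (b1 z)))\<^sup>2)"
      show "ennreal (defect K (p z) (q z)) * indicator (cball 0 R) z \<le> ennreal C1 * (?A z + ?B z) + ennreal C2 * (?P z + ?Q z)"
      proof (cases "z \<in> cball 0 R")
        case True
        have E: "ennreal (C1 * (x + y) + C2 * (x' + y')) = ennreal C1 * (ennreal x + ennreal y) + ennreal C2 * (ennreal x' + ennreal y')"
          if "0 \<le> x" "0 \<le> y" "0 \<le> x'" "0 \<le> y'" for x y x' y'
          using that C by (simp add: ennreal_plus ennreal_mult)
        from True D have "defect K (p z) (q z) \<le> C1 * ((norm (a1 z))\<^sup>2 + (norm (b1 z))\<^sup>2)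
          + C2 * ((norm (p z - a1 z))\<^sup>2 + (norm (q z - b1 z))\<^sup>2)"
          unfolding C1_C2_def by (intro defect_bound[OF K \<tau>]) blast
        from ennreal_leI[OF this] show ?thesis using True by (simp only: E zero_le_power2 indicator_simps mult_1_right)
      qed simp
    qed
  qed
  also have "\<dots> = ennreal C1 * ((\<integral>\<^sup>+z. ?A z \<partial>lborel) + (\<integral>\<^sup>+z. ?B z \<partial>lborel)) + ennreal C2 * ((\<integral>\<^sup>+z. ?P z \<partial>lborel) + (\<integral>\<^sup>+z. ?Q z \<partial>lborel))"
    by (simp add: nn_integral_cmult nn_integral_add)
  also have "\<dots> \<le> ennreal C1 * ennreal M + ennreal C2 * (ennreal e + ennreal e)"
    using M Ip Iq by (intro add_mono mult_left_mono) auto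
  also have "\<dots> = ennreal (C1 * M + C2 * (e + e))"
  proof -
    have "ennreal (C1 * M + C2 * (e + e)) = ennreal (C1 * M) + ennreal (C2 * (e + e))"
      using C M0 e by (intro ennreal_plus) auto
    moreover have "ennreal (C1 * M) = ennreal C1 * ennreal M" using C M0 by (intro ennreal_mult) auto
    moreover have "ennreal (C2 * (e + e)) = ennreal C2 * ennreal (e + e)" using C e by (intro ennreal_mult) auto
    moreover have "ennreal (e + e) = ennreal e + ennreal e" using e by (intro ennreal_plus) auto
    ultimately show ?thesis by (simp only:)
  qed
  also have "\<dots> \<le> ennreal \<epsilon>"
    using C1M C by (intro ennreal_leI) (simp add: e_def)
  finally show ?thesis
    using \<rho>(2) d3(2)[OF mollifier_mono[OF \<rho>(1) d(4)]] by blast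
qed

section \<open>Logarithmic coordinates\<close>

abbreviation Box :: "real \<Rightarrow> real \<Rightarrow> (real \<times> real) set" where
  "Box s0 s1 \<equiv> cbox (s0, 0) (s1, 2 * pi)"

lemma continuous_on_section:
  assumes "continuous_on (Box s0 s1) g"
  shows "\<theta> \<in> {0..2*pi} \<Longrightarrow> continuous_on {s0..s1} (\<lambda>s. g (s, \<theta>))"
    "s \<in> {s0..s1} \<Longrightarrow> continuous_on {0..2*pi} (\<lambda>\<theta>. g (s, \<theta>))"
  by (auto intro!: continuous_on_compose2[OF assms] continuous_intros simp: cbox_Pair_eq)

text \<open>
The form \<open>H (Re V) d(Im V)\<close> has differential \<open>h (Re V) d(Re V) d(Im V)\<close>, and the
coefficient of the latter is \<open>h (Re V)\<close> times the Jacobian \<open>Im (cnj P * Q)\<close>. The two horizontal sides of the rectangle cancel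
by periodicity. The proof avoids Stokes' theorem: the integral over one vertical line is
differentiated in \<open>s\<close>, and the term with the second derivative \<open>D\<close> is removed by an integration
by parts in \<open>\<theta>\<close>.
\<close>

lemma periodic_stokes:
  fixes V P Q D :: "real \<times> real \<Rightarrow> complex" and H h :: "real \<Rightarrow> real"
  assumes s: "s0 \<le> s1"
    and cont: "continuous_on (Box s0 s1) V" "continuous_on (Box s0 s1) P" "continuous_on (Box s0 s1) Q" "continuous_on (Box s0 s1) D"
    and Vs: "\<And>s \<theta>. s \<in> {s0..s1} \<Longrightarrow> \<theta> \<in> {0..2*pi} \<Longrightarrow> ((\<lambda>s. V (s, \<theta>)) has_vector_derivative P (s, \<theta>)) (at s within {s0..s1})"
    and Vt: "\<And>s \<theta>. s \<in> {s0..s1} \<Longrightarrow> \<theta> \<in> {0..2*pi} \<Longrightarrow> ((\<lambda>\<theta>. V (s, \<theta>)) has_vector_derivative Q (s, \<theta>)) (at \<theta> within {0..2*pi})"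
    and Pt: "\<And>s \<theta>. s \<in> {s0..s1} \<Longrightarrow> \<theta> \<in> {0..2*pi} \<Longrightarrow> ((\<lambda>\<theta>. P (s, \<theta>)) has_vector_derivative D (s, \<theta>)) (at \<theta> within {0..2*pi})"
    and Qs: "\<And>s \<theta>. s \<in> {s0..s1} \<Longrightarrow> \<theta> \<in> {0..2*pi} \<Longrightarrow> ((\<lambda>s. Q (s, \<theta>)) has_vector_derivative D (s, \<theta>)) (at s within {s0..s1})"
    and per: "\<And>s. s \<in> {s0..s1} \<Longrightarrow> V (s, 2*pi) = V (s, 0) + \<i> * of_real m" "\<And>s. s \<in> {s0..s1} \<Longrightarrow> P (s, 2*pi) = P (s, 0)"
    and H: "\<And>x. (H has_real_derivative h x) (at x)" and hc: "continuous_on UNIV h"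
    and ends: "\<And>\<theta>. \<theta> \<in> {0..2*pi} \<Longrightarrow> H (Re (V (s0, \<theta>))) = c0" "\<And>\<theta>. \<theta> \<in> {0..2*pi} \<Longrightarrow> H (Re (V (s1, \<theta>))) = c1"
  shows "integral (Box s0 s1) (\<lambda>x. h (Re (V x)) * Im (cnj (P x) * Q x)) = m * (c1 - c0)"
proof -
  have Hc: "continuous_on UNIV H" using H by (metis DERIV_isCont continuous_at_imp_continuous_on)
  have HVs: "((\<lambda>s. H (Re (V (s, \<theta>)))) has_vector_derivative h (Re (V (s, \<theta>))) * Re (P (s, \<theta>))) (at s within {s0..s1})"
    if "s \<in> {s0..s1}" "\<theta> \<in> {0..2*pi}" for s \<theta>
  proof -
    have "((\<lambda>s. Re (V (s, \<theta>))) has_real_derivative Re (P (s, \<theta>))) (at s within {s0..s1})"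
      unfolding has_real_derivative_iff_has_vector_derivative
      by (rule bounded_linear.has_vector_derivative[OF bounded_linear_Re Vs[OF that]])
    from DERIV_chain2[OF H this] show ?thesis
      unfolding has_real_derivative_iff_has_vector_derivative .
  qed
  have HVt: "((\<lambda>\<theta>. H (Re (V (s, \<theta>)))) has_vector_derivative h (Re (V (s, \<theta>))) * Re (Q (s, \<theta>))) (at \<theta> within {0..2*pi})"
    if "s \<in> {s0..s1}" "\<theta> \<in> {0..2*pi}" for s \<theta>
  proof -
    have "((\<lambda>\<theta>. Re (V (s, \<theta>))) has_real_derivative Re (Q (s, \<theta>))) (at \<theta> within {0..2*pi})"
      unfolding has_real_derivative_iff_has_vector_derivative
      by (rule bounded_linear.has_vector_derivative[OF bounded_linear_Re Vt[OF that]])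
    from DERIV_chain2[OF H this] show ?thesis
      unfolding has_real_derivative_iff_has_vector_derivative .
  qed
  have Imd: "((\<lambda>x. Im (f x)) has_vector_derivative Im f') F" if "(f has_vector_derivative f') F" for f f' and F :: "real filter"
    by (rule bounded_linear.has_vector_derivative[OF bounded_linear_Im that])
  have cHV: "continuous_on (Box s0 s1) (\<lambda>x. H (Re (V x)))" "continuous_on (Box s0 s1) (\<lambda>x. h (Re (V x)))"
    by (intro continuous_on_compose2[OF Hc] continuous_on_compose2[OF hc] continuous_intros cont; simp)+
  define g1 where "g1 x = h (Re (V x)) * Re (P x) * Im (Q x) + H (Re (V x)) * Im (D x)" for x
  define g2 where "g2 x = h (Re (V x)) * Re (Q x) * Im (P x) + H (Re (V x)) * Im (D x)" for x
  have cg: "continuous_on (Box s0 s1) g1" "continuous_on (Box s0 s1) g2"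
    unfolding g1_def g2_def by (intro continuous_intros cHV cont)+
  have g2_0: "integral {0..2*pi} (\<lambda>\<theta>. g2 (s, \<theta>)) = 0" if s: "s \<in> {s0..s1}" for s
  proof -
    have "((\<lambda>\<theta>. g2 (s, \<theta>)) has_integral H (Re (V (s, 2*pi))) * Im (P (s, 2*pi)) - H (Re (V (s, 0))) * Im (P (s, 0))) {0..2*pi}"
    proof (rule fundamental_theorem_of_calculus)
      fix \<theta> assume t: "\<theta> \<in> {0..2*pi}"
      show "((\<lambda>\<theta>. H (Re (V (s, \<theta>))) * Im (P (s, \<theta>))) has_vector_derivative g2 (s, \<theta>)) (at \<theta> within {0..2*pi})"
        using has_vector_derivative_mult[OF HVt[OF s t] Imd[OF Pt[OF s t]]]
        by (simp add: g2_def algebra_simps)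
    qed simp
    then show ?thesis using per[OF s] by (simp add: integral_unique)
  qed
  define I where "I s = integral {0..2*pi} (\<lambda>\<theta>. H (Re (V (s, \<theta>))) * Im (Q (s, \<theta>)))" for s
  have Ider: "(I has_vector_derivative integral {0..2*pi} (\<lambda>\<theta>. g1 (s, \<theta>))) (at s within {s0..s1})" if s: "s \<in> {s0..s1}" for s
  proof -
    have "((\<lambda>s. integral (cbox 0 (2*pi)) (\<lambda>\<theta>. H (Re (V (s, \<theta>))) * Im (Q (s, \<theta>)))) has_vector_derivative
        integral (cbox 0 (2*pi)) (\<lambda>\<theta>. g1 (s, \<theta>))) (at s within {s0..s1})"
    proof (rule leibniz_rule_vector_derivative)
      fix s \<theta> :: real assume st: "s \<in> {s0..s1}" "\<theta> \<in> cbox 0 (2*pi)"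
      then have st': "\<theta> \<in> {0..2*pi}" by simp
      show "((\<lambda>s. H (Re (V (s, \<theta>))) * Im (Q (s, \<theta>))) has_vector_derivative g1 (s, \<theta>)) (at s within {s0..s1})"
        using has_vector_derivative_mult[OF HVs[OF st(1) st'] Imd[OF Qs[OF st(1) st']]]
        by (simp add: g1_def algebra_simps)
    next
      fix s assume s: "s \<in> {s0..s1}"
      have "continuous_on (Box s0 s1) (\<lambda>x. H (Re (V x)) * Im (Q x))" by (intro continuous_intros cHV cont)
      from continuous_on_section(2)[OF this s]
      show "(\<lambda>\<theta>. H (Re (V (s, \<theta>))) * Im (Q (s, \<theta>))) integrable_on cbox 0 (2*pi)"
        by (intro integrable_continuous) simp
    next
      show "continuous_on ({s0..s1} \<times> cbox 0 (2*pi)) (\<lambda>(s, \<theta>). g1 (s, \<theta>))"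
        using cg(1) by (simp add: cbox_Pair_eq)
    qed (use s in auto)
    then show ?thesis by (simp add: I_def[abs_def])
  qed
  have Iends: "I s0 = m * c0" "I s1 = m * c1"
  proof -
    have "I s = m * c" if s: "s \<in> {s0..s1}" and c: "\<And>\<theta>. \<theta> \<in> {0..2*pi} \<Longrightarrow> H (Re (V (s, \<theta>))) = c" for s c
    proof -
      have "((\<lambda>\<theta>. Im (Q (s, \<theta>))) has_integral Im (V (s, 2*pi)) - Im (V (s, 0))) {0..2*pi}"
        by (rule fundamental_theorem_of_calculus) (auto intro!: Imd Vt s)
      then have "((\<lambda>\<theta>. Im (Q (s, \<theta>))) has_integral m) {0..2*pi}" using per(1)[OF s] by simp
      from has_integral_mult_right[OF this, of c]
      have "((\<lambda>\<theta>. H (Re (V (s, \<theta>))) * Im (Q (s, \<theta>))) has_integral c * m) {0..2*pi}"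
        by (rule has_integral_eq[rotated]) (simp add: c)
      then show ?thesis by (simp add: I_def integral_unique mult.commute)
    qed
    then show "I s0 = m * c0" "I s1 = m * c1" using ends s by auto
  qed
  have "((\<lambda>s. integral {0..2*pi} (\<lambda>\<theta>. g1 (s, \<theta>))) has_integral I s1 - I s0) {s0..s1}"
    using s Ider by (intro fundamental_theorem_of_calculus) auto
  then have I1: "integral {s0..s1} (\<lambda>s. integral {0..2*pi} (\<lambda>\<theta>. g1 (s, \<theta>))) = m * (c1 - c0)"
    using Iends by (simp add: integral_unique algebra_simps)
  have "integral (Box s0 s1) (\<lambda>x. h (Re (V x)) * Im (cnj (P x) * Q x)) = integral (Box s0 s1) (\<lambda>x. g1 x - g2 x)"
    by (intro arg_cong[where f = "integral (Box s0 s1)"] ext) (simp add: g1_def g2_def algebra_simps)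
  also have "\<dots> = integral (Box s0 s1) g1 - integral (Box s0 s1) g2"
    by (intro integral_diff integrable_continuous cg)
  also have "integral (Box s0 s1) g2 = integral {s0..s1} (\<lambda>s. integral {0..2*pi} (\<lambda>\<theta>. g2 (s, \<theta>)))"
    using integral_prod_continuous[OF cg(2)] by simp
  also have "\<dots> = integral {s0..s1} (\<lambda>s. 0)" by (intro integral_cong g2_0)
  also have "\<dots> = 0" by simp
  also have "integral (Box s0 s1) g1 = integral {s0..s1} (\<lambda>s. integral {0..2*pi} (\<lambda>\<theta>. g1 (s, \<theta>)))"
    using integral_prod_continuous[OF cg(1)] by simp
  finally show ?thesis using I1 by simp
qed

text \<open>
Near \<open>x\<close> a continuous logarithm of \<open>G\<close> is \<open>g x\<close> plus the principal logarithm of \<open>G y / G x\<close>.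
\<close>

lemma log_has_vector_derivative:
  fixes g G :: "real \<Rightarrow> complex"
  assumes g: "continuous_on A g" and x: "x \<in> A" and e: "\<And>y. y \<in> A \<Longrightarrow> exp (g y) = G y"
    and G: "(G has_vector_derivative G') (at x within A)"
  shows "(g has_vector_derivative G' / G x) (at x within A)"
proof -
  have nz: "G x \<noteq> 0" using e[OF x] by (metis exp_not_eq_zero)
  obtain d where d: "d > 0" "\<And>y. y \<in> A \<Longrightarrow> dist y x < d \<Longrightarrow> dist (g y) (g x) < 1"
    using g x unfolding continuous_on_iff by (metis zero_less_one)
  have "((\<lambda>y. G y / G x) has_vector_derivative G' / G x) (at x within A)"
    using has_vector_derivative_mult_left[OF G, of "inverse (G x)"] by (simp add: divide_inverse)
  moreover have "(Ln has_derivative (*) (inverse 1)) (at (G x / G x) within (\<lambda>y. G y / G x) ` A)"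
  proof -
    have 1: "(Ln has_field_derivative inverse 1) (at (1::complex))" by (rule has_field_derivative_Ln) simp
    have 2: "G x / G x = 1" using nz by simp
    show ?thesis unfolding 2 by (rule has_derivative_at_withinI[OF 1[unfolded has_field_derivative_def]])
  qed
  ultimately have "(Ln \<circ> (\<lambda>y. G y / G x) has_vector_derivative inverse 1 * (G' / G x)) (at x within A)"
    by (rule vector_derivative_diff_chain_within)
  from has_vector_derivative_add[OF has_vector_derivative_const[of "g x"] this]
  have "((\<lambda>y. g x + Ln (G y / G x)) has_vector_derivative G' / G x) (at x within A)"
    by (simp add: o_def)
  then show ?thesis
  proof (rule has_vector_derivative_transform_within[OF _ d(1) x])
    fix y assume y: "y \<in> A" "dist y x < d"
    have "\<bar>Im (g y - g x)\<bar> < pi"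
      using d(2)[OF y] abs_Im_le_cmod[of "g y - g x"] pi_gt3 by (simp add: dist_norm)
    then have "Ln (exp (g y - g x)) = g y - g x" by (intro Ln_exp) auto
    then show "g x + Ln (G y / G x) = g y" using e[OF y(1)] e[OF x] by (simp add: exp_diff)
  qed
qed

lemma has_vector_derivative_quotient:
  fixes f g :: "real \<Rightarrow> complex"
  assumes "(f has_vector_derivative f') (at x within A)" "(g has_vector_derivative g') (at x within A)" "g x \<noteq> 0"
  shows "((\<lambda>x. f x / g x) has_vector_derivative f' / g x - f x * g' / (g x)\<^sup>2) (at x within A)"
proof -
  have "((\<lambda>x. f x / g x) has_derivative (\<lambda>h. (h *\<^sub>R f' * g x - f x * (h *\<^sub>R g')) / (g x * g x))) (at x within A)"
    using has_derivative_divide'[OF assms(1,2)[unfolded has_vector_derivative_def] assms(3)] .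
  moreover have "(\<lambda>h. (h *\<^sub>R f' * g x - f x * (h *\<^sub>R g')) / (g x * g x)) = (\<lambda>h. h *\<^sub>R (f' / g x - f x * g' / (g x)\<^sup>2))"
  proof
    fix h
    have "(h *\<^sub>R f' * g x - f x * (h *\<^sub>R g')) / (g x * g x) = h *\<^sub>R ((f' * g x - f x * g') / (g x * g x))"
      by (simp add: scaleR_conv_of_real algebra_simps)
    also have "(f' * g x - f x * g') / (g x * g x) = f' / g x - f x * g' / (g x)\<^sup>2"
      using assms(3) by (simp add: diff_divide_distrib power2_eq_square)
    finally show "(h *\<^sub>R f' * g x - f x * (h *\<^sub>R g')) / (g x * g x) = h *\<^sub>R (f' / g x - f x * g' / (g x)\<^sup>2)" .
  qed
  ultimately show ?thesis by (simp add: has_vector_derivative_def)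
qed

lemma C2_map_chain:
  assumes "C2_map F p q r t u" and E: "(E has_vector_derivative E') (at x within A)"
  shows "((\<lambda>x. F (E x)) has_vector_derivative Re E' *\<^sub>R p (E x) + Im E' *\<^sub>R q (E x)) (at x within A)"
    "((\<lambda>x. p (E x)) has_vector_derivative Re E' *\<^sub>R r (E x) + Im E' *\<^sub>R t (E x)) (at x within A)"
    "((\<lambda>x. q (E x)) has_vector_derivative Re E' *\<^sub>R t (E x) + Im E' *\<^sub>R u (E x)) (at x within A)"
  using assms vector_derivative_diff_chain_within[OF E has_derivative_at_withinI]
  unfolding C2_map_def o_def by blast+

text \<open>
The exponential in real coordinates \<open>(s, \<theta>)\<close> of the logarithmic plane.
\<close>

definition exp_polar :: "real \<times> real \<Rightarrow> complex" where "exp_polar x = exp (of_real (fst x) + \<i> * of_real (snd x))"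

lemma exp_polar_has_vector_derivative:
  "((\<lambda>s. exp_polar (s, \<theta>)) has_vector_derivative exp_polar (s, \<theta>)) (at s within A)"
  "((\<lambda>\<theta>. exp_polar (s, \<theta>)) has_vector_derivative \<i> * exp_polar (s, \<theta>)) (at \<theta> within A)"
proof -
  show "((\<lambda>s. exp_polar (s, \<theta>)) has_vector_derivative exp_polar (s, \<theta>)) (at s within A)"
    unfolding exp_polar_def fst_conv snd_conv
    by (rule has_vector_derivative_real_field[of "\<lambda>w. exp (w + \<i> * of_real \<theta>)"]) (auto intro!: derivative_eq_intros)
  show "((\<lambda>\<theta>. exp_polar (s, \<theta>)) has_vector_derivative \<i> * exp_polar (s, \<theta>)) (at \<theta> within A)"
    unfolding exp_polar_def fst_conv snd_conv
    by (rule has_vector_derivative_real_field[of "\<lambda>w. exp (of_real s + \<i> * w)"]) (auto intro!: derivative_eq_intros)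
qed

lemma norm_exp_polar: "norm (exp_polar (s, \<theta>)) = exp s"
  by (simp add: exp_polar_def)

lemma continuous_exp_polar: "continuous_on A exp_polar"
  unfolding exp_polar_def by (intro continuous_intros)

lemma exp_polar_period: "exp_polar (s, 2 * pi) = exp_polar (s, 0)"
  by (simp add: exp_polar_def exp_add exp_eq_polar)

text \<open>
The logarithm of \<open>F\<close> in logarithmic coordinates. The exponential is conformal, so its Wirtinger derivatives are those of
\<open>F\<close> multiplied by \<open>z\<close> and \<open>cnj z\<close> and divided by \<open>F\<close>; this keeps the distortion
inequality. The common second derivative \<open>D\<close> expresses the symmetry of the mixed derivatives.
\<close>

lemma log_pullback:
  assumes C: "C2_map F p q r t u"
    and V: "continuous_on (Box s0 s1) V" "\<And>x. x \<in> Box s0 s1 \<Longrightarrow> exp (V x) = F (exp_polar x)"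
  defines "m \<equiv> \<lambda>x. dz (p (exp_polar x)) (q (exp_polar x)) * exp_polar x" and "n \<equiv> \<lambda>x. dzb (p (exp_polar x)) (q (exp_polar x)) * cnj (exp_polar x)"
  shows "\<exists>P Q D. continuous_on (Box s0 s1) P \<and> continuous_on (Box s0 s1) Q \<and> continuous_on (Box s0 s1) D \<and>
    (\<forall>x\<in>Box s0 s1. P x = (m x + n x) / F (exp_polar x) \<and> Q x = \<i> * (m x - n x) / F (exp_polar x)) \<and>
    (\<forall>s\<in>{s0..s1}. P (s, 2*pi) = P (s, 0)) \<and>
    (\<forall>s\<in>{s0..s1}. \<forall>\<theta>\<in>{0..2*pi}.
      ((\<lambda>s. V (s, \<theta>)) has_vector_derivative P (s, \<theta>)) (at s within {s0..s1}) \<and>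
      ((\<lambda>\<theta>. V (s, \<theta>)) has_vector_derivative Q (s, \<theta>)) (at \<theta> within {0..2*pi}) \<and>
      ((\<lambda>\<theta>. P (s, \<theta>)) has_vector_derivative D (s, \<theta>)) (at \<theta> within {0..2*pi}) \<and>
      ((\<lambda>s. Q (s, \<theta>)) has_vector_derivative D (s, \<theta>)) (at s within {s0..s1}))"
proof -
  define X Y where "X x = Re (exp_polar x)" and "Y x = Im (exp_polar x)" for x
  define Gs Gt where "Gs x = of_real (X x) * p (exp_polar x) + of_real (Y x) * q (exp_polar x)"
    and "Gt x = - of_real (Y x) * p (exp_polar x) + of_real (X x) * q (exp_polar x)" for x
  define Gst where "Gst x = - of_real (Y x) * p (exp_polar x) + of_real (X x) * (- of_real (Y x) * r (exp_polar x) + of_real (X x) * t (exp_polar x))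
     + (of_real (X x) * q (exp_polar x) + of_real (Y x) * (- of_real (Y x) * t (exp_polar x) + of_real (X x) * u (exp_polar x)))" for x
  define P Q D where "P x = Gs x / F (exp_polar x)" and "Q x = Gt x / F (exp_polar x)"
    and "D x = Gst x / F (exp_polar x) - Gs x * Gt x / (F (exp_polar x))\<^sup>2" for x
  note cs = C2_map_continuous[OF C]
  have cr: "continuous_on UNIV r" "continuous_on UNIV t" "continuous_on UNIV u" using C by (auto simp: C2_map_def)
  have ce: "continuous_on (Box s0 s1) (\<lambda>x. g (exp_polar x))" if "continuous_on UNIV g" for g :: "complex \<Rightarrow> complex"
    using continuous_on_compose2[OF that continuous_exp_polar] by auto
  have nz: "F (exp_polar x) \<noteq> 0" if "x \<in> Box s0 s1" for x using V(2)[OF that] by (metis exp_not_eq_zero)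
  have cX: "continuous_on (Box s0 s1) X" "continuous_on (Box s0 s1) Y"
    unfolding X_def Y_def by (intro continuous_intros continuous_exp_polar)+
  have cG: "continuous_on (Box s0 s1) Gs" "continuous_on (Box s0 s1) Gt" "continuous_on (Box s0 s1) Gst"
    unfolding Gs_def Gt_def Gst_def by (intro continuous_intros cX ce cs cr)+
  have "continuous_on (Box s0 s1) P" "continuous_on (Box s0 s1) Q" "continuous_on (Box s0 s1) D"
    unfolding P_def Q_def D_def using nz by (intro continuous_intros cG ce cs; simp)+
  moreover have "P x = (m x + n x) / F (exp_polar x) \<and> Q x = \<i> * (m x - n x) / F (exp_polar x)" for x
  proof -
    have "exp_polar x = of_real (X x) + \<i> * of_real (Y x)" by (simp add: X_def Y_def complex_eq_iff)
    moreover have "cnj (exp_polar x) = of_real (X x) - \<i> * of_real (Y x)" by (simp add: X_def Y_def complex_eq_iff)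
    ultimately have "Gs x = m x + n x" "Gt x = \<i> * (m x - n x)"
      unfolding Gs_def Gt_def m_def n_def dz_def dzb_def
      by (simp_all add: algebra_simps add_divide_distrib diff_divide_distrib)
    then show ?thesis by (simp add: P_def Q_def)
  qed
  moreover have "P (s, 2*pi) = P (s, 0)" for s
    by (simp add: P_def Gs_def X_def Y_def exp_polar_period)
  moreover have "((\<lambda>s. V (s, \<theta>)) has_vector_derivative P (s, \<theta>)) (at s within {s0..s1}) \<and>
      ((\<lambda>\<theta>. V (s, \<theta>)) has_vector_derivative Q (s, \<theta>)) (at \<theta> within {0..2*pi}) \<and>
      ((\<lambda>\<theta>. P (s, \<theta>)) has_vector_derivative D (s, \<theta>)) (at \<theta> within {0..2*pi}) \<and>
      ((\<lambda>s. Q (s, \<theta>)) has_vector_derivative D (s, \<theta>)) (at s within {s0..s1})"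
    if st: "s \<in> {s0..s1}" "\<theta> \<in> {0..2*pi}" for s \<theta>
  proof -
    have box: "(s', \<theta>) \<in> Box s0 s1" "(s, \<theta>') \<in> Box s0 s1" if "s' \<in> {s0..s1}" "\<theta>' \<in> {0..2*pi}" for s' \<theta>'
      using st that by (auto simp: cbox_Pair_eq)
    note nzx = nz[OF box(1)[OF st]]
    note ES = exp_polar_has_vector_derivative(1)[of \<theta> s "{s0..s1}"] and ET = exp_polar_has_vector_derivative(2)[of s \<theta> "{0..2*pi}"]
    note FS = C2_map_chain[OF C ES] and FT = C2_map_chain[OF C ET]
    have FS1: "((\<lambda>s. F (exp_polar (s, \<theta>))) has_vector_derivative Gs (s, \<theta>)) (at s within {s0..s1})"
      using FS(1) by (simp add: Gs_def X_def Y_def scaleR_conv_of_real)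
    have FT1: "((\<lambda>\<theta>. F (exp_polar (s, \<theta>))) has_vector_derivative Gt (s, \<theta>)) (at \<theta> within {0..2*pi})"
      using FT(1) by (simp add: Gt_def X_def Y_def scaleR_conv_of_real)
    have "((\<lambda>s. V (s, \<theta>)) has_vector_derivative P (s, \<theta>)) (at s within {s0..s1})"
      unfolding P_def using box st
      by (intro log_has_vector_derivative[OF continuous_on_section(1)[OF V(1)] _ _ FS1]) (auto intro!: V(2))
    moreover have "((\<lambda>\<theta>. V (s, \<theta>)) has_vector_derivative Q (s, \<theta>)) (at \<theta> within {0..2*pi})"
      unfolding Q_def using box st
      by (intro log_has_vector_derivative[OF continuous_on_section(2)[OF V(1)] _ _ FT1]) (auto intro!: V(2))
    moreover have "((\<lambda>\<theta>. P (s, \<theta>)) has_vector_derivative D (s, \<theta>)) (at \<theta> within {0..2*pi})"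
    proof -
      have Xt: "((\<lambda>\<theta>. of_real (X (s, \<theta>)) :: complex) has_vector_derivative of_real (- Y (s, \<theta>))) (at \<theta> within {0..2*pi})"
        unfolding X_def Y_def
        using bounded_linear.has_vector_derivative[OF bounded_linear_of_real bounded_linear.has_vector_derivative[OF bounded_linear_Re ET]] by simp
      have Yt: "((\<lambda>\<theta>. of_real (Y (s, \<theta>)) :: complex) has_vector_derivative of_real (X (s, \<theta>))) (at \<theta> within {0..2*pi})"
        unfolding X_def Y_def
        using bounded_linear.has_vector_derivative[OF bounded_linear_of_real bounded_linear.has_vector_derivative[OF bounded_linear_Im ET]] by simp
      have "((\<lambda>\<theta>. Gs (s, \<theta>)) has_vector_derivative Gst (s, \<theta>)) (at \<theta> within {0..2*pi})"
        unfolding Gs_def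
        using has_vector_derivative_add[OF has_vector_derivative_mult[OF Xt FT(2)] has_vector_derivative_mult[OF Yt FT(3)]]
        by (simp add: Gst_def X_def Y_def scaleR_conv_of_real algebra_simps)
      from has_vector_derivative_quotient[OF this FT1 nzx]
      show ?thesis unfolding P_def D_def .
    qed
    moreover have "((\<lambda>s. Q (s, \<theta>)) has_vector_derivative D (s, \<theta>)) (at s within {s0..s1})"
    proof -
      have Xs: "((\<lambda>s. of_real (X (s, \<theta>)) :: complex) has_vector_derivative of_real (X (s, \<theta>))) (at s within {s0..s1})"
        unfolding X_def
        by (rule bounded_linear.has_vector_derivative[OF bounded_linear_of_real bounded_linear.has_vector_derivative[OF bounded_linear_Re ES]])
      have Ys: "((\<lambda>s. of_real (Y (s, \<theta>)) :: complex) has_vector_derivative of_real (Y (s, \<theta>))) (at s within {s0..s1})"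
        unfolding Y_def
        by (rule bounded_linear.has_vector_derivative[OF bounded_linear_of_real bounded_linear.has_vector_derivative[OF bounded_linear_Im ES]])
      have "((\<lambda>s. Gt (s, \<theta>)) has_vector_derivative Gst (s, \<theta>)) (at s within {s0..s1})"
        unfolding Gt_def
        using has_vector_derivative_add[OF has_vector_derivative_mult[OF has_vector_derivative_minus[OF Ys] FS(2)] has_vector_derivative_mult[OF Xs FS(3)]]
        by (simp add: Gst_def X_def Y_def scaleR_conv_of_real algebra_simps)
      from has_vector_derivative_quotient[OF this FS1 nzx]
      show ?thesis unfolding Q_def D_def by (simp only: mult.commute[of "Gs _"])
    qed
    ultimately show ?thesis by blast
  qed
  ultimately show ?thesis by blast
qed

section \<open>Spirals and lifts\<close>

definition log_point :: "real \<times> real \<Rightarrow> complex" where "log_point x = of_real (fst x) + \<i> * of_real (snd x)"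

lemma Re_log_point [simp]: "Re (log_point x) = fst x" and Im_log_point [simp]: "Im (log_point x) = snd x"
  by (simp_all add: log_point_def)

lemma exp_polar_eq: "exp_polar x = exp (log_point x)"
  by (simp add: exp_polar_def log_point_def)

lemma continuous_log_point: "continuous_on A log_point"
  unfolding log_point_def by (intro continuous_intros)

lemma spiral_point_eq_exp:
  "x > 0 \<Longrightarrow> of_real (x powr (- c)) * exp (\<i> * of_real x) = exp (of_real (- c * ln x) + \<i> * of_real x)"
  by (simp only: exp_add exp_of_real powr_def) simp

text \<open>
In logarithmic coordinates a spiral is the graph \<open>\<theta> = exp (- s / c)\<close> together with its translates by
multiples of \<open>2 * pi\<close>.
\<close>

lemma exp_in_spiral_iff:
  assumes c: "c > 0"
  shows "exp w \<in> spiral c \<longleftrightarrow> (\<exists>n::int. Im w - exp (- Re w / c) = 2 * pi * of_int n)"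
proof
  assume "exp w \<in> spiral c"
  then obtain x :: real where x: "x > 0" "exp w = of_real (x powr (- c)) * exp (\<i> * of_real x)"
    unfolding spiral_def by blast
  have "exp w = exp (of_real (- c * ln x) + \<i> * of_real x)"
    using x spiral_point_eq_exp by simp
  then obtain n :: int where n: "w = of_real (- c * ln x) + \<i> * of_real x + (of_int (2 * n) * pi) * \<i>"
    unfolding exp_eq by blast
  have "Re w = - c * ln x" "Im w = x + 2 * pi * of_int n"
    using arg_cong[OF n, of Re] arg_cong[OF n, of Im] by simp_all
  moreover from this(1) have "exp (- Re w / c) = x" using c x by simp
  ultimately show "\<exists>n::int. Im w - exp (- Re w / c) = 2 * pi * of_int n" by auto
next
  assume "\<exists>n::int. Im w - exp (- Re w / c) = 2 * pi * of_int n"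
  then obtain n :: int where n: "Im w - exp (- Re w / c) = 2 * pi * of_int n" by blast
  define x where "x = exp (- Re w / c)"
  have x: "x > 0" by (simp add: x_def)
  have "ln x = - Re w / c" by (simp add: x_def)
  then have re: "Re w = - c * ln x" using c by simp
  have "w = of_real (- c * ln x) + \<i> * of_real x + (of_int (2 * n) * pi) * \<i>"
    using re n by (simp add: complex_eq_iff x_def algebra_simps)
  then have "exp w = exp (of_real (- c * ln x) + \<i> * of_real x)" unfolding exp_eq by blast
  also have "\<dots> = of_real (x powr (- c)) * exp (\<i> * of_real x)"
    using x spiral_point_eq_exp by simp
  finally show "exp w \<in> spiral c" using x unfolding spiral_def by blast
qed

lemma zero_notin_spiral: "0 \<notin> spiral c"
  by (auto simp: spiral_def)

lemma spiral_fixed_point_form: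
  assumes c: "c > 0" and z: "z \<in> spiral c"
  shows "z = of_real (norm z) * exp (\<i> * of_real (norm z powr (- 1 / c)))"
proof -
  obtain x :: real where x: "x > 0" "z = of_real (x powr (- c)) * exp (\<i> * of_real x)"
    using z unfolding spiral_def by blast
  have n: "norm z = x powr (- c)" using x by (simp add: norm_mult)
  then have "norm z powr (- 1 / c) = x" using x c by (simp add: powr_powr)
  with n x show ?thesis by simp
qed

text \<open>
Off the origin the spiral is the zero set of a continuous function of \<open>z\<close>, since the parameter can be
recovered from the modulus.
\<close>

lemma closure_spiral:
  assumes c: "c > 0" and z: "z \<in> closure (spiral c)" "z \<noteq> 0"
  shows "z \<in> spiral c"
proof -
  obtain y where y: "\<And>n. y n \<in> spiral c" "y \<longlonglongrightarrow> z" using z(1) unfolding closure_sequential by blast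
  have "(\<lambda>n. of_real (norm (y n)) * exp (\<i> * of_real (norm (y n) powr (- 1 / c))))
      \<longlonglongrightarrow> of_real (norm z) * exp (\<i> * of_real (norm z powr (- 1 / c)))"
    using z(2) by (intro tendsto_intros y(2)) auto
  moreover have "(\<lambda>n. of_real (norm (y n)) * exp (\<i> * of_real (norm (y n) powr (- 1 / c)))) = y"
    using spiral_fixed_point_form[OF c y(1)] by auto
  ultimately have eq: "z = of_real (norm z) * exp (\<i> * of_real (norm z powr (- 1 / c)))"
    using y(2) LIMSEQ_unique by metis
  define x where "x = norm z powr (- 1 / c)"
  have "x > 0" "x powr (- c) = norm z" using z(2) c by (auto simp: x_def powr_powr)
  then show ?thesis using eq unfolding spiral_def x_def by (metis (mono_tags, lifting) mem_Collect_eq)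
qed

lemma zero_in_closure_spiral:
  assumes c: "c > 0"
  shows "0 \<in> closure (spiral c)"
  unfolding closure_sequential
proof (intro exI conjI allI)
  fix n
  show "of_real ((1 + real n) powr (- c)) * exp (\<i> * of_real (1 + real n)) \<in> spiral c"
    unfolding spiral_def by (intro CollectI exI[of _ "1 + real n"]) auto
next
  have "filterlim (\<lambda>n. 1 + real n) at_top sequentially"
    by (intro filterlim_tendsto_add_at_top[OF tendsto_const] filterlim_real_sequentially)
  then have lim: "(\<lambda>n. (1 + real n) powr (- c)) \<longlonglongrightarrow> 0"
    using c by (intro tendsto_neg_powr) auto
  show "(\<lambda>n. of_real ((1 + real n) powr (- c)) * exp (\<i> * of_real (1 + real n))) \<longlonglongrightarrow> 0"
    by (intro Lim_null_comparison[OF _ lim] always_eventually) (auto simp: norm_mult)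
qed

lemma int_valued_constant:
  fixes \<phi> :: "'a::topological_space \<Rightarrow> real"
  assumes "connected S" "continuous_on S \<phi>" "\<And>x. x \<in> S \<Longrightarrow> \<phi> x \<in> \<int>" "x \<in> S" "y \<in> S"
  shows "\<phi> x = \<phi> y"
proof -
  have "\<phi> constant_on S"
  proof (rule continuous_discrete_range_constant[OF assms(1,2)])
    fix x assume x: "x \<in> S"
    have "1 \<le> norm (\<phi> y - \<phi> x)" if "y \<in> S" "\<phi> y \<noteq> \<phi> x" for y
      using Ints_nonzero_abs_ge1[of "\<phi> y - \<phi> x"] assms(3) x that by simp
    then show "\<exists>e>0. \<forall>y. y \<in> S \<and> \<phi> y \<noteq> \<phi> x \<longrightarrow> e \<le> norm (\<phi> y - \<phi> x)"
      by (intro exI[of _ 1]) auto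
  qed
  with assms(4,5) show ?thesis unfolding constant_on_def by metis
qed

text \<open>
The origin is the only point that the closure of a spiral adds, and homeomorphisms respect closures.
\<close>

lemma spiral_homeo_fixes_zero:
  assumes hom: "homeomorphism UNIV UNIV f g" and c: "a > 0" "b > 0" and im: "f ` spiral a = spiral b"
  shows "f 0 = 0"
proof (rule ccontr)
  assume "f 0 \<noteq> 0"
  have cf: "continuous_on UNIV f" and gf: "\<And>x. g (f x) = x" using hom by (auto simp: homeomorphism_def)
  have "f ` closure (spiral a) \<subseteq> closure (f ` spiral a)"
    by (rule image_closure_subset[OF continuous_on_subset[OF cf subset_UNIV] closed_closure closure_subset])
  from subsetD[OF this imageI[OF zero_in_closure_spiral[OF c(1)]]]
  have "f 0 \<in> closure (spiral b)" unfolding im .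
  then have "f 0 \<in> f ` spiral a" unfolding im by (rule closure_spiral[OF c(2) _ \<open>f 0 \<noteq> 0\<close>])
  then obtain z where "z \<in> spiral a" "f z = f 0" by auto
  then have "z = 0" using gf by metis
  with \<open>z \<in> spiral a\<close> show False using zero_notin_spiral by simp
qed

text \<open>
The plane is contractible, so \<open>f \<circ> exp\<close> has a continuous logarithm \<open>W\<close>. The difference of \<open>W\<close> at points
with the same exponential is a multiple of \<open>2 * pi * \<i>\<close> that depends continuously on the point.
\<close>

lemma log_lift:
  fixes f :: "complex \<Rightarrow> complex"
  assumes f: "continuous_on UNIV f" and nz: "\<And>z. z \<noteq> 0 \<Longrightarrow> f z \<noteq> 0"
  obtains W and k :: int where "continuous_on UNIV W" "\<And>w. exp (W w) = f (exp w)"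
    "\<And>w n. W (w + \<i> * of_real (2 * pi * of_int n)) = W w + \<i> * of_real (2 * pi * of_int (k * n))"
proof -
  have cfe: "continuous_on UNIV (\<lambda>w. f (exp w))"
    by (rule continuous_on_compose2[OF f]) (auto intro!: continuous_intros)
  obtain W where W: "continuous_on UNIV W" "\<And>w. f (exp w) = exp (W w)"
    using continuous_logarithm_on_contractible[OF cfe] nz convex_imp_contractible[OF convex_UNIV] by (metis UNIV_I exp_not_eq_zero)
  define \<phi> where "\<phi> w = Im (W (w + \<i> * of_real (2 * pi)) - W w) / (2 * pi)" for w
  have per: "W (w + \<i> * of_real (2 * pi)) = W w + \<i> * of_real (2 * pi * \<phi> w) \<and> \<phi> w \<in> \<int>" for w
  proof -
    have "exp (W (w + \<i> * of_real (2 * pi))) = exp (W w)"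
    proof -
      have "exp (w + \<i> * of_real (2 * pi)) = exp w"
        unfolding exp_eq by (intro exI[of _ 1]) (simp add: algebra_simps)
      then show ?thesis by (simp only: W(2)[symmetric])
    qed
    then obtain n :: int where n: "W (w + \<i> * of_real (2 * pi)) = W w + (of_int (2 * n) * pi) * \<i>"
      unfolding exp_eq by blast
    then have "\<phi> w = of_int n" by (simp add: \<phi>_def)
    with n show ?thesis by (simp add: algebra_simps)
  qed
  have "continuous_on UNIV \<phi>"
    unfolding \<phi>_def by (intro continuous_intros continuous_on_compose2[OF W(1)] W(1)) auto
  then have "\<phi> w = \<phi> 0" for w
    by (rule int_valued_constant[OF connected_UNIV]) (use per in auto)
  moreover obtain k :: int where "\<phi> 0 = of_int k" using per[of 0] by (auto elim: Ints_cases)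
  ultimately have step: "W (w + \<i> * of_real (2 * pi)) = W w + \<i> * of_real (2 * pi * of_int k)" for w
    using per[of w] by simp
  have "W (w + \<i> * of_real (2 * pi * of_int n)) = W w + \<i> * of_real (2 * pi * of_int (k * n))" for w n
  proof (induction n rule: int_induct[where k = 0])
    case (step1 i)
    have "w + \<i> * of_real (2 * pi * of_int (i + 1)) = (w + \<i> * of_real (2 * pi * of_int i)) + \<i> * of_real (2 * pi)"
      by (simp add: algebra_simps)
    then have "W (w + \<i> * of_real (2 * pi * of_int (i + 1))) = W w + \<i> * of_real (2 * pi * of_int (k * i)) + \<i> * of_real (2 * pi * of_int k)"
      by (simp only: step step1)
    then show ?case by (simp add: algebra_simps)
  next
    case (step2 i)
    have "w + \<i> * of_real (2 * pi * of_int i) = (w + \<i> * of_real (2 * pi * of_int (i - 1))) + \<i> * of_real (2 * pi)"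
      by (simp add: algebra_simps)
    then have "W w + \<i> * of_real (2 * pi * of_int (k * i)) = W (w + \<i> * of_real (2 * pi * of_int (i - 1))) + \<i> * of_real (2 * pi * of_int k)"
      using step[of "w + \<i> * of_real (2 * pi * of_int (i - 1))"] step2 by metis
    then show ?case by (simp add: algebra_simps)
  qed simp
  with W show ?thesis using that by metis
qed

text \<open>
The lift of the inverse map multiplies the period by some integer \<open>l\<close>. Since the composition of the two lifts
differs from the identity by a constant, \<open>k * l = 1\<close>. This replaces winding numbers of Jordan curves.
\<close>

lemma homeo_lift_degree:
  assumes hom: "homeomorphism UNIV UNIV f g" and f0: "f 0 = 0"
  obtains W and k :: int where "continuous_on UNIV W" "\<And>w. exp (W w) = f (exp w)" "k = 1 \<or> k = -1"
    "\<And>w n. W (w + \<i> * of_real (2 * pi * of_int n)) = W w + \<i> * of_real (2 * pi * of_int (k * n))"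
proof -
  have c: "continuous_on UNIV f" "continuous_on UNIV g" and fg: "\<And>x. f (g x) = x" and gf: "\<And>x. g (f x) = x"
    using hom by (auto simp: homeomorphism_def)
  have g0: "g 0 = 0" using gf[of 0] f0 by simp
  have nz: "f z \<noteq> 0" "g z \<noteq> 0" if "z \<noteq> 0" for z
    using that fg[of z] gf[of z] f0 g0 by auto
  obtain W and k :: int where W: "continuous_on UNIV W" "\<And>w. exp (W w) = f (exp w)"
    "\<And>w n. W (w + \<i> * of_real (2 * pi * of_int n)) = W w + \<i> * of_real (2 * pi * of_int (k * n))"
    using log_lift[OF c(1) nz(1)] by blast
  obtain U and l :: int where U: "continuous_on UNIV U" "\<And>w. exp (U w) = g (exp w)"
    "\<And>w n. U (w + \<i> * of_real (2 * pi * of_int n)) = U w + \<i> * of_real (2 * pi * of_int (l * n))"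
    using log_lift[OF c(2) nz(2)] by blast
  define \<phi> where "\<phi> w = Im (W (U w) - w) / (2 * pi)" for w
  have \<phi>Z: "\<phi> w \<in> \<int>" for w
  proof -
    have "exp (W (U w)) = exp w" using W(2)[of "U w"] U(2)[of w] fg by simp
    then obtain n :: int where "W (U w) = w + (of_int (2 * n) * pi) * \<i>" unfolding exp_eq by blast
    then have "\<phi> w = of_int n" by (simp add: \<phi>_def)
    then show ?thesis by simp
  qed
  have "continuous_on UNIV \<phi>"
    unfolding \<phi>_def by (intro continuous_intros continuous_on_compose2[OF W(1)] U(1)) auto
  then have "\<phi> (0 + \<i> * of_real (2 * pi * of_int 1)) = \<phi> 0"
    by (rule int_valued_constant[OF connected_UNIV]) (use \<phi>Z in auto)
  then have "2 * pi * of_int (k * l) = 2 * pi"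
    unfolding \<phi>_def U(3)[of 0 1] W(3)[of "U 0" "l * 1"] by (simp add: field_simps)
  then have "real_of_int (k * l) = 1" by (simp del: of_int_mult)
  then have "k * l = 1" by (metis of_int_eq_1_iff)
  then have "k = 1 \<or> k = -1" by (metis zmult_eq_1_iff)
  with W show ?thesis using that by metis
qed

lemma homeo_log_limits:
  assumes hom: "homeomorphism UNIV UNIV f g" and f0: "f 0 = 0" and W: "\<And>w. exp (W w) = f (exp w)"
  shows "\<exists>t. \<forall>s\<le>t. \<forall>\<theta>. Re (W (log_point (s, \<theta>))) \<le> x" "\<exists>t. \<forall>s\<ge>t. \<forall>\<theta>. Re (W (log_point (s, \<theta>))) \<ge> x"
proof -
  have c: "continuous_on UNIV f" "continuous_on UNIV g" and gf: "\<And>x. g (f x) = x"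
    using hom by (auto simp: homeomorphism_def)
  have nf: "norm (f (exp (log_point (s, \<theta>)))) = exp (Re (W (log_point (s, \<theta>))))" for s \<theta> by (simp flip: W)
  have ne: "norm (exp (log_point (s, \<theta>))) = exp s" for s \<theta> by (simp add: log_point_def)
  show "\<exists>t. \<forall>s\<le>t. \<forall>\<theta>. Re (W (log_point (s, \<theta>))) \<le> x"
  proof -
    have "isCont f 0" using c(1) by (simp add: continuous_on_eq_continuous_at)
    then obtain d where d: "d > 0" "\<And>z. dist z 0 < d \<Longrightarrow> dist (f z) (f 0) < exp x"
      unfolding continuous_at_eps_delta by (meson exp_gt_zero)
    have "Re (W (log_point (s, \<theta>))) \<le> x" if "s \<le> ln (d / 2)" for s \<theta>
    proof -
      have "exp s \<le> d / 2" using that d(1) by (metis exp_le_cancel_iff exp_ln half_gt_zero)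
      then have "norm (f (exp (log_point (s, \<theta>)))) < exp x" using d(2)[of "exp (log_point (s, \<theta>))"] d(1) ne f0 by simp
      then show ?thesis by (simp add: nf)
    qed
    then show ?thesis by blast
  qed
  show "\<exists>t. \<forall>s\<ge>t. \<forall>\<theta>. Re (W (log_point (s, \<theta>))) \<ge> x"
  proof -
    have "bounded (g ` cball 0 (exp x))"
      by (intro compact_imp_bounded compact_continuous_image continuous_on_subset[OF c(2)]) auto
    then obtain B where B: "B > 0" "\<And>y. y \<in> cball 0 (exp x) \<Longrightarrow> norm (g y) \<le> B" unfolding bounded_pos by auto
    have "Re (W (log_point (s, \<theta>))) \<ge> x" if "s \<ge> ln (B + 1)" for s \<theta>
    proof (rule ccontr)
      assume "\<not> Re (W (log_point (s, \<theta>))) \<ge> x"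
      then have "f (exp (log_point (s, \<theta>))) \<in> cball 0 (exp x)" by (simp add: nf)
      from B(2)[OF this] have "exp s \<le> B" by (simp add: gf ne)
      moreover have "exp s \<ge> B + 1" using that B(1) by (metis add_pos_pos exp_le_cancel_iff exp_ln zero_less_one)
      ultimately show False by simp
    qed
    then show ?thesis by blast
  qed
qed

lemma exp_log_point_surj: "\<exists>\<theta>\<in>{0..2*pi}. z = exp (log_point (ln (norm z), \<theta>))" if "z \<noteq> 0"
proof -
  have "z = of_real (norm z) * exp (\<i> * of_real (Arg2pi z))" by (simp add: Arg2pi_eq)
  also have "\<dots> = exp (log_point (ln (norm z), Arg2pi z))" using that by (simp add: log_point_def exp_add exp_of_real)
  finally show ?thesis using Arg2pi[of z] by (intro bexI[of _ "Arg2pi z"]) auto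
qed

text \<open>
Let \<open>z0\<close> be a point outside the circle. The preimage of the disc of radius \<open>norm (f z0)\<close> is
connected and contains both \<open>0\<close> and \<open>z0\<close>, so it meets the circle.
\<close>

lemma homeo_min_principle:
  assumes hom: "homeomorphism UNIV UNIV f g" and f0: "f 0 = 0" and W: "\<And>w. exp (W w) = f (exp w)"
    and s: "s \<le> s0"
  shows "\<exists>\<theta>\<in>{0..2*pi}. Re (W (log_point (s, \<theta>))) \<le> Re (W (log_point (s0, \<theta>0)))"
proof -
  have c: "continuous_on UNIV g" and gf: "\<And>x. g (f x) = x" and fg: "\<And>x. f (g x) = x"
    using hom by (auto simp: homeomorphism_def)
  have nf: "norm (f (exp (log_point (s, \<theta>)))) = exp (Re (W (log_point (s, \<theta>))))" for s \<theta> by (simp flip: W)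
  have ne: "norm (exp (log_point (s, \<theta>))) = exp s" for s \<theta> by (simp add: log_point_def)
  define z0 where "z0 = exp (log_point (s0, \<theta>0))"
  define A where "A = (\<lambda>y. norm (g y)) ` cball 0 (norm (f z0))"
  have "connected A" unfolding A_def
    by (intro connected_continuous_image continuous_on_norm continuous_on_subset[OF c]) auto
  moreover have "0 \<in> A" unfolding A_def using gf[of 0] f0 by (intro image_eqI[of _ _ 0]) auto
  moreover have "exp s0 \<in> A" unfolding A_def by (intro image_eqI[of _ _ "f z0"]) (auto simp: gf z0_def ne)
  moreover have "0 \<le> exp s" "exp s \<le> exp s0" using s by auto
  ultimately have "exp s \<in> A" by (meson connected_contains_Icc atLeastAtMost_iff subsetD)
  then obtain y where y: "y \<in> cball 0 (norm (f z0))" "exp s = norm (g y)" unfolding A_def by auto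
  have "g y \<noteq> 0" using y(2) by (metis exp_not_eq_zero norm_zero)
  then obtain \<theta> where \<theta>: "\<theta> \<in> {0..2*pi}" "g y = exp (log_point (s, \<theta>))" using exp_log_point_surj[of "g y"] y(2) by (metis ln_exp)
  have "norm (f (exp (log_point (s, \<theta>)))) \<le> norm (f z0)" using y(1) fg[of y] \<theta>(2) by simp
  then have "Re (W (log_point (s, \<theta>))) \<le> Re (W (log_point (s0, \<theta>0)))" by (simp add: nf z0_def)
  with \<theta>(1) show ?thesis by blast
qed

text \<open>
Let \<open>\<phi> w = Im (W w) - exp (- Re (W w) / b)\<close>. By \<open>exp_in_spiral_iff\<close>, \<open>\<phi>\<close> takes values in the multiples of
\<open>2 * pi\<close> exactly on the lifted spiral. Hence it is constant, \<open>2 * pi * j\<close>, along the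
graph \<open>\<theta> = exp (- s / a)\<close>, and in the channel above that graph it cannot deviate from this value
by more than \<open>2 * pi\<close>. Together with the periodicity this determines the argument of \<open>f\<close> from its modulus, up to a
bounded error; at \<open>s = 0\<close> the argument is \<open>k * \<theta>\<close> up to a bounded error. The sign of \<open>k\<close>
does no harm: it only enters through \<open>\<bar>\<theta>\<bar>\<close>.
\<close>

lemma spiral_rotation:
  assumes ab: "a > 0" "b > 0" and im: "f ` spiral a = spiral b" and inj: "inj f"
    and W: "continuous_on UNIV W" "\<And>w. exp (W w) = f (exp w)" and k: "k = 1 \<or> k = (-1::int)"
    and per: "\<And>w n. W (w + \<i> * of_real (2 * pi * of_int n)) = W w + \<i> * of_real (2 * pi * of_int (k * n))"
  obtains C where "\<And>s \<theta>. s \<le> 0 \<Longrightarrow>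
    Im (W (log_point (s, \<theta>))) - Im (W (log_point (0, \<theta>))) \<ge> exp (- Re (W (log_point (s, \<theta>))) / b) - exp (- s / a) - C"
proof -
  define \<phi> where "\<phi> w = Im (W w) - exp (- Re (W w) / b)" for w
  have \<phi>c: "continuous_on UNIV \<phi>" unfolding \<phi>_def using ab by (intro continuous_intros W(1)) auto
  have iff: "(\<exists>n::int. Im w - exp (- Re w / a) = 2 * pi * of_int n) \<longleftrightarrow> (\<exists>n::int. \<phi> w = 2 * pi * of_int n)" for w
  proof -
    have "(\<exists>n::int. Im w - exp (- Re w / a) = 2 * pi * of_int n) \<longleftrightarrow> exp w \<in> spiral a"
      using exp_in_spiral_iff[OF ab(1)] by simp
    also have "\<dots> \<longleftrightarrow> f (exp w) \<in> spiral b" using im inj by (metis image_iff inj_eq)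
    also have "\<dots> \<longleftrightarrow> (\<exists>n::int. \<phi> w = 2 * pi * of_int n)"
      unfolding W(2)[symmetric] exp_in_spiral_iff[OF ab(2)] \<phi>_def ..
    finally show ?thesis .
  qed
  have ReL: "Re (log_point (s, \<theta>)) = s" and ImL: "Im (log_point (s, \<theta>)) = \<theta>" for s \<theta> by (simp_all add: log_point_def)
  define \<xi> where "\<xi> s = \<phi> (log_point (s, exp (- s / a))) / (2 * pi)" for s
  have \<xi>c: "continuous_on UNIV \<xi>"
    unfolding \<xi>_def log_point_def fst_conv snd_conv using ab by (intro continuous_intros continuous_on_compose2[OF \<phi>c]) auto
  have \<xi>Z: "\<xi> s \<in> \<int>" for s
  proof -
    have "\<exists>n::int. \<phi> (log_point (s, exp (- s / a))) = 2 * pi * of_int n"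
      unfolding iff[symmetric] ReL ImL by (intro exI[of _ 0]) simp
    then show ?thesis by (auto simp: \<xi>_def)
  qed
  obtain j :: int where j: "\<xi> 0 = of_int j" using \<xi>Z[of 0] by (auto elim: Ints_cases)
  have curve: "\<phi> (log_point (s, exp (- s / a))) = 2 * pi * of_int j" for s
  proof -
    have "\<xi> s = \<xi> 0" using int_valued_constant[OF connected_UNIV \<xi>c \<xi>Z] by simp
    with j show ?thesis by (simp add: \<xi>_def field_simps)
  qed
  (* The intermediate value theorem along the vertical segment from the graph to the point. *)
  have strip: "\<bar>\<phi> (log_point (s, \<theta>)) - 2 * pi * of_int j\<bar> \<le> 2 * pi"
    if \<theta>: "exp (- s / a) \<le> \<theta>" "\<theta> \<le> exp (- s / a) + 2 * pi" for s \<theta>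
  proof (rule ccontr)
    assume big: "\<not> \<bar>\<phi> (log_point (s, \<theta>)) - 2 * pi * of_int j\<bar> \<le> 2 * pi"
    define e where "e = exp (- s / a)"
    have cont: "continuous_on {e..\<theta>} (\<lambda>t. \<phi> (log_point (s, t)))"
      unfolding log_point_def fst_conv snd_conv by (intro continuous_intros continuous_on_compose2[OF \<phi>c]) auto
    have "\<exists>t j'. e \<le> t \<and> t \<le> \<theta> \<and> \<phi> (log_point (s, t)) = 2 * pi * of_int j' \<and> (j' = j + 1 \<or> j' = j - 1)"
    proof (cases "\<phi> (log_point (s, \<theta>)) > 2 * pi * of_int j")
      case True
      then have "2 * pi * of_int (j + 1) \<le> \<phi> (log_point (s, \<theta>))" using big by (simp add: algebra_simps abs_if split: if_splits)
      moreover have "\<phi> (log_point (s, e)) \<le> 2 * pi * of_int (j + 1)" using curve[of s] by (simp add: e_def algebra_simps)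
      ultimately obtain t where "e \<le> t" "t \<le> \<theta>" "\<phi> (log_point (s, t)) = 2 * pi * of_int (j + 1)"
        using IVT'[of "\<lambda>t. \<phi> (log_point (s, t))" e _ \<theta>] \<theta> cont by (auto simp: e_def)
      then show ?thesis by blast
    next
      case False
      then have "\<phi> (log_point (s, \<theta>)) \<le> 2 * pi * of_int (j - 1)" using big by (simp add: algebra_simps abs_if split: if_splits)
      moreover have "2 * pi * of_int (j - 1) \<le> \<phi> (log_point (s, e))" using curve[of s] by (simp add: e_def algebra_simps)
      ultimately obtain t where "e \<le> t" "t \<le> \<theta>" "\<phi> (log_point (s, t)) = 2 * pi * of_int (j - 1)"
        using IVT2'[of "\<lambda>t. \<phi> (log_point (s, t))" \<theta> _ e] \<theta> cont by (auto simp: e_def)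
      then show ?thesis by blast
    qed
    then obtain t j' where t: "e \<le> t" "t \<le> \<theta>" "\<phi> (log_point (s, t)) = 2 * pi * of_int j'" "j' = j + 1 \<or> j' = j - 1" by blast
    have "t \<noteq> e" using t(3,4) curve[of s] by (auto simp: e_def)
    moreover have "t \<noteq> \<theta>"
    proof
      assume "t = \<theta>"
      then have "\<bar>\<phi> (log_point (s, \<theta>)) - 2 * pi * of_int j\<bar> = 2 * pi" using t(3,4) by (auto simp: algebra_simps)
      with big show False by simp
    qed
    ultimately have t': "e < t" "t < e + 2 * pi" using t(1,2) \<theta> by (auto simp: e_def)
    obtain n :: int where n: "t - e = 2 * pi * of_int n"
      using iff[of "log_point (s, t)"] t(3) unfolding ReL ImL e_def by blast
    have "0 < 2 * pi * of_int n" "2 * pi * of_int n < 2 * pi * 1" using t' n by linarith+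
    then have "0 < (of_int n :: real)" "(of_int n :: real) < 1"
      by (simp_all add: zero_less_mult_iff)
    then show False by simp
  qed
  have "bounded ((\<lambda>\<theta>. Im (W (log_point (0, \<theta>)))) ` {0..2*pi})"
    unfolding log_point_def fst_conv snd_conv
    by (intro compact_imp_bounded compact_continuous_image continuous_intros continuous_on_compose2[OF W(1)]) auto
  then obtain C0 where C0: "\<And>\<theta>. \<theta> \<in> {0..2*pi} \<Longrightarrow> \<bar>Im (W (log_point (0, \<theta>)))\<bar> \<le> C0"
    unfolding bounded_iff by (metis (no_types, lifting) imageI real_norm_def)
  have LLper: "log_point (s, \<theta> + 2 * pi * of_int n) = log_point (s, \<theta>) + \<i> * of_real (2 * pi * of_int n)" for s \<theta> and n :: int
    by (simp add: log_point_def algebra_simps)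
  have shift: "W (log_point (s, \<theta> + 2 * pi * of_int n)) = W (log_point (s, \<theta>)) + \<i> * of_real (2 * pi * of_int (k * n))" for s \<theta> and n :: int
    unfolding LLper per ..
  have reduce: "\<exists>n::int. x \<le> \<theta> + 2 * pi * of_int n \<and> \<theta> + 2 * pi * of_int n \<le> x + 2 * pi" for x \<theta>
  proof -
    define n where "n = \<lceil>(x - \<theta>) / (2 * pi)\<rceil>"
    have "(x - \<theta>) / (2 * pi) \<le> of_int n" "of_int n \<le> (x - \<theta>) / (2 * pi) + 1"
      unfolding n_def by linarith+
    then have "x - \<theta> \<le> of_int n * (2 * pi)" "of_int n * (2 * pi) \<le> x - \<theta> + 2 * pi"
      by (simp_all add: field_simps)
    then show ?thesis by (intro exI[of _ n]) (simp add: algebra_simps)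
  qed
  have base: "\<bar>Im (W (log_point (0, \<theta>)))\<bar> \<le> \<bar>\<theta>\<bar> + 2 * pi + C0" for \<theta>
  proof -
    obtain n :: int where n: "0 \<le> \<theta> + 2 * pi * of_int n" "\<theta> + 2 * pi * of_int n \<le> 0 + 2 * pi" using reduce[of 0 \<theta>] by blast
    have "\<bar>Im (W (log_point (0, \<theta> + 2 * pi * of_int n)))\<bar> \<le> C0" using C0 n by simp
    then have "\<bar>Im (W (log_point (0, \<theta>))) + 2 * pi * of_int (k * n)\<bar> \<le> C0" unfolding shift by simp
    moreover have "\<bar>2 * pi * of_int (k * n)\<bar> = \<bar>2 * pi * (of_int n :: real)\<bar>" using k by (auto simp: abs_mult)
    moreover have "\<bar>2 * pi * (of_int n :: real)\<bar> \<le> \<bar>\<theta>\<bar> + 2 * pi" using n by linarith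
    ultimately show ?thesis by linarith
  qed
  show ?thesis
  proof (rule that[of "2 * pi * \<bar>of_int j\<bar> + 6 * pi + C0"])
    fix s \<theta> :: real assume s: "s \<le> 0"
    obtain n :: int where n: "exp (- s / a) \<le> \<theta> + 2 * pi * of_int n" "\<theta> + 2 * pi * of_int n \<le> exp (- s / a) + 2 * pi"
      using reduce by blast
    define \<theta>' where "\<theta>' = \<theta> + 2 * pi * of_int n"
    have n': "exp (- s / a) \<le> \<theta>'" "\<theta>' \<le> exp (- s / a) + 2 * pi" using n by (simp_all add: \<theta>'_def)
    have "Im (W (log_point (s, \<theta>'))) \<ge> exp (- Re (W (log_point (s, \<theta>'))) / b) + 2 * pi * of_int j - 2 * pi"
      using strip[OF n'] unfolding \<phi>_def by linarith
    moreover have "\<bar>\<theta>'\<bar> \<le> exp (- s / a) + 2 * pi" using n' exp_gt_zero[of "- s / a"] by linarith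
    moreover note base[of \<theta>']
    moreover have "\<bar>2 * pi * of_int j\<bar> = 2 * pi * \<bar>of_int j :: real\<bar>" by (simp add: abs_mult)
    ultimately have "Im (W (log_point (s, \<theta>'))) - Im (W (log_point (0, \<theta>'))) \<ge>
       exp (- Re (W (log_point (s, \<theta>'))) / b) - exp (- s / a) - (2 * pi * \<bar>of_int j\<bar> + 6 * pi + C0)"
      using pi_gt_zero by linarith
    moreover have "Re (W (log_point (s, \<theta>'))) = Re (W (log_point (s, \<theta>)))" unfolding \<theta>'_def shift by simp
    moreover have "Im (W (log_point (s, \<theta>'))) - Im (W (log_point (0, \<theta>'))) = Im (W (log_point (s, \<theta>))) - Im (W (log_point (0, \<theta>)))"
      unfolding \<theta>'_def shift by simp
    ultimately show "Im (W (log_point (s, \<theta>))) - Im (W (log_point (0, \<theta>))) \<ge>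
       exp (- Re (W (log_point (s, \<theta>))) / b) - exp (- s / a) - (2 * pi * \<bar>of_int j\<bar> + 6 * pi + C0)"
      by simp
  qed
qed

section \<open>The area estimate\<close>

lemma nn_integral_Icc:
  fixes g :: "real \<Rightarrow> real"
  assumes g: "continuous_on {a..b} g" "\<And>x. x \<in> {a..b} \<Longrightarrow> 0 \<le> g x"
  shows "(\<integral>\<^sup>+x. ennreal (g x) * indicator {a..b} x \<partial>lborel) = ennreal (integral {a..b} g)"
proof -
  have i: "set_integrable lborel {a..b} g"
    unfolding set_integrable_def by (intro borel_integrable_compact g) auto
  have "(\<integral>\<^sup>+x. ennreal (g x) * indicator {a..b} x \<partial>lborel) = (\<integral>\<^sup>+x. ennreal (indicator {a..b} x *\<^sub>R g x) \<partial>lborel)"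
    by (intro nn_integral_cong) (auto simp: indicator_def)
  also have "\<dots> = ennreal (LINT x:{a..b}|lborel. g x)"
    unfolding set_lebesgue_integral_def using i g(2)
    by (intro nn_integral_eq_integral) (auto simp: set_integrable_def indicator_def)
  also have "(LINT x:{a..b}|lborel. g x) = integral {a..b} g"
    by (rule set_borel_integral_eq_integral(2)[OF i])
  finally show ?thesis .
qed

lemma exp_box_integral_le:
  fixes g :: "complex \<Rightarrow> real"
  assumes g: "continuous_on UNIV g" "\<And>z. 0 \<le> g z" and s: "s0 < s1" and e: "0 \<le> e"
    and le: "(\<integral>\<^sup>+z. ennreal (g z) * indicator (cball 0 (exp s1)) z \<partial>lborel) \<le> ennreal e"
  shows "integral (Box s0 s1) (\<lambda>x. g (exp_polar x) * exp (2 * fst x)) \<le> 5 * e"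
proof -
  let ?c = "\<lambda>x. g (exp_polar x) * exp (2 * fst x)"
  have c: "continuous_on (Box s0 s1) ?c"
    by (intro continuous_intros continuous_on_compose2[OF g(1) continuous_exp_polar]) auto
  have c': "continuous_on (cbox (0, s0) (2 * pi, s1)) (\<lambda>y. ?c (snd y, fst y))"
    by (intro continuous_intros continuous_on_compose2[OF g(1)] continuous_on_compose2[OF continuous_exp_polar[of UNIV]]) auto
  have swap: "integral (Box s0 s1) ?c = integral {0..2*pi} (\<lambda>t. integral {s0..s1} (\<lambda>s. ?c (s, t)))"
    using integral_prod_continuous[OF c] integral_swap_continuous[of s0 0 s1 "2*pi" "\<lambda>s t. ?c (s, t)"] c
    by (simp add: split_beta)
  have nn: "0 \<le> ?c x" for x using g(2) by simp
  define G where "G z = ennreal (g z) * indicator (cball 0 (exp s1)) z" for z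
  have gm: "g \<in> borel_measurable borel" using g(1) by (rule borel_measurable_continuous_onI)
  have [measurable]: "cball (0::complex) (exp s1) \<in> sets borel" by simp
  have Gm: "G \<in> borel_measurable borel" unfolding G_def using gm by measurable
  have inner: "(\<integral>\<^sup>+s. G (exp (Complex s t)) * ennreal (exp (2 * s)) * indicator {s0..s1} s \<partial>lborel)
     = ennreal (integral {s0..s1} (\<lambda>s. ?c (s, t)))" if t: "t \<in> {0..2*pi}" for t
  proof -
    have "(\<integral>\<^sup>+s. G (exp (Complex s t)) * ennreal (exp (2 * s)) * indicator {s0..s1} s \<partial>lborel)
      = (\<integral>\<^sup>+s. ennreal (?c (s, t)) * indicator {s0..s1} s \<partial>lborel)"
    proof (intro nn_integral_cong)
      fix s :: real
      have "exp (Complex s t) = exp_polar (s, t)" by (simp add: exp_polar_def Complex_eq)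
      moreover have "exp_polar (s, t) \<in> cball 0 (exp s1)" if "s \<le> s1" using that by (simp add: norm_exp_polar)
      ultimately show "G (exp (Complex s t)) * ennreal (exp (2 * s)) * indicator {s0..s1} s = ennreal (?c (s, t)) * indicator {s0..s1} s"
        by (cases "s \<in> {s0..s1}") (auto simp: G_def ennreal_mult g(2))
    qed
    also have "\<dots> = ennreal (integral {s0..s1} (\<lambda>s. ?c (s, t)))"
      by (rule nn_integral_Icc) (use continuous_on_section(1)[OF c t] nn in auto)
    finally show ?thesis .
  qed
  have oc: "continuous_on {0..2*pi} (\<lambda>t. integral {s0..s1} (\<lambda>s. ?c (s, t)))"
  proof -
    have "continuous_on {0..2*pi} (\<lambda>t. integral (cbox s0 s1) (\<lambda>s. ?c (s, t)))"
      by (rule integral_continuous_on_param) (use c' in \<open>simp add: cbox_Pair_eq split_beta\<close>)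
    then show ?thesis by simp
  qed
  have "ennreal (integral (Box s0 s1) ?c) = (\<integral>\<^sup>+t. ennreal (integral {s0..s1} (\<lambda>s. ?c (s, t))) * indicator {0..2*pi} t \<partial>lborel)"
    unfolding swap
  proof (rule nn_integral_Icc[symmetric, OF oc])
    fix t :: real assume "t \<in> {0..2*pi}"
    then show "0 \<le> integral {s0..s1} (\<lambda>s. ?c (s, t))"
      using nn by (intro integral_nonneg integrable_continuous_real continuous_on_section(1)[OF c]) auto
  qed
  also have "\<dots> = (\<integral>\<^sup>+t. (\<integral>\<^sup>+s. G (exp (Complex s t)) * ennreal (exp (2 * s)) * indicator {s0..s1} s \<partial>lborel) * indicator {0..2*pi} t \<partial>lborel)"
  proof (intro nn_integral_cong)
    fix t :: real
    show "ennreal (integral {s0..s1} (\<lambda>s. ?c (s, t))) * indicator {0..2*pi} t =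
      (\<integral>\<^sup>+s. G (exp (Complex s t)) * ennreal (exp (2 * s)) * indicator {s0..s1} s \<partial>lborel) * indicator {0..2*pi} t"
      using inner[of t] by (cases "t \<in> {0..2*pi}") simp_all
  qed
  also have "\<dots> \<le> 5 * (\<integral>\<^sup>+z. G z \<partial>lborel)" by (rule exp_box_le[OF Gm s])
  also have "\<dots> \<le> 5 * ennreal e" unfolding G_def by (rule mult_left_mono[OF le]) simp
  also have "\<dots> = ennreal (5 * e)" using e by (simp add: ennreal_mult)
  finally show ?thesis using e by simp
qed

text \<open>
For an image point \<open>F\<close>, here \<open>m\<close> and \<open>n\<close> are the Wirtinger derivatives in logarithmic coordinates
before the division by \<open>F\<close>, and \<open>Im (cnj P * Q)\<close> is the Jacobian.
\<close>

lemma distortion_pointwise: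
  fixes m n F :: complex
  assumes P: "P = (m + n) / F" and Q: "Q = \<i> * (m - n) / F" and F: "F \<noteq> 0"
  shows "Im (cnj P * Q) = ((norm m)\<^sup>2 - (norm n)\<^sup>2) / (norm F)\<^sup>2"
    "(norm P)\<^sup>2 \<le> (norm m + norm n)\<^sup>2 / (norm F)\<^sup>2" "(norm Q)\<^sup>2 \<le> (norm m + norm n)\<^sup>2 / (norm F)\<^sup>2"
proof -
  have "cnj P * Q = (cnj (m + n) * (\<i> * (m - n))) / (cnj F * F)" by (simp add: P Q)
  also have "cnj F * F = of_real ((norm F)\<^sup>2)" by (metis complex_norm_square mult.commute)
  finally have "Im (cnj P * Q) = Im (cnj (m + n) * (\<i> * (m - n))) / (norm F)\<^sup>2"
    by (simp only: Im_divide_of_real)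
  also have "Im (cnj (m + n) * (\<i> * (m - n))) = (norm m)\<^sup>2 - (norm n)\<^sup>2"
    unfolding cmod_power2 by (simp add: power2_eq_square algebra_simps)
  finally show "Im (cnj P * Q) = ((norm m)\<^sup>2 - (norm n)\<^sup>2) / (norm F)\<^sup>2" .
  show "(norm P)\<^sup>2 \<le> (norm m + norm n)\<^sup>2 / (norm F)\<^sup>2"
    unfolding P by (simp add: norm_divide power_divide divide_right_mono power_mono norm_triangle_ineq)
  show "(norm Q)\<^sup>2 \<le> (norm m + norm n)\<^sup>2 / (norm F)\<^sup>2"
    unfolding Q by (simp add: norm_divide norm_mult power_divide divide_right_mono power_mono norm_triangle_ineq4)
qed

lemma continuous_defect:
  "continuous_on A p \<Longrightarrow> continuous_on A q \<Longrightarrow> continuous_on A (\<lambda>z. defect K (p z) (q z))"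
  unfolding defect_def dz_def dzb_def by (intro continuous_intros) auto

lemma primitive_const:
  assumes H: "\<And>x. (H has_real_derivative h x) (at x)" and h: "\<And>x. x \<notin> {x0..x1} \<Longrightarrow> h x = 0"
  shows "x \<le> x0 \<Longrightarrow> H x = H x0" "x \<ge> x1 \<Longrightarrow> H x = H x1"
proof -
  show "H x = H x0" if "x \<le> x0"
  proof (cases "x = x0")
    case False
    with that have "x < x0" by simp
    from MVT2[OF this, of H h] H obtain z where "z > x" "z < x0" "H x0 - H x = (x0 - x) * h z" by blast
    then show ?thesis using h[of z] by auto
  qed simp
  show "H x = H x1" if "x \<ge> x1"
  proof (cases "x = x1")
    case False
    with that have "x1 < x" by simp
    from MVT2[OF this, of H h] H obtain z where "z > x1" "z < x" "H x - H x1 = (x - x1) * h z" by blast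
    then show ?thesis using h[of z] by auto
  qed simp
qed

text \<open>
The central estimate. A logarithm \<open>V\<close> of the mollified map, close to \<open>W\<close>, is integrated over a longer strip,
whose end circles are mapped outside the support of \<open>h (Re V)\<close>. There \<open>periodic_stokes\<close> evaluates the integral of the
Jacobian, and the defect contributes at most \<open>\<epsilon>\<close>. As \<open>h \<ge> 0\<close>, the strip can be shortened again.
\<close>

lemma smooth_log_approximation:
  fixes f W :: "complex \<Rightarrow> complex" and m :: real
  assumes qc: "quasiconformal_map K UNIV UNIV f"
    and W: "continuous_on UNIV W" "\<And>w. exp (W w) = f (exp w)"
    and per: "\<And>w. W (w + \<i> * of_real (2 * pi)) = W w + \<i> * of_real m"
    and lo: "\<And>x. \<exists>t. \<forall>s\<le>t. \<forall>\<theta>. Re (W (log_point (s, \<theta>))) \<le> x"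
    and hi: "\<And>x. \<exists>t. \<forall>s\<ge>t. \<forall>\<theta>. Re (W (log_point (s, \<theta>))) \<ge> x"
    and H: "\<And>x. (H has_real_derivative h x) (at x)" and hc: "continuous_on UNIV h"
    and h01: "\<And>x. 0 \<le> h x" "\<And>x. h x \<le> 1" and h0: "\<And>x. x \<notin> {x0..x1} \<Longrightarrow> h x = 0" and x01: "x0 \<le> x1"
    and s01: "s0 < s1" and \<epsilon>: "\<epsilon> > 0"
  shows "\<exists>V P Q. continuous_on (Box s0 s1) V \<and> continuous_on (Box s0 s1) P \<and> continuous_on (Box s0 s1) Q \<and>
    (\<forall>s\<in>{s0..s1}. \<forall>\<theta>\<in>{0..2*pi}.
      ((\<lambda>s. V (s, \<theta>)) has_vector_derivative P (s, \<theta>)) (at s within {s0..s1}) \<and>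
      ((\<lambda>\<theta>. V (s, \<theta>)) has_vector_derivative Q (s, \<theta>)) (at \<theta> within {0..2*pi})) \<and>
    (\<forall>x\<in>Box s0 s1. norm (V x - W (log_point x)) \<le> \<epsilon>) \<and>
    (\<forall>s\<in>{s0..s1}. V (s, 2*pi) = V (s, 0) + \<i> * of_real m) \<and>
    integral (Box s0 s1) (\<lambda>x. h (Re (V x)) * (norm (P x))\<^sup>2) \<le> K * \<bar>m\<bar> * (H x1 - H x0) + \<epsilon> \<and>
    integral (Box s0 s1) (\<lambda>x. h (Re (V x)) * (norm (Q x))\<^sup>2) \<le> K * \<bar>m\<bar> * (H x1 - H x0) + \<epsilon>"
proof -
  have K: "K \<ge> 1" and f: "continuous_on UNIV f"
    using qc unfolding quasiconformal_map_def homeomorphism_def by blast+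
  obtain t0 where t0: "\<And>s \<theta>. s \<le> t0 \<Longrightarrow> Re (W (log_point (s, \<theta>))) \<le> x0 - 1" using lo[of "x0 - 1"] by blast
  obtain t1 where t1: "\<And>s \<theta>. s \<ge> t1 \<Longrightarrow> Re (W (log_point (s, \<theta>))) \<ge> x1 + 1" using hi[of "x1 + 1"] by blast
  define u0 u1 where "u0 = min s0 t0" and "u1 = max s1 t1"
  have u: "u0 \<le> s0" "s1 \<le> u1" "u0 < u1" using s01 by (auto simp: u0_def u1_def)
  have sub: "Box s0 s1 \<subseteq> Box u0 u1" using u by (auto simp: cbox_Pair_eq)
  have uend: "Re (W (log_point (u0, \<theta>))) \<le> x0 - 1" "Re (W (log_point (u1, \<theta>))) \<ge> x1 + 1" for \<theta>
    by (rule t0, simp add: u0_def) (rule t1, simp add: u1_def)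
  define \<epsilon>' where "\<epsilon>' = min \<epsilon> 1"
  have \<epsilon>': "\<epsilon>' > 0" "\<epsilon>' \<le> \<epsilon>" "\<epsilon>' \<le> 1" using \<epsilon> by (auto simp: \<epsilon>'_def)
  have cfE: "continuous_on (Box u0 u1) (\<lambda>x. f (exp_polar x))"
    using continuous_on_compose2[OF f continuous_exp_polar] by auto
  have fE: "f (exp_polar x) = exp (W (log_point x))" for x by (simp add: W exp_polar_eq)
  have ne: "Box u0 u1 \<noteq> {}" using u by (auto simp: cbox_Pair_eq)
  obtain xm where xm: "xm \<in> Box u0 u1" "\<And>x. x \<in> Box u0 u1 \<Longrightarrow> norm (f (exp_polar xm)) \<le> norm (f (exp_polar x))"
    using continuous_attains_inf[OF compact_cbox ne continuous_on_norm[OF cfE]] by blast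
  define c where "c = norm (f (exp_polar xm))"
  have c: "c > 0" by (simp add: c_def fE)
  have "isCont Ln 1" by simp
  then obtain \<delta>0 where \<delta>0: "\<delta>0 > 0" "\<And>z. dist z 1 < \<delta>0 \<Longrightarrow> dist (Ln z) (Ln 1) < \<epsilon>'"
    using \<epsilon>'(1) unfolding continuous_at_eps_delta by blast
  define \<delta> where "\<delta> = min \<delta>0 (1 / 2)"
  have \<delta>: "\<delta> > 0" "\<delta> \<le> 1 / 2" and Ln\<delta>: "\<And>z. norm (z - 1) < \<delta> \<Longrightarrow> norm (Ln z) < \<epsilon>'"
    using \<delta>0 by (auto simp: \<delta>_def dist_norm)
  (* The first bound keeps the quotient F / f close to 1 and F at least c / 2. In the second,
     4 / c^2 comes from division by F and 5 from polar coordinates. *)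
  define \<eta> where "\<eta> = min (c * \<delta> / 2) (\<epsilon> * c\<^sup>2 / 20)"
  have \<eta>: "\<eta> > 0" "\<eta> \<le> c * \<delta> / 2" "\<eta> \<le> \<epsilon> * c\<^sup>2 / 20" using c \<delta> \<epsilon> by (auto simp: \<eta>_def)
  obtain F p q r t u where C: "C2_map F p q r t u" and Ff: "\<And>z. z \<in> cball 0 (exp u1) \<Longrightarrow> norm (F z - f z) \<le> \<eta>"
    and def: "(\<integral>\<^sup>+z. ennreal (defect K (p z) (q z)) * indicator (cball 0 (exp u1)) z \<partial>lborel) \<le> ennreal \<eta>"
    using quasiconformal_smooth_approximation[OF qc \<eta>(1), of "exp u1"] by blast
  have Fc: "continuous_on UNIV F" "continuous_on UNIV p" "continuous_on UNIV q" by (rule C2_map_continuous[OF C])+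
  have near: "norm (F (exp_polar x) / f (exp_polar x) - 1) < \<delta>" and Fbig: "norm (F (exp_polar x)) \<ge> c / 2" if x: "x \<in> Box u0 u1" for x
  proof -
    have "exp_polar x \<in> cball 0 (exp u1)" using x by (cases x) (auto simp: norm_exp_polar cbox_Pair_eq)
    note 1 = Ff[OF this]
    have 2: "norm (f (exp_polar x)) \<ge> c" using xm(2)[OF x] by (simp add: c_def)
    then have nz: "f (exp_polar x) \<noteq> 0" using c by auto
    have "norm (F (exp_polar x) / f (exp_polar x) - 1) = norm (F (exp_polar x) - f (exp_polar x)) / norm (f (exp_polar x))"
      using nz by (simp add: norm_divide[symmetric] diff_divide_distrib)
    also have "\<dots> \<le> (c * \<delta> / 2) / c" using 1 2 c \<eta> by (intro frac_le) auto
    also have "\<dots> < \<delta>" using c \<delta> by simp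
    finally show "norm (F (exp_polar x) / f (exp_polar x) - 1) < \<delta>" .
    have "c * \<delta> \<le> c * (1 / 2)" using \<delta>(2) c by (intro mult_left_mono) auto
    moreover have "norm (f (exp_polar x)) - norm (F (exp_polar x)) \<le> norm (F (exp_polar x) - f (exp_polar x))"
      by (metis norm_minus_commute norm_triangle_ineq2)
    ultimately show "norm (F (exp_polar x)) \<ge> c / 2" using 1 2 \<eta>(2) c by linarith
  qed
  have npos: "F (exp_polar x) / f (exp_polar x) \<notin> \<real>\<^sub>\<le>\<^sub>0" if "x \<in> Box u0 u1" for x
  proof
    assume "F (exp_polar x) / f (exp_polar x) \<in> \<real>\<^sub>\<le>\<^sub>0"
    then have "Re (F (exp_polar x) / f (exp_polar x)) \<le> 0" by (auto simp: complex_nonpos_Reals_iff)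
    then have "norm (F (exp_polar x) / f (exp_polar x) - 1) \<ge> 1"
      using abs_Re_le_cmod[of "F (exp_polar x) / f (exp_polar x) - 1"] by simp
    with near[OF that] \<delta> show False by simp
  qed
  define V where "V x = W (log_point x) + Ln (F (exp_polar x) / f (exp_polar x))" for x
  have Vc: "continuous_on (Box u0 u1) V"
    unfolding V_def
  proof (intro continuous_on_add continuous_on_Ln' continuous_on_divide)
    show "continuous_on (Box u0 u1) (\<lambda>x. W (log_point x))" using continuous_on_compose2[OF W(1) continuous_log_point] by auto
    show "continuous_on (Box u0 u1) (\<lambda>x. F (exp_polar x))" using continuous_on_compose2[OF Fc(1) continuous_exp_polar] by auto
    show "\<forall>x\<in>Box u0 u1. f (exp_polar x) \<noteq> 0" by (simp add: fE)
  qed (use cfE npos in auto)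
  have Vexp: "exp (V x) = F (exp_polar x)" if "x \<in> Box u0 u1" for x
  proof -
    have "F (exp_polar x) / f (exp_polar x) \<noteq> 0" using npos[OF that] by auto
    then show ?thesis by (simp add: V_def exp_add fE)
  qed
  have Vnear: "norm (V x - W (log_point x)) \<le> \<epsilon>'" if "x \<in> Box u0 u1" for x
    using Ln\<delta>[OF near[OF that]] by (simp add: V_def)
  have Vper: "V (s, 2*pi) = V (s, 0) + \<i> * of_real m" for s
  proof -
    have "log_point (s, 2*pi) = log_point (s, 0) + \<i> * of_real (2*pi)" by (simp add: log_point_def)
    then show ?thesis using per[of "log_point (s, 0)"] by (simp add: V_def exp_polar_period)
  qed
  obtain P Q D where PQD0: "continuous_on (Box u0 u1) P \<and> continuous_on (Box u0 u1) Q \<and> continuous_on (Box u0 u1) D \<and>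
    (\<forall>x\<in>Box u0 u1. P x = (dz (p (exp_polar x)) (q (exp_polar x)) * exp_polar x + dzb (p (exp_polar x)) (q (exp_polar x)) * cnj (exp_polar x)) / F (exp_polar x)
       \<and> Q x = \<i> * (dz (p (exp_polar x)) (q (exp_polar x)) * exp_polar x - dzb (p (exp_polar x)) (q (exp_polar x)) * cnj (exp_polar x)) / F (exp_polar x)) \<and>
    (\<forall>s\<in>{u0..u1}. P (s, 2*pi) = P (s, 0)) \<and>
    (\<forall>s\<in>{u0..u1}. \<forall>\<theta>\<in>{0..2*pi}.
      ((\<lambda>s. V (s, \<theta>)) has_vector_derivative P (s, \<theta>)) (at s within {u0..u1}) \<and>
      ((\<lambda>\<theta>. V (s, \<theta>)) has_vector_derivative Q (s, \<theta>)) (at \<theta> within {0..2*pi}) \<and>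
      ((\<lambda>\<theta>. P (s, \<theta>)) has_vector_derivative D (s, \<theta>)) (at \<theta> within {0..2*pi}) \<and>
      ((\<lambda>s. Q (s, \<theta>)) has_vector_derivative D (s, \<theta>)) (at s within {u0..u1}))"
  proof -
    show thesis by (rule log_pullback[OF C Vc, THEN exE], erule Vexp, elim exE, rule that)
  qed
  note PQD = PQD0[THEN conjunct1] PQD0[THEN conjunct2, THEN conjunct1] PQD0[THEN conjunct2, THEN conjunct2, THEN conjunct1]
  note eqs = PQD0[THEN conjunct2, THEN conjunct2, THEN conjunct2, THEN conjunct1, rule_format]
  note Pper = PQD0[THEN conjunct2, THEN conjunct2, THEN conjunct2, THEN conjunct2, THEN conjunct1, rule_format]
  note ders = PQD0[THEN conjunct2, THEN conjunct2, THEN conjunct2, THEN conjunct2, THEN conjunct2, rule_format]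
  have stokes: "integral (Box u0 u1) (\<lambda>x. h (Re (V x)) * Im (cnj (P x) * Q x)) = m * (H x1 - H x0)"
  proof (rule periodic_stokes[where D = D])
    fix \<theta> :: real assume \<theta>: "\<theta> \<in> {0..2*pi}"
    have b: "(u0, \<theta>) \<in> Box u0 u1" "(u1, \<theta>) \<in> Box u0 u1" using \<theta> u by (auto simp: cbox_Pair_eq)
    have "Re (V (u0, \<theta>)) \<le> x0"
      using Vnear[OF b(1)] uend(1)[of \<theta>] \<epsilon>'(3) abs_Re_le_cmod[of "V (u0, \<theta>) - W (log_point (u0, \<theta>))"] by simp
    then show "H (Re (V (u0, \<theta>))) = H x0" by (intro primitive_const(1)[OF H]) (use h0 in auto)
    have "Re (V (u1, \<theta>)) \<ge> x1"
      using Vnear[OF b(2)] uend(2)[of \<theta>] \<epsilon>'(3) abs_Re_le_cmod[of "V (u1, \<theta>) - W (log_point (u1, \<theta>))"] by simp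
    then show "H (Re (V (u1, \<theta>))) = H x1" by (intro primitive_const(2)[OF H]) (use h0 in auto)
  next
    show "u0 \<le> u1" using u by simp
    fix s \<theta> :: real
    assume s: "s \<in> {u0..u1}" and \<theta>: "\<theta> \<in> {0..2*pi}"
    note d = ders[OF s \<theta>]
    show "((\<lambda>s. V (s, \<theta>)) has_vector_derivative P (s, \<theta>)) (at s within {u0..u1})" by (rule d[THEN conjunct1])
    show "((\<lambda>\<theta>. V (s, \<theta>)) has_vector_derivative Q (s, \<theta>)) (at \<theta> within {0..2*pi})"
      by (rule d[THEN conjunct2, THEN conjunct1])
    show "((\<lambda>\<theta>. P (s, \<theta>)) has_vector_derivative D (s, \<theta>)) (at \<theta> within {0..2*pi})"
      by (rule d[THEN conjunct2, THEN conjunct2, THEN conjunct1])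
    show "((\<lambda>s. Q (s, \<theta>)) has_vector_derivative D (s, \<theta>)) (at s within {u0..u1})"
      by (rule d[THEN conjunct2, THEN conjunct2, THEN conjunct2])
  qed (rule Vc PQD Vper Pper H hc; assumption?)+
  have hV: "continuous_on (Box u0 u1) (\<lambda>x. h (Re (V x)))"
    by (intro continuous_on_compose2[OF hc] continuous_intros Vc) auto
  let ?d = "\<lambda>x. defect K (p (exp_polar x)) (q (exp_polar x)) * exp (2 * fst x)"
  have dc: "continuous_on (Box u0 u1) ?d"
    by (intro continuous_intros continuous_defect continuous_on_compose2[OF Fc(2) continuous_exp_polar] continuous_on_compose2[OF Fc(3) continuous_exp_polar]) auto
  have dint: "integral (Box u0 u1) ?d \<le> 5 * \<eta>"
    using def \<eta>(1) u(3)
    by (intro exp_box_integral_le continuous_defect Fc) (auto simp: defect_def)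
  have pw: "h (Re (V x)) * (norm (R x))\<^sup>2 \<le> K * (h (Re (V x)) * Im (cnj (P x) * Q x)) + 4 / c\<^sup>2 * ?d x"
    if x: "x \<in> Box u0 u1" and R: "R = P \<or> R = Q" for R x
  proof -
    define \<mu> \<nu> where "\<mu> = dz (p (exp_polar x)) (q (exp_polar x))" and "\<nu> = dzb (p (exp_polar x)) (q (exp_polar x))"
    have nE: "norm (exp_polar x) = exp (fst x)" by (metis norm_exp_polar prod.collapse)
    have nz: "F (exp_polar x) \<noteq> 0" using Fbig[OF x] c by auto
    note PQ = eqs[OF x, folded \<mu>_def \<nu>_def]
    note dp = distortion_pointwise[OF PQ[THEN conjunct1] PQ[THEN conjunct2] nz]
    define Z where "Z = (exp (fst x))\<^sup>2 / (norm (F (exp_polar x)))\<^sup>2"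
    have Z0: "Z \<ge> 0" by (simp add: Z_def)
    have J: "Im (cnj (P x) * Q x) = ((norm \<mu>)\<^sup>2 - (norm \<nu>)\<^sup>2) * Z"
      unfolding dp(1) by (simp add: norm_mult nE power_mult_distrib Z_def algebra_simps diff_divide_distrib)
    have "(norm (R x))\<^sup>2 \<le> (norm \<mu> + norm \<nu>)\<^sup>2 * Z"
    proof -
      have "(norm (\<mu> * exp_polar x) + norm (\<nu> * cnj (exp_polar x)))\<^sup>2 = (norm \<mu> + norm \<nu>)\<^sup>2 * (exp (fst x))\<^sup>2"
        by (simp add: norm_mult nE power_mult_distrib[symmetric] algebra_simps)
      with dp(2,3) R show ?thesis by (auto simp: Z_def)
    qed
    also have "\<dots> \<le> (K * ((norm \<mu>)\<^sup>2 - (norm \<nu>)\<^sup>2) + defect K (p (exp_polar x)) (q (exp_polar x))) * Z"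
      using Z0 unfolding defect_def \<mu>_def[symmetric] \<nu>_def[symmetric] by (intro mult_right_mono) auto
    also have "\<dots> = K * Im (cnj (P x) * Q x) + defect K (p (exp_polar x)) (q (exp_polar x)) * Z"
      by (simp only: J) (simp add: algebra_simps)
    finally have 1: "h (Re (V x)) * (norm (R x))\<^sup>2 \<le> h (Re (V x)) * (K * Im (cnj (P x) * Q x) + defect K (p (exp_polar x)) (q (exp_polar x)) * Z)"
      using h01 by (intro mult_left_mono) auto
    have d0: "0 \<le> defect K (p (exp_polar x)) (q (exp_polar x))" by (simp add: defect_def)
    have "h (Re (V x)) * (defect K (p (exp_polar x)) (q (exp_polar x)) * Z) \<le> 1 * (defect K (p (exp_polar x)) (q (exp_polar x)) * Z)"
      using h01 d0 Z0 by (intro mult_right_mono) auto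
    also have "\<dots> \<le> defect K (p (exp_polar x)) (q (exp_polar x)) * (exp (2 * fst x) * (4 / c\<^sup>2))"
    proof -
      have "Z \<le> (exp (fst x))\<^sup>2 / (c / 2)\<^sup>2"
      proof -
        have "0 < norm (F (exp_polar x))" using nz by simp
        then show ?thesis unfolding Z_def using Fbig[OF x] c by (intro divide_left_mono power_mono mult_pos_pos zero_less_power) auto
      qed
      also have "\<dots> = exp (2 * fst x) * (4 / c\<^sup>2)"
        by (simp add: power_divide exp_double)
      finally show ?thesis unfolding mult_1 by (rule mult_left_mono[OF _ d0])
    qed
    finally have "h (Re (V x)) * (defect K (p (exp_polar x)) (q (exp_polar x)) * Z) \<le> 4 / c\<^sup>2 * ?d x" by (simp add: algebra_simps)
    with 1 show ?thesis by (simp add: algebra_simps)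
  qed
  have est: "integral (Box s0 s1) (\<lambda>x. h (Re (V x)) * (norm (R x))\<^sup>2) \<le> K * \<bar>m\<bar> * (H x1 - H x0) + \<epsilon>"
    if R: "R = P \<or> R = Q" for R
  proof -
    have Rc: "continuous_on (Box u0 u1) (\<lambda>x. h (Re (V x)) * (norm (R x))\<^sup>2)"
      using R PQD by (auto intro!: continuous_intros hV)
    have Jc: "continuous_on (Box u0 u1) (\<lambda>x. h (Re (V x)) * Im (cnj (P x) * Q x))"
      by (intro continuous_intros hV PQD)
    have "integral (Box s0 s1) (\<lambda>x. h (Re (V x)) * (norm (R x))\<^sup>2) \<le> integral (Box u0 u1) (\<lambda>x. h (Re (V x)) * (norm (R x))\<^sup>2)"
      using h01 by (intro integral_subset_le[OF sub] integrable_continuous continuous_on_subset[OF Rc sub] Rc) auto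
    also have "\<dots> \<le> integral (Box u0 u1) (\<lambda>x. K * (h (Re (V x)) * Im (cnj (P x) * Q x)) + 4 / c\<^sup>2 * ?d x)"
      by (intro integral_le integrable_continuous Rc continuous_on_add continuous_on_mult_left Jc dc pw R)
    also have "\<dots> = integral (Box u0 u1) (\<lambda>x. K * (h (Re (V x)) * Im (cnj (P x) * Q x))) + integral (Box u0 u1) (\<lambda>x. 4 / c\<^sup>2 * ?d x)"
      by (intro integral_add integrable_continuous continuous_on_mult_left Jc dc)
    also have "\<dots> = K * (m * (H x1 - H x0)) + 4 / c\<^sup>2 * integral (Box u0 u1) ?d"
      by (simp only: integral_mult_right stokes)
    also have "\<dots> \<le> K * (\<bar>m\<bar> * (H x1 - H x0)) + 4 / c\<^sup>2 * (5 * \<eta>)"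
    proof (intro add_mono mult_left_mono mult_right_mono)
      show "0 \<le> H x1 - H x0"
        using DERIV_nonneg_imp_nondecreasing[OF x01, of H] H h01(1) by fastforce
    qed (use K dint in auto)
    also have "4 / c\<^sup>2 * (5 * \<eta>) \<le> 4 / c\<^sup>2 * (5 * (\<epsilon> * c\<^sup>2 / 20))"
      using \<eta>(3) by (intro mult_left_mono) auto
    also have "\<dots> = \<epsilon>" using c by simp
    finally show ?thesis by (simp add: mult.assoc)
  qed
  show ?thesis
  proof (intro exI conjI ballI)
    fix s \<theta> assume st: "s \<in> {s0..s1}" "\<theta> \<in> {0..2*pi}"
    have s: "s \<in> {u0..u1}" using st u by auto
    show "((\<lambda>s. V (s, \<theta>)) has_vector_derivative P (s, \<theta>)) (at s within {s0..s1})"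
      by (rule has_vector_derivative_within_subset[OF ders[OF s st(2), THEN conjunct1]]) (use u in auto)
    show "((\<lambda>\<theta>. V (s, \<theta>)) has_vector_derivative Q (s, \<theta>)) (at \<theta> within {0..2*pi})"
      using ders[OF s st(2)] by blast
  next
    fix x assume "x \<in> Box s0 s1"
    then show "norm (V x - W (log_point x)) \<le> \<epsilon>" using Vnear[of x] sub \<epsilon>' by fastforce
  qed (use est Vper continuous_on_subset[OF _ sub] Vc PQD in auto)
qed

section \<open>Depth, crossings and rotation\<close>

text \<open>
A continuous cut-off: it equals \<open>1\<close> on \<open>{x0 + 1..x1 - 1}\<close>, and the margins of length \<open>1\<close> absorb the distance
between \<open>V\<close> and \<open>W\<close>.
\<close>

definition hat :: "real \<Rightarrow> real \<Rightarrow> real \<Rightarrow> real" where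
  "hat x0 x1 x = max 0 (min 1 (min (x - x0) (x1 - x)))"

lemma hat_props:
  "continuous_on A (hat x0 x1)" "0 \<le> hat x0 x1 x" "hat x0 x1 x \<le> 1" "x \<notin> {x0..x1} \<Longrightarrow> hat x0 x1 x = 0"
  "x0 + 1 \<le> x \<Longrightarrow> x \<le> x1 - 1 \<Longrightarrow> hat x0 x1 x = 1"
  unfolding hat_def by (auto intro!: continuous_intros)

lemma hat_primitive:
  assumes "x0 + 2 \<le> x1"
  obtains H where "\<And>x. (H has_real_derivative hat x0 x1 x) (at x)" "x1 - x0 - 2 \<le> H x1 - H x0" "H x1 - H x0 \<le> x1 - x0"
proof -
  have "isCont (hat x0 x1) x" for x
    using hat_props(1)[of UNIV x0 x1] by (simp add: continuous_on_eq_continuous_at)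
  then obtain H where H: "\<And>x. (H has_vector_derivative hat x0 x1 x) (at x)"
    using einterval_antiderivative[of "-\<infinity>" "\<infinity>" "hat x0 x1"] by auto
  then have D: "(H has_real_derivative hat x0 x1 x) (at x)" for x
    by (simp add: has_real_derivative_iff_has_vector_derivative)
  have mono: "H x \<le> H y" if "x \<le> y" for x y
    using DERIV_nonneg_imp_nondecreasing[OF that, of H] D hat_props(2) by blast
  have mv: "\<exists>z. x < z \<and> z < y \<and> H y - H x = (y - x) * hat x0 x1 z" if "x < y" for x y
    using MVT2[OF that, of H "hat x0 x1"] D by blast
  have up: "H x1 - H x0 \<le> x1 - x0"
  proof -
    have "x0 < x1" using assms by simp
    from mv[OF this] obtain z where "H x1 - H x0 = (x1 - x0) * hat x0 x1 z" by blast
    also have "\<dots> \<le> (x1 - x0) * 1" using assms hat_props(3) by (intro mult_left_mono) auto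
    finally show ?thesis by simp
  qed
  have lo: "x1 - x0 - 2 \<le> H x1 - H x0"
  proof (cases "x0 + 2 = x1")
    case True
    then show ?thesis using mono[of x0 x1] by simp
  next
    case False
    then have "x0 + 1 < x1 - 1" using assms by simp
    from mv[OF this] obtain z where "x0 + 1 < z" "z < x1 - 1" "H (x1 - 1) - H (x0 + 1) = (x1 - 1 - (x0 + 1)) * hat x0 x1 z" by blast
    then have "H (x1 - 1) - H (x0 + 1) = x1 - x0 - 2" using hat_props(5)[of x0 z x1] by simp
    moreover have "H x0 \<le> H (x0 + 1)" "H (x1 - 1) \<le> H x1" by (auto intro: mono)
    ultimately show ?thesis by linarith
  qed
  show ?thesis using that D up lo by blast
qed

lemma increment_le:
  fixes g :: "real \<Rightarrow> complex"
  assumes xy: "x \<le> y" "{x..y} \<subseteq> {a..b}"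
    and g: "\<And>t. t \<in> {x..y} \<Longrightarrow> (g has_vector_derivative g' t) (at t within {x..y})" "continuous_on {x..y} g'"
    and k: "continuous_on {a..b} k" "\<And>t. t \<in> {a..b} \<Longrightarrow> 0 \<le> k t" "\<And>t. t \<in> {x..y} \<Longrightarrow> norm (g' t) \<le> k t"
  shows "norm (g y - g x) \<le> integral {a..b} k"
proof -
  have i: "(g' has_integral g y - g x) {x..y}"
    using xy(1) g(1) by (intro fundamental_theorem_of_calculus) auto
  have kxy: "k integrable_on {x..y}" "k integrable_on {a..b}"
    by (auto intro!: integrable_continuous_real continuous_on_subset[OF k(1) xy(2)] k(1))
  have "norm (g y - g x) = norm (integral {x..y} g')" using i by (simp add: integral_unique)
  also have "\<dots> \<le> integral {x..y} k"
    using i kxy k(3) by (intro integral_norm_bound_integral) auto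
  also have "\<dots> \<le> integral {a..b} k"
    using kxy k(2) by (intro integral_subset_le[OF xy(2)]) auto
  finally show ?thesis .
qed

lemma Box_integral_const: "s0 \<le> s1 \<Longrightarrow> integral (Box s0 s1) (\<lambda>x. c::real) = (s1 - s0) * (2 * pi) * c"
  by (simp add: content_Pair)

lemma Box_integral_ge_s:
  fixes k :: "real \<times> real \<Rightarrow> real"
  assumes k: "continuous_on (Box s0 s1) k" and s: "s0 \<le> s1"
    and le: "\<And>s. s \<in> {s0..s1} \<Longrightarrow> c \<le> integral {0..2*pi} (\<lambda>\<theta>. k (s, \<theta>))"
  shows "(s1 - s0) * c \<le> integral (Box s0 s1) k"
proof -
  have "(s1 - s0) * c = integral {s0..s1} (\<lambda>s. c)" using s by simp
  also have "\<dots> \<le> integral {s0..s1} (\<lambda>s. integral {0..2*pi} (\<lambda>\<theta>. k (s, \<theta>)))"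
    using integral_integrable_2dim[OF k] le by (intro integral_le) auto
  also have "\<dots> = integral (Box s0 s1) k" using integral_prod_continuous[OF k] by simp
  finally show ?thesis .
qed

lemma Box_integral_ge_t:
  fixes k :: "real \<times> real \<Rightarrow> real"
  assumes k: "continuous_on (Box s0 s1) k" and s: "s0 \<le> s1"
    and le: "\<And>\<theta>. \<theta> \<in> {0..2*pi} \<Longrightarrow> c \<le> integral {s0..s1} (\<lambda>s. k (s, \<theta>))"
  shows "2 * pi * c \<le> integral (Box s0 s1) k"
proof -
  have k': "continuous_on (cbox (0, s0) (2 * pi, s1)) (\<lambda>y. k (snd y, fst y))"
    by (intro continuous_on_compose2[OF k] continuous_intros) (auto simp: cbox_Pair_eq)
  have "2 * pi * c = integral {0..2*pi} (\<lambda>\<theta>. c)" by simp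
  also have "\<dots> \<le> integral {0..2*pi} (\<lambda>\<theta>. integral {s0..s1} (\<lambda>s. k (s, \<theta>)))"
    using integral_integrable_2dim[OF k'] le by (intro integral_le) auto
  also have "\<dots> = integral (Box s0 s1) k"
    using integral_prod_continuous[OF k] integral_swap_continuous[of s0 0 s1 "2*pi" "\<lambda>s t. k (s, t)"] k
    by (simp add: split_beta)
  finally show ?thesis .
qed

text \<open>
What the area estimate provides for one strip and one interval \<open>{x0..x1}\<close> of levels: the smooth
lift \<open>V\<close> with its partial derivatives and the primitive \<open>H\<close> of the cut-off.
\<close>

locale log_approx =
  fixes W :: "complex \<Rightarrow> complex" and K m s0 s1 x0 x1 :: real
    and V P Q :: "real \<times> real \<Rightarrow> complex" and H :: "real \<Rightarrow> real"
  assumes V: "continuous_on (Box s0 s1) V" and P: "continuous_on (Box s0 s1) P" and Q: "continuous_on (Box s0 s1) Q"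
    and Vs: "\<And>s \<theta>. s \<in> {s0..s1} \<Longrightarrow> \<theta> \<in> {0..2*pi} \<Longrightarrow> ((\<lambda>s. V (s, \<theta>)) has_vector_derivative P (s, \<theta>)) (at s within {s0..s1})"
    and Vt: "\<And>s \<theta>. s \<in> {s0..s1} \<Longrightarrow> \<theta> \<in> {0..2*pi} \<Longrightarrow> ((\<lambda>\<theta>. V (s, \<theta>)) has_vector_derivative Q (s, \<theta>)) (at \<theta> within {0..2*pi})"
    and near: "\<And>x. x \<in> Box s0 s1 \<Longrightarrow> norm (V x - W (log_point x)) \<le> 1"
    and Vper: "\<And>s. s \<in> {s0..s1} \<Longrightarrow> V (s, 2*pi) = V (s, 0) + \<i> * of_real m"
    and H: "\<And>x. (H has_real_derivative hat x0 x1 x) (at x)"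
    and Hge: "x1 - x0 - 2 \<le> H x1 - H x0" and Hle: "H x1 - H x0 \<le> x1 - x0"
    and IP: "integral (Box s0 s1) (\<lambda>x. hat x0 x1 (Re (V x)) * (norm (P x))\<^sup>2) \<le> K * (2 * pi) * (H x1 - H x0) + 1"
    and IQ: "integral (Box s0 s1) (\<lambda>x. hat x0 x1 (Re (V x)) * (norm (Q x))\<^sup>2) \<le> K * (2 * pi) * (H x1 - H x0) + 1"
begin

lemma near_Re: "x \<in> Box s0 s1 \<Longrightarrow> \<bar>Re (V x) - Re (W (log_point x))\<bar> \<le> 1"
  using near[of x] abs_Re_le_cmod[of "V x - W (log_point x)"] by simp

lemma near_Im: "x \<in> Box s0 s1 \<Longrightarrow> \<bar>Im (V x) - Im (W (log_point x))\<bar> \<le> 1"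
  using near[of x] abs_Im_le_cmod[of "V x - W (log_point x)"] by simp

end

text \<open>
A lift of a quasiconformal homeomorphism that fixes \<open>0\<close> and \<open>\<infinity>\<close>; the last three assumptions are the topological
facts about it. The number \<open>m\<close> is \<open>2 * pi\<close> or \<open>- 2 * pi\<close>.
\<close>

locale qc_log_lift =
  fixes K :: real and f W :: "complex \<Rightarrow> complex" and m :: real
  assumes qc: "quasiconformal_map K UNIV UNIV f"
    and Wc: "continuous_on UNIV W" and We: "\<And>w. exp (W w) = f (exp w)"
    and per: "\<And>w. W (w + \<i> * of_real (2 * pi)) = W w + \<i> * of_real m" and m: "\<bar>m\<bar> = 2 * pi"
    and lo: "\<And>x. \<exists>t. \<forall>s\<le>t. \<forall>\<theta>. Re (W (log_point (s, \<theta>))) \<le> x"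
    and hi: "\<And>x. \<exists>t. \<forall>s\<ge>t. \<forall>\<theta>. Re (W (log_point (s, \<theta>))) \<ge> x"
    and min_principle: "\<And>s s0 \<theta>0. s \<le> s0 \<Longrightarrow> \<exists>\<theta>\<in>{0..2*pi}. Re (W (log_point (s, \<theta>))) \<le> Re (W (log_point (s0, \<theta>0)))"
begin

lemma K1: "K \<ge> 1" using qc unfolding quasiconformal_map_def by blast

lemma area_estimate:
  assumes x: "x0 + 2 \<le> x1" and s: "s0 < s1"
  shows "\<exists>V P Q H. log_approx W K m s0 s1 x0 x1 V P Q H"
proof -
  obtain H where H: "\<And>x. (H has_real_derivative hat x0 x1 x) (at x)" "x1 - x0 - 2 \<le> H x1 - H x0" "H x1 - H x0 \<le> x1 - x0"
    using hat_primitive[OF x] by blast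
  have x01: "x0 \<le> x1" using x by simp
  have ex: "\<exists>V P Q. continuous_on (Box s0 s1) V \<and> continuous_on (Box s0 s1) P \<and> continuous_on (Box s0 s1) Q \<and>
    (\<forall>s\<in>{s0..s1}. \<forall>\<theta>\<in>{0..2*pi}.
      ((\<lambda>s. V (s, \<theta>)) has_vector_derivative P (s, \<theta>)) (at s within {s0..s1}) \<and>
      ((\<lambda>\<theta>. V (s, \<theta>)) has_vector_derivative Q (s, \<theta>)) (at \<theta> within {0..2*pi})) \<and>
    (\<forall>x\<in>Box s0 s1. norm (V x - W (log_point x)) \<le> 1) \<and>
    (\<forall>s\<in>{s0..s1}. V (s, 2*pi) = V (s, 0) + \<i> * of_real m) \<and>
    integral (Box s0 s1) (\<lambda>x. hat x0 x1 (Re (V x)) * (norm (P x))\<^sup>2) \<le> K * \<bar>m\<bar> * (H x1 - H x0) + 1 \<and>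
    integral (Box s0 s1) (\<lambda>x. hat x0 x1 (Re (V x)) * (norm (Q x))\<^sup>2) \<le> K * \<bar>m\<bar> * (H x1 - H x0) + 1"
    by (rule smooth_log_approximation[OF qc Wc We per lo hi H(1) hat_props(1) hat_props(2) hat_props(3) _ x01 s zero_less_one]) (rule hat_props(4))
  obtain V P Q where VPQ: "continuous_on (Box s0 s1) V \<and> continuous_on (Box s0 s1) P \<and> continuous_on (Box s0 s1) Q \<and>
    (\<forall>s\<in>{s0..s1}. \<forall>\<theta>\<in>{0..2*pi}.
      ((\<lambda>s. V (s, \<theta>)) has_vector_derivative P (s, \<theta>)) (at s within {s0..s1}) \<and>
      ((\<lambda>\<theta>. V (s, \<theta>)) has_vector_derivative Q (s, \<theta>)) (at \<theta> within {0..2*pi})) \<and>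
    (\<forall>x\<in>Box s0 s1. norm (V x - W (log_point x)) \<le> 1) \<and>
    (\<forall>s\<in>{s0..s1}. V (s, 2*pi) = V (s, 0) + \<i> * of_real m) \<and>
    integral (Box s0 s1) (\<lambda>x. hat x0 x1 (Re (V x)) * (norm (P x))\<^sup>2) \<le> K * \<bar>m\<bar> * (H x1 - H x0) + 1 \<and>
    integral (Box s0 s1) (\<lambda>x. hat x0 x1 (Re (V x)) * (norm (Q x))\<^sup>2) \<le> K * \<bar>m\<bar> * (H x1 - H x0) + 1"
  proof -
    from ex show thesis by (elim exE) (rule that)
  qed
  note V1 = VPQ[THEN conjunct1] and V2 = VPQ[THEN conjunct2, THEN conjunct1] and V3 = VPQ[THEN conjunct2, THEN conjunct2, THEN conjunct1]
  note R = VPQ[THEN conjunct2, THEN conjunct2, THEN conjunct2]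
  note D = R[THEN conjunct1, rule_format]
  note N = R[THEN conjunct2, THEN conjunct1, rule_format]
  note R2 = R[THEN conjunct2, THEN conjunct2]
  have "log_approx W K m s0 s1 x0 x1 V P Q H"
  proof (rule log_approx.intro)
    fix s \<theta> :: real assume st: "s \<in> {s0..s1}" "\<theta> \<in> {0..2*pi}"
    show "((\<lambda>s. V (s, \<theta>)) has_vector_derivative P (s, \<theta>)) (at s within {s0..s1})" by (rule D[OF st, THEN conjunct1])
    show "((\<lambda>\<theta>. V (s, \<theta>)) has_vector_derivative Q (s, \<theta>)) (at \<theta> within {0..2*pi})" by (rule D[OF st, THEN conjunct2])
  next
    fix s assume s: "s \<in> {s0..s1}"
    show "V (s, 2*pi) = V (s, 0) + \<i> * of_real m" by (rule R2[THEN conjunct1, rule_format, OF s])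
  next
    fix x assume x: "x \<in> Box s0 s1"
    show "norm (V x - W (log_point x)) \<le> 1" by (rule N[OF x])
  qed (rule V1 V2 V3 H R2[THEN conjunct2, THEN conjunct1, unfolded m] R2[THEN conjunct2, THEN conjunct2, unfolded m])+
  then show ?thesis by blast
qed

lemma Re_lift_bounded_above: obtains C where "C \<ge> 0" "\<And>s \<theta>. s \<le> 0 \<Longrightarrow> Re (W (log_point (s, \<theta>))) \<le> C"
proof -
  have fc: "continuous_on UNIV f" using qc unfolding quasiconformal_map_def homeomorphism_def by blast
  have "bounded (f ` cball 0 1)"
    by (intro compact_imp_bounded compact_continuous_image continuous_on_subset[OF fc]) auto
  then obtain B where B: "\<And>z. z \<in> cball 0 1 \<Longrightarrow> norm (f z) \<le> B" unfolding bounded_iff by blast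
  have "Re (W (log_point (s, \<theta>))) \<le> max 0 (ln B)" if "s \<le> 0" for s \<theta>
  proof -
    have "exp (log_point (s, \<theta>)) \<in> cball 0 1" using that by simp
    from B[OF this] have "exp (Re (W (log_point (s, \<theta>)))) \<le> B" unfolding We[symmetric] by simp
    then have "Re (W (log_point (s, \<theta>))) \<le> ln B" by (metis exp_gt_zero ln_exp ln_le_cancel_iff order_less_le_trans)
    then show ?thesis by simp
  qed
  then show ?thesis using that[of "max 0 (ln B)"] by simp
qed

lemma continuous_Re_lift: "continuous_on A (\<lambda>x. Re (W (log_point x)))"
  by (intro continuous_intros continuous_on_compose2[OF Wc continuous_log_point]) auto

lemma weighted_square_bound: "0 \<le> h \<Longrightarrow> h \<le> 1 \<Longrightarrow> 0 < l \<Longrightarrow> h * q \<le> (l * (h * q\<^sup>2) + 1 / l) / 2" for h q l :: real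
proof -
  assume h: "0 \<le> h" "h \<le> 1" and l: "0 < l"
  have "0 \<le> (l * q - 1)\<^sup>2" by simp
  then have "2 * (l * q) \<le> l * (l * q\<^sup>2) + 1" by (simp add: power2_eq_square algebra_simps)
  then have "l * (2 * q) \<le> l * (l * q\<^sup>2 + 1 / l)" using l by (simp add: algebra_simps)
  then have "2 * q \<le> l * q\<^sup>2 + 1 / l" using l by simp
  then have "h * (2 * q) \<le> h * (l * q\<^sup>2 + 1 / l)" using h by (intro mult_left_mono)
  also have "\<dots> = l * (h * q\<^sup>2) + h * (1 / l)" by (simp add: algebra_simps)
  also have "h * (1 / l) \<le> 1 * (1 / l)" using h l by (intro mult_right_mono) auto
  finally show ?thesis by simp
qed

text \<open>
Cauchy-Schwarz in the form \<open>2 * q \<le> l * q\<^sup>2 + 1 / l\<close>, with a weight \<open>l\<close> that each application optimises.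
\<close>

lemma hat_norm_integral_le:
  assumes V: "continuous_on (Box s0 s1) V" and R: "continuous_on (Box s0 s1) R" and s: "s0 < s1" and l: "l > 0"
    and I: "integral (Box s0 s1) (\<lambda>x. hat x0 x1 (Re (V x)) * (norm (R x))\<^sup>2) \<le> I"
  shows "integral (Box s0 s1) (\<lambda>x. hat x0 x1 (Re (V x)) * norm (R x)) \<le> (l * I + (s1 - s0) * (2 * pi) / l) / 2"
    "continuous_on (Box s0 s1) (\<lambda>x. hat x0 x1 (Re (V x)) * norm (R x))"
proof -
  have hV: "continuous_on (Box s0 s1) (\<lambda>x. hat x0 x1 (Re (V x)))"
    by (intro continuous_on_compose2[OF hat_props(1)[of UNIV]] continuous_intros V) auto
  show c: "continuous_on (Box s0 s1) (\<lambda>x. hat x0 x1 (Re (V x)) * norm (R x))"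
    by (intro continuous_intros hV R)
  have c2: "continuous_on (Box s0 s1) (\<lambda>x. hat x0 x1 (Re (V x)) * (norm (R x))\<^sup>2)"
    by (intro continuous_intros hV R)
  have i2: "(\<lambda>x. hat x0 x1 (Re (V x)) * (norm (R x))\<^sup>2) integrable_on Box s0 s1"
    by (rule integrable_continuous[OF c2])
  have "integral (Box s0 s1) (\<lambda>x. hat x0 x1 (Re (V x)) * norm (R x))
     \<le> integral (Box s0 s1) (\<lambda>x. l / 2 * (hat x0 x1 (Re (V x)) * (norm (R x))\<^sup>2) + 1 / l / 2)"
  proof (rule integral_le)
    show "(\<lambda>x. l / 2 * (hat x0 x1 (Re (V x)) * (norm (R x))\<^sup>2) + 1 / l / 2) integrable_on Box s0 s1"
      by (intro integrable_continuous continuous_on_add continuous_on_mult_left c2 continuous_on_const)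
    fix x
    show "hat x0 x1 (Re (V x)) * norm (R x) \<le> l / 2 * (hat x0 x1 (Re (V x)) * (norm (R x))\<^sup>2) + 1 / l / 2"
      using weighted_square_bound[OF hat_props(2) hat_props(3) l, of x0 x1 "Re (V x)" "norm (R x)"] by simp
  qed (rule integrable_continuous[OF c])
  also have "\<dots> = integral (Box s0 s1) (\<lambda>x. l / 2 * (hat x0 x1 (Re (V x)) * (norm (R x))\<^sup>2)) + integral (Box s0 s1) (\<lambda>x. 1 / l / 2)"
    by (intro integral_add integrable_continuous continuous_on_mult_left c2 continuous_on_const)
  also have "\<dots> = l / 2 * integral (Box s0 s1) (\<lambda>x. hat x0 x1 (Re (V x)) * (norm (R x))\<^sup>2) + (s1 - s0) * (2 * pi) * (1 / l / 2)"
    using s by (simp only: integral_mult_right Box_integral_const less_imp_le)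
  also have "\<dots> \<le> l / 2 * I + (s1 - s0) * (2 * pi) * (1 / l / 2)"
    using I l by (intro add_right_mono mult_left_mono) auto
  also have "\<dots> = (l * I + (s1 - s0) * (2 * pi) / l) / 2" using l by (simp add: field_simps)
  finally show "integral (Box s0 s1) (\<lambda>x. hat x0 x1 (Re (V x)) * norm (R x)) \<le> (l * I + (s1 - s0) * (2 * pi) / l) / 2" .
qed

text \<open>
Let \<open>\<mu>\<close> be the minimum of \<open>Re W\<close> on the strip. Every circle in it has image length at least \<open>2 * pi\<close>, so the
integral of \<open>norm Q\<close> is at least \<open>2 * pi * L\<close>. With weight \<open>1\<close> it is also at most half of
\<open>2 * pi * K * (C - \<mu>) + 2 * pi * L\<close>, up to constants, which gives the sharp factor in \<open>L \<le> K * (C - \<mu>)\<close>.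
\<close>

lemma deep_point:
  obtains C where "\<And>L. L > 0 \<Longrightarrow> \<exists>s \<theta>. - L \<le> s \<and> Re (W (log_point (s, \<theta>))) \<le> C - L / K"
proof -
  obtain C where C: "C \<ge> 0" "\<And>s \<theta>. s \<le> 0 \<Longrightarrow> Re (W (log_point (s, \<theta>))) \<le> C" using Re_lift_bounded_above by blast
  have "\<exists>s \<theta>. - L \<le> s \<and> Re (W (log_point (s, \<theta>))) \<le> (C + 5) - L / K" if L: "L > 0" for L
  proof -
    have ne: "Box (-L) 0 \<noteq> {}" using L by (auto simp: cbox_Pair_eq)
    obtain xm where xm: "xm \<in> Box (-L) 0" "\<And>x. x \<in> Box (-L) 0 \<Longrightarrow> Re (W (log_point xm)) \<le> Re (W (log_point x))"
      using continuous_attains_inf[OF compact_cbox ne continuous_Re_lift] by blast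
    define \<mu> where "\<mu> = Re (W (log_point xm))"
    have xmC: "\<mu> \<le> C" using xm(1) C(2)[of "fst xm" "snd xm"] by (cases xm) (auto simp: \<mu>_def cbox_Pair_eq)
    have x2: "(\<mu> - 2) + 2 \<le> C + 2" and sL: "- L < 0" using xmC L by auto
    obtain V P Q H where "log_approx W K m (-L) 0 (\<mu> - 2) (C + 2) V P Q H" using area_estimate[OF x2 sL] by blast
    then interpret A: log_approx W K m "-L" 0 "\<mu> - 2" "C + 2" V P Q H .
    have one: "hat (\<mu> - 2) (C + 2) (Re (V x)) = 1" if x: "x \<in> Box (-L) 0" for x
    proof (rule hat_props(5))
      note A.near_Re[OF x]
      moreover have "\<mu> \<le> Re (W (log_point x))" using xm(2)[OF x] by (simp add: \<mu>_def)
      moreover have "Re (W (log_point x)) \<le> C" using x C(2)[of "fst x" "snd x"] by (cases x) (auto simp: cbox_Pair_eq)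
      ultimately show "\<mu> - 2 + 1 \<le> Re (V x)" "Re (V x) \<le> C + 2 - 1" by linarith+
    qed
    note le = hat_norm_integral_le[OF A.V A.Q sL zero_less_one A.IQ]
    have "(0 - (-L)) * (2 * pi) \<le> integral (Box (-L) 0) (\<lambda>x. hat (\<mu> - 2) (C + 2) (Re (V x)) * norm (Q x))"
    proof (rule Box_integral_ge_s[OF le(2)])
      fix s assume s: "s \<in> {-L..0}"
      have "norm (V (s, 2*pi) - V (s, 0)) \<le> integral {0..2*pi} (\<lambda>\<theta>. hat (\<mu> - 2) (C + 2) (Re (V (s, \<theta>))) * norm (Q (s, \<theta>)))"
      proof (rule increment_le[where g' = "\<lambda>\<theta>. Q (s, \<theta>)" and g = "\<lambda>\<theta>. V (s, \<theta>)"])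
        show "continuous_on {0..2*pi} (\<lambda>\<theta>. Q (s, \<theta>))" using continuous_on_section(2)[OF A.Q s] .
        show "continuous_on {0..2*pi} (\<lambda>\<theta>. hat (\<mu> - 2) (C + 2) (Re (V (s, \<theta>))) * norm (Q (s, \<theta>)))"
          using continuous_on_section(2)[OF le(2) s] .
        fix \<theta> :: real assume \<theta>: "\<theta> \<in> {0..2*pi}"
        then have "(s, \<theta>) \<in> Box (-L) 0" using s by (auto simp: cbox_Pair_eq)
        then show "norm (Q (s, \<theta>)) \<le> hat (\<mu> - 2) (C + 2) (Re (V (s, \<theta>))) * norm (Q (s, \<theta>))"
          "0 \<le> hat (\<mu> - 2) (C + 2) (Re (V (s, \<theta>))) * norm (Q (s, \<theta>))" using one by auto
      qed (use A.Vt[OF s] in auto)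
      moreover have "norm (V (s, 2*pi) - V (s, 0)) = 2 * pi" using A.Vper[OF s] m by (simp add: norm_mult)
      ultimately show "2 * pi \<le> integral {0..2*pi} (\<lambda>\<theta>. hat (\<mu> - 2) (C + 2) (Re (V (s, \<theta>))) * norm (Q (s, \<theta>)))" by simp
    qed (use L in simp)
    also note le(1)
    finally have "L * (2 * pi) \<le> (K * (2 * pi) * (H (C + 2) - H (\<mu> - 2)) + 1 + L * (2 * pi)) / 2" by simp
    then have "L * (2 * pi) \<le> K * (2 * pi) * (H (C + 2) - H (\<mu> - 2)) + 1" by simp
    also have "\<dots> \<le> K * (2 * pi) * ((C + 2) - (\<mu> - 2)) + K * (2 * pi)"
    proof (intro add_mono mult_left_mono A.Hle)
      show "1 \<le> K * (2 * pi)" using mult_mono[of 1 K 1 "2*pi"] K1 pi_gt3 by simp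
    qed (use K1 in simp)
    also have "\<dots> = K * ((C + 5) - \<mu>) * (2 * pi)" by (simp add: algebra_simps)
    finally have "L \<le> K * ((C + 5) - \<mu>)" by simp
    then have "L / K \<le> (C + 5) - \<mu>" using K1 by (simp add: field_simps)
    then have "Re (W (log_point (fst xm, snd xm))) \<le> (C + 5) - L / K" by (simp add: \<mu>_def)
    moreover have "- L \<le> fst xm" using xm(1) by (cases xm) (auto simp: cbox_Pair_eq)
    ultimately show ?thesis by blast
  qed
  then show ?thesis using that by blast
qed

text \<open>
Each circle crosses all levels between \<open>x0\<close> and \<open>x1\<close>, so that the integral of \<open>hat * norm Q\<close> along it is at least the
increment \<open>I\<close> of \<open>H\<close>. The squared integral is bounded by a multiple of \<open>I\<close> alone, and the weight
\<open>l = 1 / (2 * pi * K)\<close> makes the resulting inequality \<open>2 * I \<le> I + const\<close>.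
\<close>

lemma crossing_bound:
  assumes s: "s0 < s1" and len: "s1 - s0 = 1"
    and x: "x0 + 2 \<le> x1"
    and shallow: "\<And>s. s \<in> {s0..s1} \<Longrightarrow> \<exists>\<theta>\<in>{0..2*pi}. x1 + 1 \<le> Re (W (log_point (s, \<theta>)))"
    and deep: "\<And>s. s \<in> {s0..s1} \<Longrightarrow> \<exists>\<theta>\<in>{0..2*pi}. Re (W (log_point (s, \<theta>))) \<le> x0 - 1"
  shows "x1 - x0 \<le> 4 * pi\<^sup>2 * K + 3"
proof -
  obtain V P Q H where "log_approx W K m s0 s1 x0 x1 V P Q H" using area_estimate[OF x s] by blast
  then interpret A: log_approx W K m s0 s1 x0 x1 V P Q H .
  define l where "l = 1 / (2 * pi * K)"
  have l: "l > 0" using K1 by (simp add: l_def)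
  define I where "I = H x1 - H x0"
  have I0: "I \<ge> 0" using A.Hge x by (simp add: I_def)
  note le = hat_norm_integral_le[OF A.V A.Q s l A.IQ]
  have "(s1 - s0) * I \<le> integral (Box s0 s1) (\<lambda>x. hat x0 x1 (Re (V x)) * norm (Q x))"
  proof (rule Box_integral_ge_s[OF le(2)])
    fix s assume s: "s \<in> {s0..s1}"
    let ?k = "\<lambda>\<theta>. hat x0 x1 (Re (V (s, \<theta>))) * norm (Q (s, \<theta>))"
    obtain \<theta>1 where 1: "\<theta>1 \<in> {0..2*pi}" "x1 + 1 \<le> Re (W (log_point (s, \<theta>1)))" using shallow[OF s] by blast
    obtain \<theta>2 where 2: "\<theta>2 \<in> {0..2*pi}" "Re (W (log_point (s, \<theta>2))) \<le> x0 - 1" using deep[OF s] by blast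
    have b: "(s, \<theta>1) \<in> Box s0 s1" "(s, \<theta>2) \<in> Box s0 s1" using s 1 2 by (auto simp: cbox_Pair_eq)
    have "Re (V (s, \<theta>1)) \<ge> x1" using A.near_Re[OF b(1)] 1(2) by linarith
    then have H1: "H (Re (V (s, \<theta>1))) = H x1" by (intro primitive_const(2)[OF A.H]) (use hat_props(4) in auto)
    have "Re (V (s, \<theta>2)) \<le> x0" using A.near_Re[OF b(2)] 2(2) by linarith
    then have H2: "H (Re (V (s, \<theta>2))) = H x0" by (intro primitive_const(1)[OF A.H]) (use hat_props(4) in auto)
    define g where "g \<theta> = complex_of_real (H (Re (V (s, \<theta>))))" for \<theta>
    define g' where "g' \<theta> = complex_of_real (hat x0 x1 (Re (V (s, \<theta>))) * Re (Q (s, \<theta>)))" for \<theta>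
    have der: "(g has_vector_derivative g' \<theta>) (at \<theta> within {0..2*pi})" if t: "\<theta> \<in> {0..2*pi}" for \<theta>
    proof -
      have "((\<lambda>\<theta>. Re (V (s, \<theta>))) has_real_derivative Re (Q (s, \<theta>))) (at \<theta> within {0..2*pi})"
        unfolding has_real_derivative_iff_has_vector_derivative
        by (rule bounded_linear.has_vector_derivative[OF bounded_linear_Re A.Vt[OF s t]])
      from DERIV_chain2[OF A.H this]
      have "((\<lambda>\<theta>. H (Re (V (s, \<theta>)))) has_vector_derivative hat x0 x1 (Re (V (s, \<theta>))) * Re (Q (s, \<theta>))) (at \<theta> within {0..2*pi})"
        unfolding has_real_derivative_iff_has_vector_derivative .
      then show ?thesis unfolding g_def g'_def
        by (rule bounded_linear.has_vector_derivative[OF bounded_linear_of_real])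
    qed
    have cg: "continuous_on {0..2*pi} g'"
    proof -
      have "continuous_on (Box s0 s1) (\<lambda>x. complex_of_real (hat x0 x1 (Re (V x)) * Re (Q x)))"
        by (intro continuous_intros continuous_on_compose2[OF hat_props(1)[of UNIV]] A.V A.Q) auto
      from continuous_on_section(2)[OF this s] show ?thesis by (simp add: g'_def[abs_def])
    qed
    have ck: "continuous_on {0..2*pi} ?k" by (rule continuous_on_section(2)[OF le(2) s])
    have bound: "norm (g y - g x) \<le> integral {0..2*pi} ?k" if xy: "x \<le> y" "x \<in> {0..2*pi}" "y \<in> {0..2*pi}" for x y
    proof (rule increment_le[where g' = g'])
      show "{x..y} \<subseteq> {0..2*pi}" using xy by auto
      then show "continuous_on {x..y} g'" by (rule continuous_on_subset[OF cg])
      fix t assume t: "t \<in> {x..y}"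
      then have t': "t \<in> {0..2*pi}" using xy by auto
      show "(g has_vector_derivative g' t) (at t within {x..y})"
        by (rule has_vector_derivative_within_subset[OF der[OF t']]) (use xy in auto)
      have "norm (g' t) = hat x0 x1 (Re (V (s, t))) * \<bar>Re (Q (s, t))\<bar>"
        using hat_props(2) unfolding g'_def norm_of_real by (simp add: abs_mult)
      also have "\<dots> \<le> ?k t" using hat_props(2) abs_Re_le_cmod by (intro mult_left_mono)
      finally show "norm (g' t) \<le> ?k t" .
    next
      fix t show "0 \<le> ?k t" using hat_props(2) by simp
    qed (use xy ck in auto)
    have "I = norm (g \<theta>1 - g \<theta>2)" using I0 unfolding g_def H1 H2 I_def by (simp flip: of_real_diff)
    also have "\<dots> \<le> integral {0..2*pi} ?k"
      using bound[of \<theta>1 \<theta>2] bound[of \<theta>2 \<theta>1] 1 2 by (cases "\<theta>1 \<le> \<theta>2") (auto simp: norm_minus_commute)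
    finally show "I \<le> integral {0..2*pi} ?k" .
  qed (use s in simp)
  also note le(1)
  finally have "2 * I \<le> l * (K * (2 * pi) * I + 1) + 2 * pi / l" using len by (simp add: I_def)
  also have "l * (K * (2 * pi) * I + 1) = I + l" using K1 by (simp add: l_def field_simps)
  also have "2 * pi / l = 4 * pi\<^sup>2 * K" using K1 by (simp add: l_def power2_eq_square field_simps)
  finally have "I \<le> l + 4 * pi\<^sup>2 * K" by simp
  moreover have "l \<le> 1"
  proof -
    have "1 \<le> 2 * pi * K" using mult_mono[of 1 "2*pi" 1 K] K1 pi_gt3 by simp
    then show ?thesis unfolding l_def by (subst divide_le_eq_1_pos) linarith+
  qed
  ultimately show ?thesis using A.Hge by (simp add: I_def)
qed

text \<open>
On each radius only the part from \<open>s = 0\<close> down to the first point \<open>\<sigma>\<close> with \<open>Re W = x\<close> is used. There the cut-off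
equals \<open>1\<close>, and the image already turns by \<open>\<Psi> x - \<Phi> \<sigma>\<close>. Stopping at \<open>\<sigma>\<close> is essential, because the area
estimate controls only the levels above \<open>x\<close>.
\<close>

lemma rotation_bound:
  assumes rot: "\<And>s \<theta>. s \<le> 0 \<Longrightarrow> Im (W (log_point (s, \<theta>))) - Im (W (log_point (0, \<theta>))) \<ge> \<Psi> (Re (W (log_point (s, \<theta>)))) - \<Phi> s"
    and \<Phi>: "\<And>s s'. s \<le> s' \<Longrightarrow> \<Phi> s' \<le> \<Phi> s"
    and C: "C \<ge> 0" "\<And>s \<theta>. s \<le> 0 \<Longrightarrow> Re (W (log_point (s, \<theta>))) \<le> C"
    and C2: "\<And>\<theta>. \<theta> \<in> {0..2*pi} \<Longrightarrow> - C2 \<le> Re (W (log_point (0, \<theta>)))"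
    and L: "L > 0" and x: "x \<le> - C2" "x \<le> C"
    and deep: "\<And>\<theta>. \<theta> \<in> {0..2*pi} \<Longrightarrow> Re (W (log_point (-L, \<theta>))) \<le> x"
  shows "2 * pi * (\<Psi> x - \<Phi> (-L) - 2) \<le> (K * (2 * pi) * (C - x + 4) + 1 + L * (2 * pi)) / 2"
proof -
  have x2: "(x - 2) + 2 \<le> C + 2" and sL: "- L < 0" using x C L by auto
  obtain V P Q H where "log_approx W K m (-L) 0 (x - 2) (C + 2) V P Q H" using area_estimate[OF x2 sL] by blast
  then interpret A: log_approx W K m "-L" 0 "x - 2" "C + 2" V P Q H .
  note le = hat_norm_integral_le[OF A.V A.P sL zero_less_one A.IP]
  have "2 * pi * (\<Psi> x - \<Phi> (-L) - 2) \<le> integral (Box (-L) 0) (\<lambda>y. hat (x - 2) (C + 2) (Re (V y)) * norm (P y))"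
  proof (rule Box_integral_ge_t[OF le(2)])
    fix \<theta> :: real assume \<theta>: "\<theta> \<in> {0..2*pi}"
    let ?k = "\<lambda>s. hat (x - 2) (C + 2) (Re (V (s, \<theta>))) * norm (P (s, \<theta>))"
    define r where "r s = Re (W (log_point (s, \<theta>)))" for s
    have rc: "continuous_on A r" for A
      unfolding r_def by (rule continuous_on_compose2[OF continuous_Re_lift[of UNIV]]) (auto intro!: continuous_intros)
    define S where "S = {s \<in> {-L..0}. r s \<le> x}"
    have "S = {-L..0} \<inter> r -` {..x}" by (auto simp: S_def)
    then have "closed S" using continuous_closed_preimage[OF rc[of "{-L..0}"], of "{..x}"] by simp
    moreover have "bounded S" by (rule bounded_subset[of "{-L..0}"]) (auto simp: S_def)
    ultimately have "compact S" by (simp add: compact_eq_bounded_closed)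
    moreover have "-L \<in> S" using deep[OF \<theta>] L by (simp add: S_def r_def)
    ultimately obtain \<sigma> where \<sigma>: "\<sigma> \<in> S" "\<And>s. s \<in> S \<Longrightarrow> s \<le> \<sigma>"
      using compact_attains_sup[of S] by blast
    have \<sigma>1: "-L \<le> \<sigma>" "\<sigma> \<le> 0" "r \<sigma> \<le> x" using \<sigma>(1) by (auto simp: S_def)
    have above: "x < r s" if "\<sigma> < s" "s \<le> 0" for s
      using \<sigma>(2)[of s] that \<sigma>1 by (auto simp: S_def not_le[symmetric])
    have r\<sigma>: "r \<sigma> = x"
    proof (rule ccontr)
      assume "r \<sigma> \<noteq> x"
      with \<sigma>1 have lt: "r \<sigma> < x" by simp
      have "x \<le> r 0" using C2[OF \<theta>] x(1) by (simp add: r_def)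
      then obtain t where t: "\<sigma> \<le> t" "t \<le> 0" "r t = x"
        using IVT'[of r \<sigma> x 0] lt \<sigma>1 rc by auto
      then have "t \<in> S" using \<sigma>1 by (simp add: S_def)
      then have "t = \<sigma>" using \<sigma>(2) t(1) by force
      then show False using t(3) lt by simp
    qed
    have one: "hat (x - 2) (C + 2) (Re (V (s, \<theta>))) = 1" if s: "\<sigma> \<le> s" "s \<le> 0" for s
    proof (rule hat_props(5))
      have "(s, \<theta>) \<in> Box (-L) 0" using s \<sigma>1 \<theta> by (auto simp: cbox_Pair_eq)
      note A.near_Re[OF this]
      moreover have "x \<le> r s" using above[of s] r\<sigma> s by (cases "s = \<sigma>") auto
      moreover have "r s \<le> C" using C(2)[OF s(2)] by (simp add: r_def)
      ultimately show "x - 2 + 1 \<le> Re (V (s, \<theta>))" "Re (V (s, \<theta>)) \<le> C + 2 - 1" unfolding r_def by linarith+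
    qed
    have "norm (V (0, \<theta>) - V (\<sigma>, \<theta>)) \<le> integral {-L..0} ?k"
    proof (rule increment_le[where g' = "\<lambda>s. P (s, \<theta>)" and g = "\<lambda>s. V (s, \<theta>)"])
      show "continuous_on {\<sigma>..0} (\<lambda>s. P (s, \<theta>))"
        by (rule continuous_on_subset[OF continuous_on_section(1)[OF A.P \<theta>]]) (use \<sigma>1 in auto)
      show "continuous_on {-L..0} ?k" by (rule continuous_on_section(1)[OF le(2) \<theta>])
      fix s assume s: "s \<in> {\<sigma>..0}"
      then have "s \<in> {-L..0}" using \<sigma>1 by auto
      show "((\<lambda>s. V (s, \<theta>)) has_vector_derivative P (s, \<theta>)) (at s within {\<sigma>..0})"
        by (rule has_vector_derivative_within_subset[OF A.Vs[OF \<open>s \<in> {-L..0}\<close> \<theta>]]) (use \<sigma>1 in auto)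
      show "norm (P (s, \<theta>)) \<le> ?k s" using one[of s] s by simp
    next
      fix s show "0 \<le> ?k s" using hat_props(2) by simp
    qed (use \<sigma>1 in auto)
    moreover have "\<Psi> x - \<Phi> (-L) - 2 \<le> norm (V (0, \<theta>) - V (\<sigma>, \<theta>))"
    proof -
      have b: "(0, \<theta>) \<in> Box (-L) 0" "(\<sigma>, \<theta>) \<in> Box (-L) 0" using \<sigma>1 \<theta> L by (auto simp: cbox_Pair_eq)
      have "\<Psi> x - \<Phi> \<sigma> \<le> Im (W (log_point (\<sigma>, \<theta>))) - Im (W (log_point (0, \<theta>)))"
        using rot[OF \<sigma>1(2), of \<theta>] r\<sigma> by (simp add: r_def)
      moreover have "\<Phi> \<sigma> \<le> \<Phi> (-L)" using \<Phi> \<sigma>1 by simp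
      moreover note A.near_Im[OF b(1)] A.near_Im[OF b(2)]
      moreover have "\<bar>Im (V (0, \<theta>)) - Im (V (\<sigma>, \<theta>))\<bar> \<le> norm (V (0, \<theta>) - V (\<sigma>, \<theta>))"
        using abs_Im_le_cmod[of "V (0, \<theta>) - V (\<sigma>, \<theta>)"] by simp
      ultimately show ?thesis by linarith
    qed
    ultimately show "\<Psi> x - \<Phi> (-L) - 2 \<le> integral {-L..0} ?k" by linarith
  qed (use L in simp)
  also note le(1)
  also have "1 * (K * (2 * pi) * (H (C + 2) - H (x - 2)) + 1) + (0 - - L) * (2 * pi) / 1
    \<le> K * (2 * pi) * (C - x + 4) + 1 + L * (2 * pi)"
    using mult_left_mono[OF A.Hle, of "K * (2 * pi)"] K1 by (simp add: algebra_simps)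
  finally show ?thesis by simp
qed

end

section \<open>The lower bound for the dilatation\<close>

text \<open>
The gap between two exponential rates beats any linear function; the quadratic Taylor bound suffices.
\<close>

lemma exp_gap:
  fixes L \<gamma> \<delta> :: real
  assumes L: "L \<ge> 0" and \<gamma>: "\<gamma> \<ge> 0" and \<delta>: "\<delta> \<ge> 0"
  shows "(\<delta> * L)\<^sup>2 / 2 \<le> exp ((\<gamma> + \<delta>) * L) - exp (\<gamma> * L)"
proof -
  have 1: "1 \<le> exp (\<gamma> * L)" using mult_nonneg_nonneg[OF \<gamma> L] by simp
  have 2: "(\<delta> * L)\<^sup>2 / 2 \<le> exp (\<delta> * L) - 1"
    using exp_lower_Taylor_quadratic[of "\<delta> * L"] L \<delta> mult_nonneg_nonneg[OF \<delta> L] by linarith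
  have "1 * (exp (\<delta> * L) - 1) \<le> exp (\<gamma> * L) * (exp (\<delta> * L) - 1)"
    using 1 L \<delta> by (intro mult_right_mono) auto
  also have "\<dots> = exp ((\<gamma> + \<delta>) * L) - exp (\<gamma> * L)" by (simp add: algebra_simps exp_add)
  finally show ?thesis using 2 by simp
qed

text \<open>
The three consequences of the area estimate are incompatible when \<open>b / a < \<beta> < 1 / K\<close>.
\<close>

theorem quasiconformal_spiral_lower_bound:
  fixes a b K :: real
  assumes b: "b > 0" and ab: "a > b" and qc: "quasiconformal_map K UNIV UNIV f" and im: "f ` spiral a = spiral b"
  shows "K \<ge> a / b"
proof (rule ccontr)
  assume "\<not> K \<ge> a / b"
  then have Kab: "K < a / b" by simp
  have a: "a > 0" using b ab by simp
  have K1: "K \<ge> 1" using qc unfolding quasiconformal_map_def by blast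
  have lt: "b / a < 1 / K" using Kab a b K1 by (simp add: field_simps)
  define \<beta> where "\<beta> = (b / a + 1 / K) / 2"
  have \<beta>: "b / a < \<beta>" "\<beta> < 1 / K" 
  proof -
    have mean: "x < (x + y) / 2" "(x + y) / 2 < y" if "x < y" for x y :: real using that by simp_all
    show "b / a < \<beta>" "\<beta> < 1 / K" unfolding \<beta>_def by (rule mean[OF lt])+
  qed
  have \<beta>0: "\<beta> > 0" using \<beta>(1) a b by (meson divide_pos_pos less_trans)
  obtain g where hom: "homeomorphism UNIV UNIV f g" using qc unfolding quasiconformal_map_def by blast
  have gf: "g (f x) = x" for x using hom by (simp add: homeomorphism_def)
  have inj: "inj f" by (rule inj_on_inverseI[of _ g]) (rule gf)
  have f0: "f 0 = 0" by (rule spiral_homeo_fixes_zero[OF hom a b im])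
  obtain W and k :: int where W: "continuous_on UNIV W" "\<And>w. exp (W w) = f (exp w)" and k: "k = 1 \<or> k = -1"
    and perk: "\<And>w n. W (w + \<i> * of_real (2 * pi * of_int n)) = W w + \<i> * of_real (2 * pi * of_int (k * n))"
    using homeo_lift_degree[OF hom f0] by blast
  define m where "m = 2 * pi * of_int k"
  interpret qc_log_lift K f W m
  proof
    show "W (w + \<i> * of_real (2 * pi)) = W w + \<i> * of_real m" for w
      using perk[of w 1] by (simp add: m_def)
    show "\<bar>m\<bar> = 2 * pi" using k by (auto simp: m_def)
  qed (rule qc W homeo_log_limits[OF hom f0 W(2)] | erule homeo_min_principle[OF hom f0 W(2)])+
  obtain C where C: "C \<ge> 0" "\<And>s \<theta>. s \<le> 0 \<Longrightarrow> Re (W (log_point (s, \<theta>))) \<le> C" using Re_lift_bounded_above by blast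
  obtain Cr where Cr: "\<And>s \<theta>. s \<le> 0 \<Longrightarrow>
    Im (W (log_point (s, \<theta>))) - Im (W (log_point (0, \<theta>))) \<ge> exp (- Re (W (log_point (s, \<theta>))) / b) - exp (- s / a) - Cr"
    using spiral_rotation[OF a b im inj W k perk] by blast
  have "bounded ((\<lambda>x. Re (W (log_point x))) ` ({0} \<times> {0..2*pi}))"
    by (intro compact_imp_bounded compact_continuous_image continuous_Re_lift compact_Times) auto
  then obtain C2 where "\<forall>x\<in>{0} \<times> {0..2*pi}. \<bar>Re (W (log_point x))\<bar> \<le> C2" unfolding bounded_iff by auto
  then have C2: "- C2 \<le> Re (W (log_point (0, \<theta>)))" if "\<theta> \<in> {0..2*pi}" for \<theta> using that by (force simp: abs_le_iff)
  obtain Cd where Cd: "\<And>L. L > 0 \<Longrightarrow> \<exists>s \<theta>. - L \<le> s \<and> Re (W (log_point (s, \<theta>))) \<le> Cd - L / K"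
    using deep_point by blast
  define \<delta> where "\<delta> = \<beta> / b - 1 / a"
  have \<delta>: "\<delta> > 0" using \<beta>(1) a b by (simp add: \<delta>_def field_simps)
  define A where "A = (K * (2 * pi) * (C + 4) + 1) / 2 + 2 * pi * (\<bar>Cr\<bar> + 2)"
  define B where "B = (K * (2 * pi) * \<beta> + 2 * pi) / 2"
  have AB: "A \<ge> 0" "B \<ge> 0" using K1 C(1) \<beta>0 by (auto simp: A_def B_def)
  (* Beyond L0 the quadratic lower bound pi * (\<delta> * L)^2 of the rotation exceeds the linear area bound
     A + B * L; the second summand puts the level - \<beta> * L below the image of the unit circle. *)
  define L0 where "L0 = 1 + \<bar>C2\<bar> / \<beta> + (A + B) / (pi * \<delta>\<^sup>2)"
  have L0ge: "L0 \<ge> 1" using AB \<beta>0 by (simp add: L0_def)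
  have shallow: "\<exists>\<theta>\<in>{0..2*pi}. - \<beta> * L < Re (W (log_point (-L, \<theta>)))" if L: "L \<ge> L0" for L
  proof (rule ccontr)
    assume "\<not> (\<exists>\<theta>\<in>{0..2*pi}. - \<beta> * L < Re (W (log_point (-L, \<theta>))))"
    then have deep: "\<And>\<theta>. \<theta> \<in> {0..2*pi} \<Longrightarrow> Re (W (log_point (-L, \<theta>))) \<le> - \<beta> * L" by force
    have L1: "L \<ge> 1" using L L0ge by simp
    have "\<bar>C2\<bar> / \<beta> \<le> L"
    proof -
      have "0 \<le> (A + B) / (pi * \<delta>\<^sup>2)" using AB by simp
      then show ?thesis using L unfolding L0_def by linarith
    qed
    then have x1: "- \<beta> * L \<le> - C2" using \<beta>0 by (simp add: field_simps)
    have x2: "- \<beta> * L \<le> C"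
    proof -
      have "0 \<le> \<beta> * L" using \<beta>0 L1 by simp
      then show ?thesis using C(1) by simp
    qed
    have "2 * pi * (exp (- (- \<beta> * L) / b) - (exp (- (-L) / a) + Cr) - 2)
       \<le> (K * (2 * pi) * (C - (- \<beta> * L) + 4) + 1 + L * (2 * pi)) / 2"
    proof (rule rotation_bound[where \<Psi> = "\<lambda>x. exp (- x / b)" and \<Phi> = "\<lambda>s. exp (- s / a) + Cr" and ?C2.0 = C2])
      show "exp (- s' / a) + Cr \<le> exp (- s / a) + Cr" if "s \<le> s'" for s s'
        using that a by (simp add: divide_right_mono)
      show "exp (- Re (W (log_point (s, \<theta>))) / b) - (exp (- s / a) + Cr) \<le> Im (W (log_point (s, \<theta>))) - Im (W (log_point (0, \<theta>)))" if "s \<le> 0" for s \<theta>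
        using Cr[OF that, of \<theta>] by simp
      show "L > 0" using L1 by simp
    qed (use C C2 x1 x2 deep in auto)
    then have r: "2 * pi * (exp (\<beta> * L / b) - exp (L / a) - Cr - 2) \<le> (K * (2 * pi) * (C + \<beta> * L + 4) + 1 + L * (2 * pi)) / 2"
      by (simp add: algebra_simps)
    have e: "\<beta> * L / b = (1 / a + \<delta>) * L" "L / a = 1 / a * L" by (simp_all add: \<delta>_def algebra_simps)
    have "(\<delta> * L)\<^sup>2 / 2 \<le> exp (\<beta> * L / b) - exp (L / a)"
      unfolding e using L1 a \<delta> by (intro exp_gap) auto
    then have "2 * pi * ((\<delta> * L)\<^sup>2 / 2 - \<bar>Cr\<bar> - 2) \<le> 2 * pi * (exp (\<beta> * L / b) - exp (L / a) - Cr - 2)"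
      by (intro mult_left_mono) auto
    with r have "2 * pi * ((\<delta> * L)\<^sup>2 / 2 - \<bar>Cr\<bar> - 2) \<le> (K * (2 * pi) * (C + \<beta> * L + 4) + 1 + L * (2 * pi)) / 2"
      by linarith
    then have "pi * (\<delta> * L)\<^sup>2 \<le> A + B * L" by (simp add: A_def B_def algebra_simps add_divide_distrib)
    also have "\<dots> \<le> A * L + B * L" using AB(1) L1 mult_left_mono[of 1 L A] by simp
    finally have "(pi * \<delta>\<^sup>2 * L) * L \<le> (A + B) * L" by (simp add: power2_eq_square algebra_simps)
    then have "pi * \<delta>\<^sup>2 * L \<le> A + B" using L1 by simp
    then have "L \<le> (A + B) / (pi * \<delta>\<^sup>2)" using \<delta> by (simp add: field_simps)
    moreover have "0 \<le> \<bar>C2\<bar> / \<beta>" using \<beta>0 by simp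
    ultimately show False using L unfolding L0_def by linarith
  qed
  define \<kappa> where "\<kappa> = 1 / K - \<beta>"
  have \<kappa>: "\<kappa> > 0" using \<beta>(2) by (simp add: \<kappa>_def)
  define L where "L = L0 + (4 * pi\<^sup>2 * K + \<beta> + \<bar>Cd\<bar> + 10) / \<kappa>"
  have big0: "0 \<le> (4 * pi\<^sup>2 * K + \<beta> + \<bar>Cd\<bar> + 10) / \<kappa>" using K1 \<beta>0 \<kappa> by simp
  then have LL0: "L \<ge> L0" "L > 0" using L0ge unfolding L_def by linarith+
  have "(4 * pi\<^sup>2 * K + \<beta> + \<bar>Cd\<bar> + 10) / \<kappa> \<le> L" using L0ge unfolding L_def by linarith
  then have big: "4 * pi\<^sup>2 * K + \<beta> + \<bar>Cd\<bar> + 10 \<le> L / K - \<beta> * L" using \<kappa> by (simp add: \<kappa>_def field_simps)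
  define x0 x1 where "x0 = Cd - L / K + 1" and "x1 = - \<beta> * (L + 1) - 1"
  have diff: "x1 - x0 = L / K - \<beta> * L - \<beta> - 2 - Cd" by (simp add: x0_def x1_def algebra_simps)
  have "0 \<le> 4 * pi\<^sup>2 * K" using K1 by simp
  then have x: "x0 + 2 \<le> x1" using diff big by linarith
  have "x1 - x0 \<le> 4 * pi\<^sup>2 * K + 3"
  proof (rule crossing_bound[of "- L - 1" "- L"])
    fix s assume s: "s \<in> {- L - 1..- L}"
    have "- s \<ge> L0" using s LL0 by simp
    from shallow[OF this] obtain \<theta> where \<theta>: "\<theta> \<in> {0..2*pi}" "- \<beta> * - s < Re (W (log_point (s, \<theta>)))" by auto
    have "\<beta> * - s \<le> \<beta> * (L + 1)" using s \<beta>0 by (intro mult_left_mono) auto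
    then have "x1 + 1 \<le> Re (W (log_point (s, \<theta>)))" using \<theta>(2) by (simp add: x1_def)
    with \<theta>(1) show "\<exists>\<theta>\<in>{0..2*pi}. x1 + 1 \<le> Re (W (log_point (s, \<theta>)))" by blast
    obtain s' \<theta>' where s': "- L \<le> s'" "Re (W (log_point (s', \<theta>'))) \<le> Cd - L / K" using Cd[OF LL0(2)] by blast
    have "s \<le> s'" using s s' by simp
    from min_principle[OF this, of \<theta>'] obtain \<theta>2
      where \<theta>2: "\<theta>2 \<in> {0..2*pi}" "Re (W (log_point (s, \<theta>2))) \<le> Re (W (log_point (s', \<theta>')))" by blast
    from \<theta>2(2) s'(2) have "Re (W (log_point (s, \<theta>2))) \<le> x0 - 1" by (simp add: x0_def)
    with \<theta>2(1) show "\<exists>\<theta>\<in>{0..2*pi}. Re (W (log_point (s, \<theta>))) \<le> x0 - 1" by blast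
  qed (use x in auto)
  then show False using diff big by linarith
qed

section \<open>The radial stretch\<close>

text \<open>
The stretch \<open>\<bar>z\<bar> powr (2 * \<gamma>) * z\<close>. Powers of the squared modulus are differentiable along lines with
less effort than powers of the modulus.
\<close>

definition radial :: "real \<Rightarrow> complex \<Rightarrow> complex" where
  "radial \<gamma> z = of_real ((norm z)\<^sup>2 powr \<gamma>) * z"

text \<open>
The derivative of \<open>radial \<gamma>\<close> in direction \<open>e\<close> off the origin; at the origin it is \<open>0\<close>, as
\<open>0 powr \<gamma> = 0\<close>.
\<close>

definition radial_deriv :: "real \<Rightarrow> complex \<Rightarrow> complex \<Rightarrow> complex" where
  "radial_deriv \<gamma> e z = of_real ((norm z)\<^sup>2 powr \<gamma>) * e + of_real (2 * \<gamma> * (z \<bullet> e) * (norm z)\<^sup>2 powr (\<gamma> - 1)) * z"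

lemma radial_0 [simp]: "radial \<gamma> 0 = 0"
  by (simp add: radial_def)

lemma norm_radial: "z \<noteq> 0 \<Longrightarrow> norm (radial \<gamma> z) = norm z powr (2 * \<gamma> + 1)"
proof -
  assume z: "z \<noteq> 0"
  then have "(norm z)\<^sup>2 powr \<gamma> = norm z powr (2 * \<gamma>)" by (simp add: powr_powr flip: powr_numeral)
  with z show ?thesis by (simp add: radial_def norm_mult powr_add)
qed

lemma radial_compose:
  assumes "(2 * \<gamma> + 1) * (2 * \<delta> + 1) = 1"
  shows "radial \<gamma> (radial \<delta> z) = z"
proof (cases "z = 0")
  case False
  have n: "norm (radial \<delta> z) = norm z powr (2 * \<delta> + 1)" by (rule norm_radial[OF False])
  have sq: "x\<^sup>2 powr c = x powr (2 * c)" if "x > 0" for x c :: real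
    using that by (simp add: powr_powr flip: powr_numeral)
  have "(norm (radial \<delta> z))\<^sup>2 powr \<gamma> = norm z powr ((2 * \<delta> + 1) * (2 * \<gamma>))"
    unfolding n using False by (subst sq) (auto simp: powr_powr)
  moreover have "(norm z)\<^sup>2 powr \<delta> = norm z powr (2 * \<delta>)" using False by (intro sq) auto
  ultimately have "radial \<gamma> (radial \<delta> z) = of_real (norm z powr ((2 * \<delta> + 1) * (2 * \<gamma>)) * norm z powr (2 * \<delta>)) * z"
    unfolding radial_def[of \<gamma>] by (simp add: radial_def)
  also have "norm z powr ((2 * \<delta> + 1) * (2 * \<gamma>)) * norm z powr (2 * \<delta>) = norm z powr ((2 * \<delta> + 1) * (2 * \<gamma>) + 2 * \<delta>)"
    by (simp add: powr_add)
  also have "(2 * \<delta> + 1) * (2 * \<gamma>) + 2 * \<delta> = 0" using assms by (simp add: algebra_simps)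
  finally show ?thesis using False by simp
qed simp

lemma continuous_radial:
  assumes "2 * \<gamma> + 1 > 0"
  shows "continuous_on UNIV (radial \<gamma>)"
proof -
  have "isCont (radial \<gamma>) z" for z
  proof (cases "z = 0")
    case True
    have "((\<lambda>z. norm z powr (2 * \<gamma> + 1)) \<longlongrightarrow> 0 powr (2 * \<gamma> + 1)) (at (0::complex))"
      using assms by (intro tendsto_powr2 tendsto_norm_zero tendsto_const) auto
    then have lim: "((\<lambda>z. norm z powr (2 * \<gamma> + 1)) \<longlongrightarrow> 0) (at (0::complex))" using assms by simp
    have "(radial \<gamma> \<longlongrightarrow> 0) (at 0)"
      by (rule Lim_null_comparison[OF _ lim]) (auto simp: eventually_at_filter norm_radial)
    with True show ?thesis by (simp add: isCont_def)
  next
    case False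
    then show ?thesis unfolding radial_def[abs_def] by (intro continuous_intros) auto
  qed
  then show ?thesis by (simp add: continuous_at_imp_continuous_on)
qed

lemma homeomorphism_radial:
  assumes "0 < \<alpha>"
  shows "homeomorphism UNIV UNIV (radial ((\<alpha> - 1) / 2)) (radial ((1 / \<alpha> - 1) / 2))"
proof -
  have c: "continuous_on UNIV (radial ((\<alpha> - 1) / 2))" "continuous_on UNIV (radial ((1 / \<alpha> - 1) / 2))"
  proof -
    have p: "2 * ((\<alpha> - 1) / 2) + 1 > 0" "2 * ((1 / \<alpha> - 1) / 2) + 1 > 0" using assms by (simp_all only: nonzero_mult_div_cancel_left times_divide_eq_right) simp_all
    show "continuous_on UNIV (radial ((\<alpha> - 1) / 2))" by (rule continuous_radial[OF p(1)])
    show "continuous_on UNIV (radial ((1 / \<alpha> - 1) / 2))" by (rule continuous_radial[OF p(2)])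
  qed
  have e: "radial ((\<alpha> - 1) / 2) (radial ((1 / \<alpha> - 1) / 2) z) = z" "radial ((1 / \<alpha> - 1) / 2) (radial ((\<alpha> - 1) / 2) z) = z" for z
    using assms by (auto intro!: radial_compose simp: field_simps)
  show ?thesis
    using c e by (intro homeomorphismI) auto
qed

lemma radial_spiral:
  assumes "a > 0"
  shows "radial ((b / a - 1) / 2) ` spiral a = spiral b"
proof -
  have pt: "radial ((b / a - 1) / 2) (of_real (x powr (- a)) * exp (\<i> * of_real x)) = of_real (x powr (- b)) * exp (\<i> * of_real x)" if x: "x > 0" for x
  proof -
    have "norm (of_real (x powr (- a)) * exp (\<i> * of_real x)) = x powr (- a)" by (simp add: norm_mult)
    then have "radial ((b / a - 1) / 2) (of_real (x powr (- a)) * exp (\<i> * of_real x))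
      = of_real (((x powr (- a))\<^sup>2) powr ((b / a - 1) / 2) * x powr (- a)) * exp (\<i> * of_real x)"
      by (simp add: radial_def)
    also have "((x powr (- a))\<^sup>2) powr ((b / a - 1) / 2) * x powr (- a) = x powr (- b)"
    proof -
      have "((x powr (- a))\<^sup>2) = x powr (- a + - a)" by (simp only: power2_eq_square powr_add)
      then have "((x powr (- a))\<^sup>2) powr ((b / a - 1) / 2) * x powr (- a) = x powr ((- a + - a) * ((b / a - 1) / 2) + - a)"
        by (simp only: powr_powr powr_add[symmetric])
      also have "(- a + - a) * ((b / a - 1) / 2) + - a = - b" using assms by (simp add: field_simps)
      finally show ?thesis .
    qed
    finally show ?thesis .
  qed
  show ?thesis
  proof
    show "radial ((b / a - 1) / 2) ` spiral a \<subseteq> spiral b"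
      using pt unfolding spiral_def by blast
    show "spiral b \<subseteq> radial ((b / a - 1) / 2) ` spiral a"
    proof
      fix z assume "z \<in> spiral b"
      then obtain x :: real where "x > 0" "z = of_real (x powr (- b)) * exp (\<i> * of_real x)" unfolding spiral_def by blast
      then show "z \<in> radial ((b / a - 1) / 2) ` spiral a"
        using pt[of x] by (intro image_eqI[of _ _ "of_real (x powr (- a)) * exp (\<i> * of_real x)"]) (auto simp: spiral_def)
    qed
  qed
qed

text \<open>
With \<open>S = (norm z)\<^sup>2 powr \<gamma>\<close> the Wirtinger derivatives have moduli \<open>S * (1 + \<gamma>)\<close> and \<open>- \<gamma> * S\<close>, so that the square of the operator norm
is \<open>S\<^sup>2\<close> and the Jacobian is \<open>(2 * \<gamma> + 1) * S\<^sup>2\<close>.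
\<close>

lemma radial_distortion:
  assumes \<gamma>: "\<gamma> \<le> 0" "2 * \<gamma> + 1 > 0" and K: "K * (2 * \<gamma> + 1) \<ge> 1"
  shows "(onorm (\<lambda>h. diff_matrix (radial_deriv \<gamma> 1 z) (radial_deriv \<gamma> \<i> z) *v h))\<^sup>2
     \<le> K * det (diff_matrix (radial_deriv \<gamma> 1 z) (radial_deriv \<gamma> \<i> z))"
proof (cases "z = 0")
  case True
  then show ?thesis by (simp add: onorm_diff_matrix det_diff_matrix radial_deriv_def dz_def dzb_def)
next
  case False
  define S where "S = (norm z)\<^sup>2 powr \<gamma>"
  define T where "T = (norm z)\<^sup>2 powr (\<gamma> - 1)"
  have ST: "T * (norm z)\<^sup>2 = S" using False by (simp add: S_def T_def powr_diff)
  have S0: "S > 0" using False by (simp add: S_def)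
  have T0: "T \<ge> 0" by (simp add: T_def)
  have nz2: "z * cnj z = of_real ((norm z)\<^sup>2)" by (simp only: complex_norm_square)
  have fx: "radial_deriv \<gamma> 1 z = of_real S + of_real (2 * \<gamma> * Re z * T) * z"
    and fy: "radial_deriv \<gamma> \<i> z = of_real S * \<i> + of_real (2 * \<gamma> * Im z * T) * z"
    by (simp_all add: radial_deriv_def S_def T_def inner_complex_def)
  have z: "of_real (Re z) - \<i> * of_real (Im z) = cnj z" "of_real (Re z) + \<i> * of_real (Im z) = z"
    by (simp_all add: complex_eq_iff)
  have "dz (radial_deriv \<gamma> 1 z) (radial_deriv \<gamma> \<i> z) = of_real S + of_real (\<gamma> * T) * (z * (of_real (Re z) - \<i> * of_real (Im z)))"
    unfolding dz_def fx fy by (simp add: algebra_simps add_divide_distrib diff_divide_distrib)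
  also have "\<dots> = of_real (S + \<gamma> * (T * (norm z)\<^sup>2))" unfolding z nz2 by simp
  also have "\<dots> = of_real (S * (1 + \<gamma>))" unfolding ST by (simp add: algebra_simps)
  finally have m: "norm (dz (radial_deriv \<gamma> 1 z) (radial_deriv \<gamma> \<i> z)) = S * (1 + \<gamma>)"
    using S0 \<gamma> by (simp only: norm_of_real) (simp add: abs_mult)
  have "dzb (radial_deriv \<gamma> 1 z) (radial_deriv \<gamma> \<i> z) = of_real (\<gamma> * T) * (z * (of_real (Re z) + \<i> * of_real (Im z)))"
    unfolding dzb_def fx fy by (simp add: algebra_simps add_divide_distrib diff_divide_distrib)
  then have "norm (dzb (radial_deriv \<gamma> 1 z) (radial_deriv \<gamma> \<i> z)) = \<bar>\<gamma>\<bar> * (T * (norm z)\<^sup>2)"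
    unfolding z using T0 by (simp add: norm_mult abs_mult power2_eq_square)
  then have n: "norm (dzb (radial_deriv \<gamma> 1 z) (radial_deriv \<gamma> \<i> z)) = - \<gamma> * S"
    unfolding ST using \<gamma> by simp
  have "(onorm (\<lambda>h. diff_matrix (radial_deriv \<gamma> 1 z) (radial_deriv \<gamma> \<i> z) *v h))\<^sup>2 = S\<^sup>2"
    unfolding onorm_diff_matrix m n by (simp add: algebra_simps)
  also have "\<dots> \<le> (K * (2 * \<gamma> + 1)) * S\<^sup>2" using K mult_right_mono[of 1 "K * (2 * \<gamma> + 1)" "S\<^sup>2"] by simp
  also have "\<dots> = K * det (diff_matrix (radial_deriv \<gamma> 1 z) (radial_deriv \<gamma> \<i> z))"
    unfolding det_diff_matrix m n by (simp add: power2_eq_square algebra_simps)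
  finally show ?thesis .
qed

lemma borel_radial_deriv [measurable]: "radial_deriv \<gamma> e \<in> borel_measurable borel"
  unfolding radial_deriv_def[abs_def] by measurable

lemma norm_radial_deriv_le:
  assumes \<gamma>: "\<gamma> \<le> 0" "2 * \<gamma> + 1 > 0" and e: "norm e = 1"
  shows "norm (radial_deriv \<gamma> e z) \<le> 2 * (norm z)\<^sup>2 powr \<gamma>"
proof (cases "z = 0")
  case False
  define S where "S = (norm z)\<^sup>2 powr \<gamma>"
  define T where "T = (norm z)\<^sup>2 powr (\<gamma> - 1)"
  have ST: "T * (norm z)\<^sup>2 = S" using False by (simp add: S_def T_def powr_diff)
  have T0: "T \<ge> 0" "S \<ge> 0" by (simp_all add: T_def S_def)
  have "norm (radial_deriv \<gamma> e z) \<le> norm (of_real S * e) + norm (of_real (2 * \<gamma> * (z \<bullet> e) * T) * z)"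
    unfolding radial_deriv_def S_def T_def by (rule norm_triangle_ineq)
  also have "norm (of_real S * e) = S" using T0 e by (simp add: norm_mult)
  also have "norm (of_real (2 * \<gamma> * (z \<bullet> e) * T) * z) = (2 * (- \<gamma>)) * \<bar>z \<bullet> e\<bar> * (T * norm z)"
    using \<gamma> T0 by (simp add: norm_mult abs_mult)
  also have "\<dots> \<le> 1 * norm z * (T * norm z)"
    using \<gamma> T0 Cauchy_Schwarz_ineq2[of z e] e by (intro mult_mono mult_right_mono) auto
  also have "\<dots> = S" using ST by (simp add: power2_eq_square algebra_simps)
  finally show ?thesis by (simp add: S_def)
qed (simp add: radial_deriv_def)

lemma nn_integral_powr_interval:
  assumes c: "-1 < c" "R > 0"
  shows "(\<integral>\<^sup>+x. ennreal (\<bar>x\<bar> powr c) * indicator {-R..R} x \<partial>lborel) < \<infinity>"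
proof -
  let ?f = "\<lambda>x. ennreal (x powr c) * indicator {0..R} x"
  have fin: "(\<integral>\<^sup>+x. ?f x \<partial>lborel) < \<infinity>"
    using nn_integral_has_integral_lebesgue'[OF _ has_integral_powr_from_0[of c R]] c by simp
  have [measurable]: "?f \<in> borel_measurable borel" by measurable
  have "(\<integral>\<^sup>+x. ennreal (\<bar>x\<bar> powr c) * indicator {-R..R} x \<partial>lborel) \<le> (\<integral>\<^sup>+x. ?f x + ?f (0 - x) \<partial>lborel)"
    by (intro nn_integral_mono) (auto simp: indicator_def abs_if)
  also have "\<dots> = (\<integral>\<^sup>+x. ?f x \<partial>lborel) + (\<integral>\<^sup>+x. ?f (0 - x) \<partial>lborel)"
    by (rule nn_integral_add) measurable
  also have "(\<integral>\<^sup>+x. ?f (0 - x) \<partial>lborel) = (\<integral>\<^sup>+x. ?f x \<partial>lborel)" by (rule nn_integral_reflect) measurable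
  also have "(\<integral>\<^sup>+x. ?f x \<partial>lborel) + (\<integral>\<^sup>+x. ?f x \<partial>lborel) < \<infinity>" using fin by simp
  finally show ?thesis .
qed

text \<open>
As \<open>\<bar>x\<bar> * \<bar>y\<bar> \<le> x\<^sup>2 + y\<^sup>2\<close> and the exponent is negative, the integrand is dominated by a product of integrable functions
of one variable. The axes, where the bound fails because of \<open>0 powr c = 0\<close>, are null sets.
\<close>

lemma nn_integral_radial_square:
  assumes \<gamma>: "\<gamma> \<le> 0" "2 * \<gamma> + 1 > 0"
  shows "(\<integral>\<^sup>+z. ennreal (((norm z)\<^sup>2 powr \<gamma>)\<^sup>2) * indicator (cball 0 R) z \<partial>(lborel :: complex measure)) < \<infinity>"
proof -
  define R' where "R' = max 1 R"
  have B[measurable]: "cball (0::complex) R \<in> sets borel" by simp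
  let ?I = "\<integral>\<^sup>+x. ennreal (\<bar>x\<bar> powr (2 * \<gamma>)) * indicator {-R'..R'} x \<partial>lborel"
  have fin: "?I < \<infinity>" using \<gamma> by (intro nn_integral_powr_interval) (auto simp: R'_def)
  have ptw: "ennreal (((norm (Complex x y))\<^sup>2 powr \<gamma>)\<^sup>2) * indicator (cball 0 R) (Complex x y)
     \<le> (ennreal (\<bar>x\<bar> powr (2 * \<gamma>)) * indicator {-R'..R'} x) * (ennreal (\<bar>y\<bar> powr (2 * \<gamma>)) * indicator {-R'..R'} y)"
    if xy: "x \<noteq> 0" "y \<noteq> 0" for x y
  proof (cases "Complex x y \<in> cball 0 R")
    case True
    have "\<bar>x\<bar> \<le> R'" "\<bar>y\<bar> \<le> R'"
      using True abs_Re_le_cmod[of "Complex x y"] abs_Im_le_cmod[of "Complex x y"] by (auto simp: R'_def)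
    then have i: "x \<in> {-R'..R'}" "y \<in> {-R'..R'}" by auto
    have N: "(norm (Complex x y))\<^sup>2 = x\<^sup>2 + y\<^sup>2" by (simp add: cmod_power2)
    have pos: "0 < \<bar>x\<bar> * \<bar>y\<bar>" using xy by simp
    have "0 \<le> (\<bar>x\<bar> - \<bar>y\<bar>)\<^sup>2" by simp
    then have "2 * (\<bar>x\<bar> * \<bar>y\<bar>) \<le> x\<^sup>2 + y\<^sup>2" by (simp add: power2_diff)
    then have "\<bar>x\<bar> * \<bar>y\<bar> \<le> x\<^sup>2 + y\<^sup>2" using pos by linarith
    then have "(x\<^sup>2 + y\<^sup>2) powr (2 * \<gamma>) \<le> (\<bar>x\<bar> * \<bar>y\<bar>) powr (2 * \<gamma>)"
      using \<gamma> pos by (intro powr_mono2') auto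
    also have "\<dots> = \<bar>x\<bar> powr (2 * \<gamma>) * \<bar>y\<bar> powr (2 * \<gamma>)" by (simp add: powr_mult)
    also have "(x\<^sup>2 + y\<^sup>2) powr (2 * \<gamma>) = ((x\<^sup>2 + y\<^sup>2) powr \<gamma>)\<^sup>2"
      by (simp add: power2_eq_square powr_add[symmetric])
    finally have "ennreal (((norm (Complex x y))\<^sup>2 powr \<gamma>)\<^sup>2) \<le> ennreal (\<bar>x\<bar> powr (2 * \<gamma>) * \<bar>y\<bar> powr (2 * \<gamma>))"
      unfolding N by (rule ennreal_leI)
    then show ?thesis using True i by (simp add: ennreal_mult)
  qed simp
  have ae: "AE x in lborel. x \<noteq> (0::real)" by (rule AE_lborel_singleton)
  have "(\<integral>\<^sup>+z. ennreal (((norm z)\<^sup>2 powr \<gamma>)\<^sup>2) * indicator (cball 0 R) z \<partial>(lborel :: complex measure))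
    = (\<integral>\<^sup>+x. (\<integral>\<^sup>+y. ennreal (((norm (Complex x y))\<^sup>2 powr \<gamma>)\<^sup>2) * indicator (cball 0 R) (Complex x y) \<partial>lborel) \<partial>lborel)"
    by (rule nn_integral_complex) measurable
  also have "\<dots> \<le> (\<integral>\<^sup>+x. (\<integral>\<^sup>+y. (ennreal (\<bar>x\<bar> powr (2 * \<gamma>)) * indicator {-R'..R'} x) * (ennreal (\<bar>y\<bar> powr (2 * \<gamma>)) * indicator {-R'..R'} y) \<partial>lborel) \<partial>lborel)"
  proof (rule nn_integral_mono_AE)
    show "AE x in lborel. (\<integral>\<^sup>+y. ennreal (((norm (Complex x y))\<^sup>2 powr \<gamma>)\<^sup>2) * indicator (cball 0 R) (Complex x y) \<partial>lborel)
      \<le> (\<integral>\<^sup>+y. (ennreal (\<bar>x\<bar> powr (2 * \<gamma>)) * indicator {-R'..R'} x) * (ennreal (\<bar>y\<bar> powr (2 * \<gamma>)) * indicator {-R'..R'} y) \<partial>lborel)"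
      using ae
    proof eventually_elim
      fix x :: real assume x: "x \<noteq> 0"
      show "(\<integral>\<^sup>+y. ennreal (((norm (Complex x y))\<^sup>2 powr \<gamma>)\<^sup>2) * indicator (cball 0 R) (Complex x y) \<partial>lborel)
      \<le> (\<integral>\<^sup>+y. (ennreal (\<bar>x\<bar> powr (2 * \<gamma>)) * indicator {-R'..R'} x) * (ennreal (\<bar>y\<bar> powr (2 * \<gamma>)) * indicator {-R'..R'} y) \<partial>lborel)"
      proof (rule nn_integral_mono_AE)
        show "AE y in lborel. ennreal (((norm (Complex x y))\<^sup>2 powr \<gamma>)\<^sup>2) * indicator (cball 0 R) (Complex x y)
          \<le> (ennreal (\<bar>x\<bar> powr (2 * \<gamma>)) * indicator {-R'..R'} x) * (ennreal (\<bar>y\<bar> powr (2 * \<gamma>)) * indicator {-R'..R'} y)"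
          using ae by eventually_elim (rule ptw[OF x])
      qed
    qed
  qed
  also have "\<dots> = ?I * ?I" by (simp add: nn_integral_cmult nn_integral_multc)
  also have "\<dots> < \<infinity>" using fin by (simp add: ennreal_mult_less_top)
  finally show ?thesis .
qed

lemma Lp_loc_borel:
  fixes u :: "complex \<Rightarrow> complex"
  assumes [measurable]: "u \<in> borel_measurable borel"
    and fin: "\<And>R. (\<integral>\<^sup>+z. ennreal (norm (u z) ^ p) * indicator (cball 0 R) z \<partial>lborel) < \<infinity>"
  shows "Lp_loc p UNIV u"
  unfolding Lp_loc_def lebesgue_on_UNIV_eq
proof (intro conjI allI impI)
  show "u \<in> borel_measurable lebesgue" by (rule measurable_completion) measurable
  fix C :: "complex set" assume C: "compact C \<and> C \<subseteq> UNIV"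
  then have "bounded C" using compact_imp_bounded by blast
  then obtain R where "\<forall>x\<in>C. norm x \<le> R" unfolding bounded_iff by blast
  then have R: "C \<subseteq> cball 0 R" by auto
  have Cm[measurable]: "C \<in> sets borel" using C by (simp add: borel_compact)
  have "integrable lborel (\<lambda>z. indicator C z *\<^sub>R norm (u z) ^ p)"
  proof (rule integrableI_bounded)
    have "(\<integral>\<^sup>+z. ennreal (norm (indicator C z *\<^sub>R norm (u z) ^ p)) \<partial>lborel)
      \<le> (\<integral>\<^sup>+z. ennreal (norm (u z) ^ p) * indicator (cball 0 R) z \<partial>lborel)"
      using R by (intro nn_integral_mono) (auto simp: indicator_def)
    with fin[of R] show "(\<integral>\<^sup>+z. ennreal (norm (indicator C z *\<^sub>R norm (u z) ^ p)) \<partial>lborel) < \<infinity>"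
      by (rule order_le_less_trans[rotated])
  qed measurable
  then show "set_integrable lebesgue C (\<lambda>z. norm (u z) ^ p)"
    unfolding set_integrable_def by (subst integrable_completion) auto
qed

lemma power_1_2_bound:
  fixes u :: "complex \<Rightarrow> complex"
  assumes [measurable]: "u \<in> borel_measurable borel"
    and fin: "(\<integral>\<^sup>+z. ennreal (norm (u z) ^ 2) * indicator (cball 0 R) z \<partial>lborel) < \<infinity>"
  shows "(\<integral>\<^sup>+z. ennreal (norm (u z) ^ 1) * indicator (cball 0 R) z \<partial>lborel) < \<infinity>"
proof -
  have B[measurable]: "cball (0::complex) R \<in> sets borel" by simp
  have "(\<integral>\<^sup>+z. ennreal (norm (u z) ^ 1) * indicator (cball 0 R) z \<partial>lborel)
    \<le> (\<integral>\<^sup>+z. indicator (cball 0 R) z + ennreal (norm (u z) ^ 2) * indicator (cball 0 R) z \<partial>lborel)"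
  proof (rule nn_integral_mono)
    fix z
    have "0 \<le> (norm (u z) - 1 / 2)\<^sup>2" by simp
    then have "norm (u z) ^ 1 \<le> 1 + norm (u z) ^ 2" by (simp add: power2_eq_square algebra_simps)
    then have "ennreal (norm (u z) ^ 1) \<le> ennreal (1 + norm (u z) ^ 2)" by (rule ennreal_leI)
    also have "\<dots> = 1 + ennreal (norm (u z) ^ 2)" by (subst ennreal_plus) auto
    finally show "ennreal (norm (u z) ^ 1) * indicator (cball 0 R) z \<le> indicator (cball 0 R) z + ennreal (norm (u z) ^ 2) * indicator (cball 0 R) z"
      by (cases "z \<in> cball 0 R") auto
  qed
  also have "\<dots> = emeasure lborel (cball (0::complex) R) + (\<integral>\<^sup>+z. ennreal (norm (u z) ^ 2) * indicator (cball 0 R) z \<partial>lborel)"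
    by (subst nn_integral_add) auto
  also have "\<dots> < \<infinity>" using fin cball_emeasure_finite[of R] by simp
  finally show ?thesis .
qed

lemma radial_deriv_L2:
  assumes \<gamma>: "\<gamma> \<le> 0" "2 * \<gamma> + 1 > 0" and e: "norm e = 1"
  shows "(\<integral>\<^sup>+z. ennreal (norm (radial_deriv \<gamma> e z) ^ 2) * indicator (cball 0 R) z \<partial>lborel) < \<infinity>"
proof -
  have B[measurable]: "cball (0::complex) R \<in> sets borel" by simp
  have "(\<integral>\<^sup>+z. ennreal (norm (radial_deriv \<gamma> e z) ^ 2) * indicator (cball 0 R) z \<partial>lborel)
    \<le> (\<integral>\<^sup>+z. 4 * (ennreal (((norm z)\<^sup>2 powr \<gamma>)\<^sup>2) * indicator (cball 0 R) z) \<partial>(lborel :: complex measure))"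
  proof (rule nn_integral_mono)
    fix z :: complex
    have "norm (radial_deriv \<gamma> e z) ^ 2 \<le> (2 * (norm z)\<^sup>2 powr \<gamma>)\<^sup>2"
      by (intro power_mono norm_radial_deriv_le[OF \<gamma> e]) auto
    also have "\<dots> = 4 * (((norm z)\<^sup>2 powr \<gamma>)\<^sup>2)" by (simp add: power_mult_distrib)
    finally have "ennreal (norm (radial_deriv \<gamma> e z) ^ 2) \<le> ennreal (4 * (((norm z)\<^sup>2 powr \<gamma>)\<^sup>2))" by (rule ennreal_leI)
    also have "\<dots> = 4 * ennreal (((norm z)\<^sup>2 powr \<gamma>)\<^sup>2)" by (subst ennreal_mult) auto
    finally show "ennreal (norm (radial_deriv \<gamma> e z) ^ 2) * indicator (cball 0 R) z \<le> 4 * (ennreal (((norm z)\<^sup>2 powr \<gamma>)\<^sup>2) * indicator (cball 0 R) z)"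
      by (cases "z \<in> cball 0 R") auto
  qed
  also have "\<dots> = 4 * (\<integral>\<^sup>+z. ennreal (((norm z)\<^sup>2 powr \<gamma>)\<^sup>2) * indicator (cball 0 R) z \<partial>(lborel::complex measure))"
    by (rule nn_integral_cmult) measurable
  also have "\<dots> < \<infinity>" using nn_integral_radial_square[OF \<gamma>] by (simp add: ennreal_mult_less_top)
  finally show ?thesis .
qed

lemma integral_lborel_zero_of_primitive:
  fixes h h' :: "real \<Rightarrow> complex"
  assumes R: "R > 0" and h: "\<And>t. (h has_vector_derivative h' t) (at t)" "continuous_on UNIV h'"
    and z: "\<And>t. \<bar>t\<bar> \<ge> R \<Longrightarrow> h t = 0" "\<And>t. \<bar>t\<bar> \<ge> R \<Longrightarrow> h' t = 0"
  shows "(\<integral>t. h' t \<partial>lborel) = 0"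
proof -
  have i: "set_integrable lborel {-R..R} h'"
    unfolding set_integrable_def by (intro borel_integrable_compact continuous_on_subset[OF h(2)]) auto
  have "(\<integral>t. h' t \<partial>lborel) = (LINT t:{-R..R}|lborel. h' t)"
    unfolding set_lebesgue_integral_def
    by (rule arg_cong[where f = "integral\<^sup>L lborel"]) (use z(2) in \<open>force simp: indicator_def fun_eq_iff\<close>)
  also have "\<dots> = integral {-R..R} h'" by (rule set_borel_integral_eq_integral(2)[OF i])
  also have "\<dots> = h R - h (-R)"
    using R h(1) by (intro integral_unique fundamental_theorem_of_calculus) (auto intro: has_vector_derivative_at_within)
  also have "\<dots> = 0" using z(1)[of R] z(1)[of "-R"] R by simp
  finally show ?thesis .
qed

lemma integral_complex_zero:
  fixes u :: "complex \<Rightarrow> complex"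
  assumes u: "integrable lborel u"
  shows "(\<And>y. y \<noteq> 0 \<Longrightarrow> (\<integral>x. u (Complex x y) \<partial>lborel) = 0) \<Longrightarrow> (\<integral>z. u z \<partial>lborel) = 0"
    and "(\<And>x. x \<noteq> 0 \<Longrightarrow> (\<integral>y. u (Complex x y) \<partial>lborel) = 0) \<Longrightarrow> (\<integral>z. u z \<partial>lborel) = 0"
proof -
  have um[measurable]: "u \<in> borel_measurable borel" using borel_measurable_integrable[OF u] by simp
  have c: "(\<lambda>(x, y). Complex x y) \<in> lborel \<Otimes>\<^sub>M lborel \<rightarrow>\<^sub>M borel" by measurable
  define v where "v = (\<lambda>x y. u (Complex x y))"
  have veq: "(\<lambda>p. u (case p of (x, y) \<Rightarrow> Complex x y)) = case_prod v" by (auto simp: v_def)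
  have iv: "integrable (lborel \<Otimes>\<^sub>M lborel) (case_prod v)"
    using u integrable_distr_eq[OF c um] lborel_complex unfolding veq by simp
  have eq: "(\<integral>z. u z \<partial>lborel) = integral\<^sup>L (lborel \<Otimes>\<^sub>M lborel) (case_prod v)"
    using integral_distr[OF c um] lborel_complex unfolding veq by simp
  have ae: "AE x in lborel. x \<noteq> (0::real)" by (rule AE_lborel_singleton)
  show "(\<integral>z. u z \<partial>lborel) = 0" if z: "\<And>y. y \<noteq> 0 \<Longrightarrow> (\<integral>x. u (Complex x y) \<partial>lborel) = 0"
  proof -
    have "(\<integral>y. (\<integral>x. v x y \<partial>lborel) \<partial>lborel) = 0"
      by (rule integral_eq_zero_AE) (use ae z in \<open>auto simp: v_def elim!: eventually_mono\<close>)
    then show ?thesis using lborel_pair.integral_snd[OF iv] eq by simp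
  qed
  show "(\<integral>z. u z \<partial>lborel) = 0" if z: "\<And>x. x \<noteq> 0 \<Longrightarrow> (\<integral>y. u (Complex x y) \<partial>lborel) = 0"
  proof -
    have "(\<integral>x. (\<integral>y. v x y \<partial>lborel) \<partial>lborel) = 0"
      by (rule integral_eq_zero_AE) (use ae z in \<open>auto simp: v_def elim!: eventually_mono\<close>)
    then show ?thesis using lborel_pair.integral_fst[OF iv] eq by simp
  qed
qed

lemma radial_line_derivative:
  assumes nz: "c + t *\<^sub>R e \<noteq> 0"
  shows "((\<lambda>t. radial \<gamma> (c + t *\<^sub>R e)) has_vector_derivative radial_deriv \<gamma> e (c + t *\<^sub>R e)) (at t)"
proof -
  let ?p = "\<lambda>t. c + t *\<^sub>R e"
  have p: "(?p has_vector_derivative e) (at t)" by (auto intro!: derivative_eq_intros)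
  have "((\<lambda>t. ?p t \<bullet> ?p t) has_derivative (\<lambda>h. ?p t \<bullet> (h *\<^sub>R e) + (h *\<^sub>R e) \<bullet> ?p t)) (at t)"
    using p unfolding has_vector_derivative_def by (intro has_derivative_inner)
  moreover have "(\<lambda>h. ?p t \<bullet> (h *\<^sub>R e) + (h *\<^sub>R e) \<bullet> ?p t) = (*) (2 * (?p t \<bullet> e))"
  proof
    have "P \<bullet> (h *\<^sub>R e) + (h *\<^sub>R e) \<bullet> P = 2 * (P \<bullet> e) * h" for P h
      by (simp add: inner_commute[of e P])
    then show "?p t \<bullet> (h *\<^sub>R e) + (h *\<^sub>R e) \<bullet> ?p t = 2 * (?p t \<bullet> e) * h" for h .
  qed
  ultimately have q: "((\<lambda>t. (norm (?p t))\<^sup>2) has_real_derivative 2 * (?p t \<bullet> e)) (at t)"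
    by (simp add: has_field_derivative_def power2_norm_eq_inner)
  have "(norm (?p t))\<^sup>2 > 0" using nz by simp
  from DERIV_chain2[OF has_real_derivative_powr[OF this] q]
  have "((\<lambda>t. (norm (?p t))\<^sup>2 powr \<gamma>) has_real_derivative \<gamma> * (norm (?p t))\<^sup>2 powr (\<gamma> - 1) * (2 * (?p t \<bullet> e))) (at t)" .
  then have r: "((\<lambda>t. of_real ((norm (?p t))\<^sup>2 powr \<gamma>) :: complex) has_vector_derivative
      of_real (\<gamma> * (norm (?p t))\<^sup>2 powr (\<gamma> - 1) * (2 * (?p t \<bullet> e)))) (at t)"
    unfolding has_real_derivative_iff_has_vector_derivative
    by (rule bounded_linear.has_vector_derivative[OF bounded_linear_of_real])
  from has_vector_derivative_mult[OF r p]
  have "((\<lambda>t. of_real ((norm (?p t))\<^sup>2 powr \<gamma>) * ?p t) has_vector_derivative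
     of_real ((norm (?p t))\<^sup>2 powr \<gamma>) * e + of_real (\<gamma> * (norm (?p t))\<^sup>2 powr (\<gamma> - 1) * (2 * (?p t \<bullet> e))) * ?p t) (at t)" .
  moreover have "\<gamma> * (norm (?p t))\<^sup>2 powr (\<gamma> - 1) * (2 * (?p t \<bullet> e)) = 2 * \<gamma> * (?p t \<bullet> e) * (norm (?p t))\<^sup>2 powr (\<gamma> - 1)"
    by simp
  ultimately show ?thesis unfolding radial_def radial_deriv_def by simp
qed

text \<open>
On every line in direction \<open>e\<close> that misses the origin, \<open>\<phi> * radial \<gamma>\<close> is continuously differentiable with compact support,
so the integral of its derivative vanishes. All lines but one miss the origin, and the
derivative is integrable over the plane, so Fubini gives the integration by parts.
\<close>

lemma weak_partial_radial:
  assumes \<gamma>: "\<gamma> \<le> 0" "2 * \<gamma> + 1 > 0" and e: "e = 1 \<or> e = \<i>"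
  shows "weak_partial UNIV e (radial \<gamma>) (radial_deriv \<gamma> e)"
proof -
  have e1: "norm e = 1" using e by auto
  have fc: "continuous_on UNIV (radial \<gamma>)" by (rule continuous_radial[OF \<gamma>(2)])
  have fm[measurable]: "radial \<gamma> \<in> borel_measurable borel" using fc by (rule borel_measurable_continuous_onI)
  note d2 = radial_deriv_L2[OF \<gamma> e1]
  note d1 = power_1_2_bound[OF borel_radial_deriv d2]
  have int: "(LINT z:UNIV|lebesgue. frechet_derivative \<phi> (at z) e *\<^sub>R radial \<gamma> z) = - (LINT z:UNIV|lebesgue. \<phi> z *\<^sub>R radial_deriv \<gamma> e z)"
    if tf: "test_function UNIV \<phi>" for \<phi>
  proof -
    have C1: "Ck (Suc 0) \<phi>" and cpt: "compact (closure {z. \<phi> z \<noteq> 0})" using tf unfolding test_function_def by blast+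
    have diff: "\<phi> differentiable (at z)" for z using C1 by (simp add: differentiable_on_def)
    then have der: "(\<phi> has_derivative frechet_derivative \<phi> (at z)) (at z)" for z using frechet_derivative_works by blast
    define \<psi> where "\<psi> z = frechet_derivative \<phi> (at z) e" for z
    have \<psi>c: "continuous_on UNIV \<psi>" using C1 by (simp add: \<psi>_def[abs_def])
    have \<phi>c: "continuous_on UNIV \<phi>" using der by (meson continuous_at_imp_continuous_on has_derivative_continuous)
    have [measurable]: "\<phi> \<in> borel_measurable borel" "\<psi> \<in> borel_measurable borel"
      using \<phi>c \<psi>c by (auto intro: borel_measurable_continuous_onI)
    obtain R0 where "\<forall>z\<in>closure {z. \<phi> z \<noteq> 0}. norm z \<le> R0" using compact_imp_bounded[OF cpt] unfolding bounded_iff by blast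
    then have R0: "norm z \<le> R0" if "z \<in> closure {z. \<phi> z \<noteq> 0}" for z using that by blast
    define R where "R = \<bar>R0\<bar> + 1"
    have R: "R > 0" by (simp add: R_def)
    have out: "z \<notin> closure {z. \<phi> z \<noteq> 0}" if "norm z \<ge> R" for z using R0[of z] that by (auto simp: R_def)
    have \<phi>0: "\<phi> z = 0" if "norm z \<ge> R" for z
      using out[OF that] closure_subset[of "{z. \<phi> z \<noteq> 0}"] by blast
    have \<psi>0: "\<psi> z = 0" if "norm z \<ge> R" for z
    proof -
      have op: "open (- closure {z. \<phi> z \<noteq> 0})" by (rule open_Compl[OF closed_closure])
      have zin: "z \<in> - closure {z. \<phi> z \<noteq> 0}" using out[OF that] by simp
      have "((\<lambda>_. 0) has_derivative (\<lambda>_. 0)) (at z)" by simp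
      from this op zin have "(\<phi> has_derivative (\<lambda>_. 0)) (at z)"
      proof (rule has_derivative_transform_within_open)
        fix w assume "w \<in> - closure {z. \<phi> z \<noteq> 0}"
        then show "0 = \<phi> w" using closure_subset[of "{z. \<phi> z \<noteq> 0}"] by auto
      qed
      from frechet_derivative_at[OF this] show ?thesis unfolding \<psi>_def by metis
    qed
    have i1: "integrable lborel (\<lambda>z. \<psi> z *\<^sub>R radial \<gamma> z)"
      by (rule compact_support_integrable[where d = R]) (use \<psi>0 in \<open>auto intro!: continuous_intros \<psi>c fc\<close>)
    have "bounded (\<phi> ` cball 0 R)" by (intro compact_imp_bounded compact_continuous_image continuous_on_subset[OF \<phi>c]) auto
    then obtain M where M0: "\<forall>z\<in>cball 0 R. \<bar>\<phi> z\<bar> \<le> M" unfolding bounded_iff by auto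
    have M: "\<bar>\<phi> z\<bar> \<le> max M 0" for z
    proof (cases "z \<in> cball 0 R")
      case True
      then have "\<bar>\<phi> z\<bar> \<le> M" using M0 by blast
      then show ?thesis by simp
    qed (use \<phi>0[of z] in simp)
    have i2: "integrable lborel (\<lambda>z. \<phi> z *\<^sub>R radial_deriv \<gamma> e z)"
    proof (rule integrableI_bounded)
      have B[measurable]: "cball (0::complex) R \<in> sets borel" by simp
      have "(\<integral>\<^sup>+z. ennreal (norm (\<phi> z *\<^sub>R radial_deriv \<gamma> e z)) \<partial>lborel)
        \<le> (\<integral>\<^sup>+z. ennreal (max M 0) * (ennreal (norm (radial_deriv \<gamma> e z) ^ 1) * indicator (cball 0 R) z) \<partial>lborel)"
      proof (rule nn_integral_mono)
        fix z
        show "ennreal (norm (\<phi> z *\<^sub>R radial_deriv \<gamma> e z)) \<le> ennreal (max M 0) * (ennreal (norm (radial_deriv \<gamma> e z) ^ 1) * indicator (cball 0 R) z)"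
        proof (cases "z \<in> cball 0 R")
          case True
          have "norm (\<phi> z *\<^sub>R radial_deriv \<gamma> e z) \<le> max M 0 * norm (radial_deriv \<gamma> e z)"
            unfolding norm_scaleR real_norm_def by (intro mult_right_mono M) simp
          then have "ennreal (norm (\<phi> z *\<^sub>R radial_deriv \<gamma> e z)) \<le> ennreal (max M 0 * norm (radial_deriv \<gamma> e z))" by (rule ennreal_leI)
          also have "\<dots> = ennreal (max M 0) * ennreal (norm (radial_deriv \<gamma> e z))" by (rule ennreal_mult) auto
          finally show ?thesis using True by simp
        next
          case False
          then have "\<phi> z = 0" by (intro \<phi>0) simp
          then show ?thesis by simp
        qed
      qed
      also have "\<dots> = ennreal (max M 0) * (\<integral>\<^sup>+z. ennreal (norm (radial_deriv \<gamma> e z) ^ 1) * indicator (cball 0 R) z \<partial>lborel)"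
        by (rule nn_integral_cmult) measurable
      also have "\<dots> < \<infinity>" using d1[of R] by (simp add: ennreal_mult_less_top)
      finally show "(\<integral>\<^sup>+z. ennreal (norm (\<phi> z *\<^sub>R radial_deriv \<gamma> e z)) \<partial>lborel) < \<infinity>" .
    qed measurable
    define u where "u z = \<psi> z *\<^sub>R radial \<gamma> z + \<phi> z *\<^sub>R radial_deriv \<gamma> e z" for z
    have iu: "integrable lborel u" unfolding u_def using i1 i2 by (rule Bochner_Integration.integrable_add)
    have line: "(\<integral>t. u (c + t *\<^sub>R e) \<partial>lborel) = 0" if nz: "\<And>t. c + t *\<^sub>R e \<noteq> 0" for c
    proof (rule integral_lborel_zero_of_primitive)
      let ?p = "\<lambda>t. c + t *\<^sub>R e"
      have pc: "continuous_on UNIV ?p" by (intro continuous_intros)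
      have far: "norm (?p t) \<ge> R" if "\<bar>t\<bar> \<ge> R + norm c" for t
        using norm_triangle_ineq2[of "t *\<^sub>R e" "- c"] that e1 by (simp add: add.commute)
      show "0 < R + norm c" using R by (simp add: add_pos_nonneg)
      show "((\<lambda>t. \<phi> (?p t) *\<^sub>R radial \<gamma> (?p t)) has_vector_derivative u (?p t)) (at t)" for t
      proof -
        have p: "(?p has_vector_derivative e) (at t)" by (auto intro!: derivative_eq_intros)
        have "(\<phi> \<circ> ?p has_vector_derivative frechet_derivative \<phi> (at (?p t)) e) (at t)"
          using vector_derivative_diff_chain_within[OF p has_derivative_at_withinI[OF der]] by simp
        then have \<phi>d: "((\<lambda>t. \<phi> (?p t)) has_real_derivative \<psi> (?p t)) (at t)"
          unfolding has_real_derivative_iff_has_vector_derivative by (simp add: o_def \<psi>_def)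
        from has_vector_derivative_scaleR[OF \<phi>d radial_line_derivative[OF nz]]
        show ?thesis by (simp add: u_def add.commute)
      qed
      have "continuous_on UNIV (\<lambda>t. radial_deriv \<gamma> e (?p t))"
        unfolding radial_deriv_def using nz by (intro continuous_intros) auto
      then show "continuous_on UNIV (\<lambda>t. u (?p t))"
        unfolding u_def
        by (intro continuous_on_add continuous_on_scaleR continuous_on_compose2[OF \<psi>c pc] continuous_on_compose2[OF \<phi>c pc] continuous_on_compose2[OF fc pc]) auto
      show "\<phi> (?p t) *\<^sub>R radial \<gamma> (?p t) = 0" "u (?p t) = 0" if "\<bar>t\<bar> \<ge> R + norm c" for t
        using \<phi>0[OF far[OF that]] \<psi>0[OF far[OF that]] by (simp_all add: u_def)
    qed
    have "(\<integral>z. u z \<partial>lborel) = 0"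
      using e
    proof
      assume e: "e = 1"
      show ?thesis
      proof (rule integral_complex_zero(1)[OF iu])
        fix y :: real assume y: "y \<noteq> 0"
        have q: "(\<lambda>t. u (Complex t y)) = (\<lambda>t. u (Complex 0 y + t *\<^sub>R e))"
          by (intro ext arg_cong[where f = u]) (simp add: e complex_eq_iff)
        have "Complex 0 y + t *\<^sub>R e \<noteq> 0" for t using y by (simp add: e complex_eq_iff)
        from line[OF this] have z: "(\<integral>t. u (Complex 0 y + t *\<^sub>R e) \<partial>lborel) = 0" .
        show "(\<integral>x. u (Complex x y) \<partial>lborel) = 0" using z unfolding q .
      qed
    next
      assume e: "e = \<i>"
      show ?thesis
      proof (rule integral_complex_zero(2)[OF iu])
        fix x :: real assume x: "x \<noteq> 0"
        have q: "(\<lambda>t. u (Complex x t)) = (\<lambda>t. u (Complex x 0 + t *\<^sub>R e))"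
          by (intro ext arg_cong[where f = u]) (simp add: e complex_eq_iff)
        have "Complex x 0 + t *\<^sub>R e \<noteq> 0" for t using x by (simp add: e complex_eq_iff)
        from line[OF this] have z: "(\<integral>t. u (Complex x 0 + t *\<^sub>R e) \<partial>lborel) = 0" .
        show "(\<integral>y. u (Complex x y) \<partial>lborel) = 0" using z unfolding q .
      qed
    qed
    then have "(\<integral>z. \<psi> z *\<^sub>R radial \<gamma> z \<partial>lborel) + (\<integral>z. \<phi> z *\<^sub>R radial_deriv \<gamma> e z \<partial>lborel) = 0"
      unfolding u_def using i1 i2 by (subst (asm) Bochner_Integration.integral_add)
    moreover have "(\<integral>z. \<psi> z *\<^sub>R radial \<gamma> z \<partial>lebesgue) = (\<integral>z. \<psi> z *\<^sub>R radial \<gamma> z \<partial>lborel)"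
      by (rule integral_completion) measurable
    moreover have "(\<integral>z. \<phi> z *\<^sub>R radial_deriv \<gamma> e z \<partial>lebesgue) = (\<integral>z. \<phi> z *\<^sub>R radial_deriv \<gamma> e z \<partial>lborel)"
      by (rule integral_completion) measurable
    ultimately show ?thesis
      unfolding set_lebesgue_integral_def \<psi>_def by (simp add: eq_neg_iff_add_eq_0)
  qed
  have "Lp_loc 1 UNIV (radial \<gamma>)" by (rule Lp_loc_borel[OF fm cball_nn_finite_continuous[OF fc]])
  moreover have "Lp_loc 1 UNIV (radial_deriv \<gamma> e)" by (rule Lp_loc_borel[OF borel_radial_deriv d1])
  ultimately show ?thesis unfolding weak_partial_def using int by blast
qed

text \<open>
The exponent \<open>\<alpha>\<close> is the power of the modulus: \<open>norm (radial ((\<alpha> - 1) / 2) z) = norm z powr \<alpha>\<close>.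
\<close>

lemma quasiconformal_radial:
  assumes \<alpha>: "0 < \<alpha>" "\<alpha> \<le> 1" and K: "K * \<alpha> \<ge> 1"
  shows "quasiconformal_map K UNIV UNIV (radial ((\<alpha> - 1) / 2))"
proof -
  define \<gamma> where "\<gamma> = (\<alpha> - 1) / 2"
  have g: "2 * \<gamma> + 1 = \<alpha>" by (simp add: \<gamma>_def field_simps)
  have \<gamma>: "\<gamma> \<le> 0" "2 * \<gamma> + 1 > 0" using \<alpha> unfolding g by (simp_all add: \<gamma>_def)
  have K1: "K \<ge> 1"
  proof (rule ccontr)
    assume "\<not> K \<ge> 1"
    then have "K * \<alpha> < 1 * \<alpha>" using \<alpha> by (intro mult_strict_right_mono) auto
    with K \<alpha> show False by simp
  qed
  have fc: "continuous_on UNIV (radial \<gamma>)" by (rule continuous_radial[OF \<gamma>(2)])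
  have fm: "radial \<gamma> \<in> borel_measurable borel" using fc by (rule borel_measurable_continuous_onI)
  have w: "weak_partial UNIV 1 (radial \<gamma>) (radial_deriv \<gamma> 1)" "weak_partial UNIV \<i> (radial \<gamma>) (radial_deriv \<gamma> \<i>)"
    by (rule weak_partial_radial[OF \<gamma>]; simp)+
  have L: "Lp_loc 2 UNIV (radial_deriv \<gamma> e)" if "norm e = 1" for e
    by (rule Lp_loc_borel[OF borel_radial_deriv radial_deriv_L2[OF \<gamma> that]])
  have "Lp_loc 2 UNIV (radial \<gamma>)" by (rule Lp_loc_borel[OF fm cball_nn_finite_continuous[OF fc]])
  then have "W12_loc UNIV (radial \<gamma>)" unfolding W12_loc_def using w L[of 1] L[of \<i>] by auto
  moreover have "distortion_inequality K UNIV (radial \<gamma>)"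
    unfolding distortion_inequality_def
    using w radial_distortion[OF \<gamma>, of K] K unfolding g by (intro exI[of _ "radial_deriv \<gamma> 1"] exI[of _ "radial_deriv \<gamma> \<i>"]) auto
  moreover have "\<exists>h. homeomorphism UNIV UNIV (radial \<gamma>) h"
    using homeomorphism_radial[OF \<alpha>(1)] unfolding \<gamma>_def by blast
  ultimately show ?thesis
    unfolding quasiconformal_map_def \<gamma>_def[symmetric] using K1 by (auto simp: connected_UNIV)
qed

section \<open>The classification\<close>

theorem theorem1p1:
  fixes a b K :: real
  assumes "b > 0" and "a > b" and "K \<ge> 1"
  shows "(\<exists>f. quasiconformal_map K UNIV UNIV f \<and> f ` spiral a = spiral b) \<longleftrightarrow> K \<ge> a / b"
proof
  assume "\<exists>f. quasiconformal_map K UNIV UNIV f \<and> f ` spiral a = spiral b"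
  then show "K \<ge> a / b" using quasiconformal_spiral_lower_bound[OF assms(1,2)] by blast
next
  assume K: "K \<ge> a / b"
  have a: "a > 0" using assms by simp
  have "quasiconformal_map K UNIV UNIV (radial ((b / a - 1) / 2))"
    by (rule quasiconformal_radial) (use K a assms in \<open>simp_all add: field_simps\<close>)
  with radial_spiral[OF a, of b] show "\<exists>f. quasiconformal_map K UNIV UNIV f \<and> f ` spiral a = spiral b" by blast
qed

end
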